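(* Let $N\ge2$ be an integer, $1<p<N$, $\alpha\in\mathbb{R}$, $p-1<q<\frac{(N+\alpha)p}{N-p}-1$, and let $u$ be a nonnegative (not necessarily radial) solution of $-\Delta_p u=|x|^{\alpha}u^q$ in $\mathbb{R}^N$ satisfying $|x|^{\frac{p+\alpha}{q+1-p}}u(x)\le C$ for some constant $C>0$. Then $u\equiv0$.
   Context: $\Delta_p u=\mathrm{div}(|\nabla u|^{p-2}\nabla u)$. A solution of $-\Delta_p u=|x|^\alpha u^q$ in $\Omega$ always means a continuous solution: $u$ is continuous in $\Omega$, $\nabla u\in L^p_{loc}(\Omega)$, and $\int_\Omega|\nabla u|^{p-2}\nabla u\cdot\nabla\phi\,dx=\int_\Omega|x|^\alpha u^q\phi\,dx$ for all $\phi\in C_c^\infty(\Omega)$; here $\Omega=\mathbb{R}^N$. *)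

theory Defs
  imports "HOL-Analysis.Analysis"
begin

text \<open>
  \<open>Ck k f\<close>: all iterated partial derivatives of \<open>f\<close> of order at most \<open>k\<close> exist and are continuous
  on the whole space. From order one on, Frechet differentiability is required at each step,
  which for continuous partial derivatives is automatic.
\<close>

primrec Ck :: "nat \<Rightarrow> ('a::euclidean_space \<Rightarrow> real) \<Rightarrow> bool" where
  "Ck 0 f \<longleftrightarrow> continuous_on UNIV f"
| "Ck (Suc k) f \<longleftrightarrow> (\<exists>g. (\<forall>x. GDERIV f x :> g x) \<and> (\<forall>b\<in>Basis. Ck k (\<lambda>x. g x \<bullet> b)))"

definition grad :: "('a::euclidean_space \<Rightarrow> real) \<Rightarrow> 'a \<Rightarrow> 'a" where
  "grad f x = (THE D. GDERIV f x :> D)"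

text \<open>
  The class of smooth functions with compact support in \<open>\<Omega>\<close>, each extended by zero to the
  whole space.
\<close>

definition test_function :: "'a::euclidean_space set \<Rightarrow> ('a \<Rightarrow> real) \<Rightarrow> bool" where
  "test_function \<Omega> \<phi> \<longleftrightarrow>
     (\<forall>k. Ck k \<phi>) \<and>
     compact (closure (support_on UNIV \<phi>)) \<and> closure (support_on UNIV \<phi>) \<subseteq> \<Omega>"

definition Lp_loc ::
  "real \<Rightarrow> 'a::euclidean_space set \<Rightarrow> ('a \<Rightarrow> 'b::euclidean_space) \<Rightarrow> bool" where
  "Lp_loc p \<Omega> f \<longleftrightarrow>
     f \<in> borel_measurable (lebesgue_on \<Omega>) \<and>
     (\<forall>K. compact K \<and> K \<subseteq> \<Omega> \<longrightarrow> integrable (lebesgue_on K) (\<lambda>x. norm (f x) powr p))"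

definition weak_gradient ::
  "'a::euclidean_space set \<Rightarrow> ('a \<Rightarrow> real) \<Rightarrow> ('a \<Rightarrow> 'a) \<Rightarrow> bool" where
  "weak_gradient \<Omega> u G \<longleftrightarrow>
     Lp_loc 1 \<Omega> u \<and> Lp_loc 1 \<Omega> G \<and>
     (\<forall>\<phi>. test_function \<Omega> \<phi> \<longrightarrow>
        (LINT x|lebesgue_on \<Omega>. u x *\<^sub>R grad \<phi> x) = - (LINT x|lebesgue_on \<Omega>. \<phi> x *\<^sub>R G x))"

text \<open>
  Continuous solutions of \<open>- \<Delta>\<^sub>p u = |x|\<^sup>\<alpha> u\<^sup>q\<close> in an open set \<open>\<Omega>\<close>, intended for \<open>p > 1\<close>, \<open>q > 0\<close>
  and \<open>u \<ge> 0\<close>. The weak gradient \<open>G\<close> of \<open>u\<close> is unique up to a null set.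

  Local integrability of the right-hand side says that its integral against every test function
  exists; Isabelle's integral would otherwise be 0 by convention. It follows from continuity of
  \<open>u\<close> when \<open>\<alpha> > - N\<close> (\<open>N\<close> being the dimension).

  Since \<open>0 powr a = 0\<close> for every \<open>a\<close>, the weight takes the value 0 at the origin, a null set, and
  \<open>|G|\<^sup>p\<^sup>-\<^sup>2 G\<close> is 0 wherever \<open>G = 0\<close>, also for \<open>p < 2\<close>.
\<close>

definition continuous_solution ::
  "real \<Rightarrow> real \<Rightarrow> real \<Rightarrow> 'a::euclidean_space set \<Rightarrow> ('a \<Rightarrow> real) \<Rightarrow> bool" where
  "continuous_solution p \<alpha> q \<Omega> u \<longleftrightarrow>
     continuous_on \<Omega> u \<and>
     Lp_loc 1 \<Omega> (\<lambda>x. norm x powr \<alpha> * u x powr q) \<and>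
     (\<exists>G. weak_gradient \<Omega> u G \<and> Lp_loc p \<Omega> G \<and>
        (\<forall>\<phi>. test_function \<Omega> \<phi> \<longrightarrow>
           (LINT x|lebesgue_on \<Omega>. (norm (G x) powr (p - 2) *\<^sub>R G x) \<bullet> grad \<phi> x) =
           (LINT x|lebesgue_on \<Omega>. norm x powr \<alpha> * u x powr q * \<phi> x)))"

end

theory Submission
  imports Defs
begin

text \<open>
  The idea is Pohozaev's identity, obtained variationally: since \<open>u\<close> is only a continuous weak
  solution, the usual multiplier \<open>x \<bullet> \<nabla>u\<close> is not available, and it is replaced by the difference
  between \<open>u\<close> and its dilation \<open>u(l \<cdot>)\<close>.

  Write \<open>\<gamma> = (p + \<alpha>)/(q + 1 - p)\<close> for the decay rate of \<open>u\<close> and \<open>N\<close> for the dimension. Subcriticality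
  means \<open>\<gamma> p + p > N\<close>, so a Caccioppoli estimate shows that \<open>\<nabla>u\<close> lies in \<open>L\<^sup>p\<close> on the whole space
  (\<open>G_Lp\<close>), and every \<open>v\<close> that decays like \<open>u\<close> and has its gradient in \<open>L\<^sup>p\<close> is an admissible test
  function (\<open>test_decaying\<close>). With \<open>v = u\<close> this gives
  \<open>E = \<integral>|\<nabla>u|\<^sup>p = \<integral>|x|\<^sup>\<alpha> u\<^sup>q\<^sup>+\<^sup>1\<close>.

  For \<open>v = u(l \<cdot>)\<close>, consider \<open>h(l) = \<integral>|x|\<^sup>\<alpha> u\<^sup>q u(l \<cdot>)\<close>. Young's inequality in the equation gives
  \<open>h(l) \<le> (1 - 1/p) E + l\<^sup>p\<^sup>-\<^sup>N E/p\<close> (\<open>dilation_upper\<close>). Convexity of \<open>t\<^sup>q\<^sup>+\<^sup>1\<close> gives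
  \<open>h(l) \<ge> E + (l\<^sup>-\<^sup>(\<^sup>N\<^sup>+\<^sup>\<alpha>\<^sup>) - 1) E/(q + 1)\<close> up to the error
  \<open>\<integral>|x|\<^sup>\<alpha> |u(lx)\<^sup>q - u(x)\<^sup>q| |u(lx) - u(x)|\<close> (\<open>dilation_lower\<close>). The last factor, divided by \<open>(1 - l) |x|\<close>,
  is bounded in \<open>L\<^sup>p\<close> by the norm of the gradient (\<open>dilation_difference_bound\<close>), and the other one
  tends to zero in the dual norm, so the error is \<open>o(1 - l)\<close>. Comparing first order terms as \<open>l\<close>
  increases to 1 yields \<open>(N + \<alpha>) E/(q + 1) \<le> (N - p) E/p\<close> (\<open>pohozaev_inequality\<close>), which
  contradicts subcriticality unless \<open>E = 0\<close>.

  Two steps need smooth approximations of a compactly supported function with weak gradient in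
  \<open>L\<^sup>p\<close>: extending the equation from smooth test functions to products of \<open>v\<close> and a cutoff
  (\<open>weak_equation_extends\<close>), and the bound on \<open>u(lx) - u(x)\<close> (\<open>dilation_difference\<close>). Both use
  mollification, whose gradients converge weakly in \<open>L\<^sup>p\<close> without increase of the norm.
\<close>

section \<open>Smooth functions and test functions\<close>

lemma gderiv_unique: "GDERIV f x :> d \<Longrightarrow> GDERIV f x :> d' \<Longrightarrow> d = d'"
  unfolding gderiv_def using has_derivative_unique[of f _ x]
  by (metis inner_commute vector_eq_ldot)

lemma grad_eq: "GDERIV f x :> d \<Longrightarrow> grad f x = d"
  unfolding grad_def by (rule the_equality) (auto intro: gderiv_unique)

lemma gderiv_continuous: "(\<And>x. GDERIV f x :> g x) \<Longrightarrow> continuous_on UNIV f"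
  unfolding gderiv_def by (meson continuous_at_imp_continuous_on has_derivative_continuous)

lemma Ck_SucD: "Ck (Suc k) f \<Longrightarrow> Ck k f"
proof (induction k arbitrary: f)
  case 0 then show ?case using gderiv_continuous[of f] by auto
next
  case (Suc k)
  then obtain g where "\<And>x. GDERIV f x :> g x" "\<And>b. b\<in>Basis \<Longrightarrow> Ck (Suc k) (\<lambda>x. g x \<bullet> b)"
    by (metis Ck.simps(2))
  with Suc.IH show ?case by (auto intro!: exI[of _ g])
qed

lemma Ck_continuous: "Ck k f \<Longrightarrow> continuous_on UNIV f"
proof (induction k)
  case (Suc k) then show ?case using Ck_SucD by blast
qed auto

lemma Ck_SucI:
  "(\<And>x. GDERIV f x :> g x) \<Longrightarrow> (\<And>b. b\<in>Basis \<Longrightarrow> Ck k (\<lambda>x. g x \<bullet> b)) \<Longrightarrow> Ck (Suc k) f"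
  by auto

lemma Ck_const: "Ck k (\<lambda>x. c)"
proof (induction k arbitrary: c)
  case (Suc k)
  show ?case by (rule Ck_SucI[where g="\<lambda>_. 0"]) (auto intro: GDERIV_const Suc)
qed auto

lemma Ck_inner: "Ck k (\<lambda>x. x \<bullet> b)"
proof (cases k)
  case (Suc k')
  have "GDERIV (\<lambda>x. x \<bullet> b) x :> b" for x
    unfolding gderiv_def by (auto intro!: derivative_eq_intros)
  then show ?thesis unfolding Suc by (rule Ck_SucI) (rule Ck_const)
qed (auto intro!: continuous_intros)

lemma Ck_add: "Ck k f \<Longrightarrow> Ck k h \<Longrightarrow> Ck k (\<lambda>x. f x + h x)"
proof (induction k arbitrary: f h)
  case 0 then show ?case by (simp add: continuous_on_add)
next
  case (Suc k)
  obtain g where g: "\<And>x. GDERIV f x :> g x" "\<And>b. b\<in>Basis \<Longrightarrow> Ck k (\<lambda>x. g x \<bullet> b)"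
    using Suc.prems(1) by auto
  obtain g' where g': "\<And>x. GDERIV h x :> g' x" "\<And>b. b\<in>Basis \<Longrightarrow> Ck k (\<lambda>x. g' x \<bullet> b)"
    using Suc.prems(2) by auto
  show ?case
  proof (rule Ck_SucI)
    show "GDERIV (\<lambda>x. f x + h x) x :> g x + g' x" for x
      by (rule GDERIV_add[OF g(1) g'(1)])
    show "Ck k (\<lambda>x. (g x + g' x) \<bullet> b)" if "b \<in> Basis" for b
      using Suc.IH[OF g(2)[OF that] g'(2)[OF that]] by (simp only: inner_add_left)
  qed
qed

lemma Ck_mult: "Ck k f \<Longrightarrow> Ck k h \<Longrightarrow> Ck k (\<lambda>x. f x * h x)"
proof (induction k arbitrary: f h)
  case 0 then show ?case by (simp add: continuous_on_mult)
next
  case (Suc k)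
  obtain g where g: "\<And>x. GDERIV f x :> g x" "\<And>b. b\<in>Basis \<Longrightarrow> Ck k (\<lambda>x. g x \<bullet> b)"
    using Suc.prems(1) by auto
  obtain g' where g': "\<And>x. GDERIV h x :> g' x" "\<And>b. b\<in>Basis \<Longrightarrow> Ck k (\<lambda>x. g' x \<bullet> b)"
    using Suc.prems(2) by auto
  show ?case
  proof (rule Ck_SucI)
    show "GDERIV (\<lambda>x. f x * h x) x :> f x *\<^sub>R g' x + h x *\<^sub>R g x" for x
      by (rule GDERIV_mult[OF g(1) g'(1)])
    show "Ck k (\<lambda>x. (f x *\<^sub>R g' x + h x *\<^sub>R g x) \<bullet> b)" if "b \<in> Basis" for b
      using Ck_add[OF Suc.IH[OF Ck_SucD[OF Suc.prems(1)] g'(2)[OF that]]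
          Suc.IH[OF Ck_SucD[OF Suc.prems(2)] g(2)[OF that]]]
      by (simp only: inner_add_left inner_scaleR_left)
  qed
qed

lemma Ck_power: "Ck k f \<Longrightarrow> Ck k (\<lambda>x. f x ^ m)"
  by (induction m) (auto intro: Ck_const Ck_mult)

lemma gderiv_affine:
  assumes "GDERIV f (c *\<^sub>R x + d) :> g"
  shows "GDERIV (\<lambda>x. f (c *\<^sub>R x + d)) x :> c *\<^sub>R g"
proof -
  have "((\<lambda>x. c *\<^sub>R x + d) has_derivative (\<lambda>h. c *\<^sub>R h)) (at x)"
    by (auto intro!: derivative_eq_intros)
  from diff_chain_at[OF this assms[unfolded gderiv_def]] show ?thesis
    by (simp add: gderiv_def o_def)
qed

lemma Ck_affine: "Ck k f \<Longrightarrow> Ck k (\<lambda>x. f (c *\<^sub>R x + d))"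
proof (induction k arbitrary: f)
  case 0 then show ?case
    by (auto intro!: continuous_intros continuous_on_compose2[of UNIV f])
next
  case (Suc k)
  then obtain g where *: "\<And>x. GDERIV f x :> g x" "\<And>b. b\<in>Basis \<Longrightarrow> Ck k (\<lambda>x. g x \<bullet> b)"
    by (metis Ck.simps(2))
  show ?case
    by (rule Ck_SucI[where g="\<lambda>x. c *\<^sub>R g (c *\<^sub>R x + d)"])
       (simp_all add: gderiv_affine[OF *(1)] Ck_mult[OF Ck_const Suc.IH[OF *(2)]])
qed

lemma test_functionI:
  assumes "\<And>k. Ck k \<phi>" "\<And>x. norm x > R \<Longrightarrow> \<phi> x = 0"
  shows "test_function UNIV \<phi>"
proof -
  have "support_on UNIV \<phi> \<subseteq> cball 0 R"
    using assms(2) by (force simp: support_on_def)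
  then have "bounded (support_on UNIV \<phi>)" by (rule bounded_subset[OF bounded_cball])
  with assms(1) show ?thesis
    by (auto simp: test_function_def compact_closure)
qed

lemma test_function_bounded_support:
  assumes "test_function UNIV \<phi>"
  obtains R where "R > 0" "\<And>x. norm x \<ge> R \<Longrightarrow> \<phi> x = 0"
proof -
  have "bounded (closure (support_on UNIV \<phi>))"
    using assms by (auto simp: test_function_def intro: compact_imp_bounded)
  then obtain R where "R > 0" "\<And>x. x \<in> closure (support_on UNIV \<phi>) \<Longrightarrow> norm x < R"
    by (auto simp: bounded_pos_less)
  then show thesis using closure_subset[of "support_on UNIV \<phi>"]
    by (intro that[of R]) (force simp: support_on_def)+
qed

lemma test_function_Ck: "test_function UNIV \<phi> \<Longrightarrow> Ck k \<phi>"
  by (simp add: test_function_def)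

lemma test_function_cont: "test_function UNIV \<phi> \<Longrightarrow> continuous_on UNIV \<phi>"
  by (meson test_function_Ck Ck_continuous)

lemma gderiv_grad_Ck: assumes "Ck (Suc k) \<phi>" shows "GDERIV \<phi> x :> grad \<phi> x"
proof -
  obtain g where "\<And>x. GDERIV \<phi> x :> g x" using assms by auto
  then show ?thesis using grad_eq[of \<phi> x "g x"] by metis
qed

lemma gderiv_grad: "test_function UNIV \<phi> \<Longrightarrow> GDERIV \<phi> x :> grad \<phi> x"
  by (meson test_function_Ck gderiv_grad_Ck)

lemma Ck_grad:
  assumes "Ck (Suc k) \<phi>" "b \<in> Basis"
  shows "Ck k (\<lambda>x. grad \<phi> x \<bullet> b)"
proof -
  obtain g where *: "\<And>x. GDERIV \<phi> x :> g x" "Ck k (\<lambda>x. g x \<bullet> b)"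
    using assms by auto
  have "grad \<phi> = g" by (rule ext, rule grad_eq, rule *(1))
  with *(2) show ?thesis by simp
qed

lemma continuous_grad:
  assumes "Ck (Suc k) \<phi>"
  shows "continuous_on UNIV (grad \<phi>)"
  by (subst continuous_on_componentwise) (intro ballI Ck_continuous[OF Ck_grad[OF assms]])

lemma continuous_grad_test: "test_function UNIV \<phi> \<Longrightarrow> continuous_on UNIV (grad \<phi>)"
  by (meson test_function_Ck continuous_grad)

lemma gderiv_zero_outside:
  assumes "\<And>x. GDERIV \<phi> x :> g x" "\<And>x. norm x > R \<Longrightarrow> \<phi> x = 0" "norm x > R"
  shows "g x = 0"
proof -
  have "open {x::'a. norm x > R}" by (auto intro!: open_Collect_less continuous_intros)
  from has_derivative_transform_within_open[OF _ this, of "\<lambda>_. 0" "\<lambda>_. 0" x UNIV \<phi>] assms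
  have "GDERIV \<phi> x :> 0" by (auto simp: gderiv_def)
  from gderiv_unique[OF assms(1) this] show ?thesis .
qed

lemma grad_zero_outside:
  assumes "test_function UNIV \<phi>" "\<And>x. norm x > R \<Longrightarrow> \<phi> x = 0" "norm x > R"
  shows "grad \<phi> x = 0"
  by (rule gderiv_zero_outside[OF gderiv_grad[OF assms(1)] assms(2,3)])

lemma test_function_mult:
  assumes "test_function UNIV \<phi>" "\<And>k. Ck k \<psi>"
  shows "test_function UNIV (\<lambda>x. \<psi> x * \<phi> x)"
proof -
  obtain R where "R > 0" "\<And>x. norm x \<ge> R \<Longrightarrow> \<phi> x = 0"
    using test_function_bounded_support[OF assms(1)] by blast
  then show ?thesis using assms
    by (intro test_functionI[of _ R] Ck_mult) (auto intro: test_function_Ck)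
qed

lemma grad_mult:
  assumes "Ck (Suc k) f" "Ck (Suc j) h"
  shows "grad (\<lambda>x. f x * h x) x = f x *\<^sub>R grad h x + h x *\<^sub>R grad f x"
  using GDERIV_mult[OF gderiv_grad_Ck[OF assms(1)] gderiv_grad_Ck[OF assms(2)]]
  by (rule grad_eq)

lemma grad_affine:
  assumes "Ck (Suc k) f"
  shows "grad (\<lambda>x. f (c *\<^sub>R x + d)) x = c *\<^sub>R grad f (c *\<^sub>R x + d)"
  using gderiv_affine[OF gderiv_grad_Ck[OF assms]] by (rule grad_eq)

lemma test_function_affine:
  assumes "test_function UNIV \<phi>" "c \<noteq> 0"
  shows "test_function UNIV (\<lambda>x. \<phi> (c *\<^sub>R x + d))"
proof -
  obtain R where R: "R > 0" "\<And>x. norm x \<ge> R \<Longrightarrow> \<phi> x = 0"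
    using test_function_bounded_support[OF assms(1)] by blast
  show ?thesis
  proof (rule test_functionI[of _ "(R + norm d) / \<bar>c\<bar>"])
    fix x :: 'a assume "norm x > (R + norm d) / \<bar>c\<bar>"
    then have "norm (c *\<^sub>R x) > R + norm d" using assms(2) by (simp add: field_simps)
    then have "norm (c *\<^sub>R x + d) \<ge> R" using norm_diff_ineq[of "c *\<^sub>R x" d] by linarith
    then show "\<phi> (c *\<^sub>R x + d) = 0" using R by auto
  qed (intro Ck_affine test_function_Ck assms)
qed

lemma continuous_zero_outside_bounded:
  fixes g :: "'a::euclidean_space \<Rightarrow> 'b::real_normed_vector"
  assumes "continuous_on UNIV g" "\<And>x. norm x > R \<Longrightarrow> g x = 0"
  obtains B where "B > 0" "\<And>x. norm (g x) \<le> B"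
proof -
  have "bounded (g ` cball 0 R)"
    by (intro compact_imp_bounded compact_continuous_image)
       (auto intro: continuous_on_subset[OF assms(1)])
  then obtain B where B: "B > 0" "\<And>x. x \<in> cball 0 R \<Longrightarrow> norm (g x) \<le> B"
    by (auto simp: bounded_pos)
  have "norm (g x) \<le> B" for x using B assms(2)[of x] by (cases "norm x > R") auto
  with B that show thesis by blast
qed

lemma continuous_zero_outside_integrable:
  fixes g :: "'a::euclidean_space \<Rightarrow> 'b::euclidean_space"
  assumes "continuous_on UNIV g" "\<And>x. norm x > R \<Longrightarrow> g x = 0"
  shows "integrable lborel g"
proof -
  have "integrable lborel (\<lambda>x. indicator (cball 0 R) x *\<^sub>R g x)"
    by (rule borel_integrable_compact) (auto intro: continuous_on_subset[OF assms(1)])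
  also have "(\<lambda>x. indicator (cball 0 R) x *\<^sub>R g x) = g"
    using assms(2) by (auto simp: indicator_def fun_eq_iff not_le)
  finally show ?thesis .
qed

lemma continuous_UNIV_borel:
  "continuous_on UNIV f \<Longrightarrow> f \<in> borel_measurable borel"
  by (rule borel_measurable_continuous_onI)

subsection \<open>A smooth bump\<close>

text \<open>The case \<open>n = 0\<close> is the classical smooth function that is flat at the origin; its derivatives are
  linear combinations of the other members of the family.\<close>

definition flat_exp :: "nat \<Rightarrow> real \<Rightarrow> real" where
  "flat_exp n t = (if t > 0 then exp (- 1 / t) / t ^ n else 0)"

text \<open>One term of the exponential series at \<open>1/t\<close> already beats \<open>t\<^sup>-\<^sup>n\<^sup>-\<^sup>2\<close>. The quadratic bound gives
  derivative zero at the origin.\<close>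

lemma flat_exp_le_square: "\<bar>flat_exp n t\<bar> \<le> fact (n + 2) * t\<^sup>2"
proof (cases "t > 0")
  case True
  have "(1/t) ^ (n+2) / fact (n+2) \<le> exp (1/t)"
  proof -
    have "(\<Sum>i\<in>{n+2}. (1/t) ^ i /\<^sub>R fact i) \<le> (\<Sum>i. (1/t) ^ i /\<^sub>R fact i)"
      by (rule sum_le_suminf[OF summable_exp_generic]) (use True in auto)
    then show ?thesis by (simp add: exp_def divide_inverse mult.commute)
  qed
  then have "inverse (exp (1/t)) \<le> inverse ((1/t) ^ (n+2) / fact (n+2))"
    using True by (intro le_imp_inverse_le) auto
  also have "\<dots> = fact (n+2) * t ^ (n+2)" by (simp add: field_simps)
  finally have "exp (- 1 / t) \<le> fact (n+2) * t ^ (n+2)" by (simp add: exp_minus)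
  then have "exp (- 1 / t) / t ^ n \<le> fact (n+2) * t ^ (n+2) / t ^ n"
    using True by (intro divide_right_mono) auto
  also have "\<dots> = fact (n+2) * t\<^sup>2" using True by (simp only: power_add) simp
  finally show ?thesis using True by (simp add: flat_exp_def)
qed (auto simp: flat_exp_def)

text \<open>Dividing by powers of \<open>t\<close> keeps the family closed under differentiation, which is what lets
  smoothness be proved by induction on the order.\<close>

lemma flat_exp_deriv:
  "(flat_exp n has_real_derivative (flat_exp (n + 2) t - n * flat_exp (n + 1) t)) (at t)"
proof -
  consider "t > 0" | "t < 0" | "t = 0" by linarith
  then show ?thesis
  proof cases
    case 1
    have "((\<lambda>t. exp (- 1 / t) / t ^ n) has_real_derivative
        (flat_exp (n + 2) t - n * flat_exp (n + 1) t)) (at t)"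
    proof (rule DERIV_cong)
      have "((\<lambda>t. exp (- 1 / t)) has_real_derivative exp (- 1 / t) / t\<^sup>2) (at t)"
        using 1 by (auto intro!: derivative_eq_intros simp: power2_eq_square)
      moreover have "((\<lambda>t. t ^ n) has_real_derivative n * t ^ n / t) (at t)"
        using 1 by (intro DERIV_cong[OF DERIV_pow]) (cases n, auto)
      ultimately show "((\<lambda>t. exp (- 1 / t) / t ^ n) has_real_derivative
          (exp (- 1 / t) / t\<^sup>2 * t ^ n - exp (- 1 / t) * (n * t ^ n / t)) / (t ^ n * t ^ n)) (at t)"
        using 1 by (intro DERIV_divide) auto
    qed (use 1 in \<open>auto simp: flat_exp_def field_simps power2_eq_square\<close>)
    then show ?thesis
      by (rule has_field_derivative_transform_within_open[where S="{0<..}"])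
         (use 1 in \<open>auto simp: flat_exp_def\<close>)
  next
    case 2
    have "((\<lambda>t. 0) has_real_derivative (flat_exp (n + 2) t - n * flat_exp (n + 1) t)) (at t)"
      using 2 by (auto simp: flat_exp_def)
    then show ?thesis
      by (rule has_field_derivative_transform_within_open[where S="{..<0}"])
         (use 2 in \<open>auto simp: flat_exp_def\<close>)
  next
    case 3
    have "((\<lambda>h. flat_exp n h / h) \<longlongrightarrow> 0) (at 0)"
    proof (rule Lim_null_comparison[of _ "\<lambda>h. fact (n + 2) * \<bar>h\<bar>"])
      show "\<forall>\<^sub>F h in at 0. norm (flat_exp n h / h) \<le> fact (n + 2) * \<bar>h\<bar>"
        using flat_exp_le_square[of n]
        by (auto intro!: always_eventually simp: divide_le_eq power2_eq_square mult.assoc)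
    qed (auto intro!: tendsto_eq_intros)
    then show ?thesis using 3 by (simp add: has_field_derivative_iff flat_exp_def)
  qed
qed

definition bump :: "'a::euclidean_space \<Rightarrow> real" where
  "bump x = exp 1 * flat_exp 0 (1 - x \<bullet> x)"

lemma Ck_flat_exp_sphere: "Ck k (\<lambda>x::'a::euclidean_space. flat_exp n (1 - x \<bullet> x))"
proof -
  define h where "h n x = flat_exp n (1 - x \<bullet> x)" for n and x :: 'a
  have D: "GDERIV (h n) x :> (-2 * h (n + 2) x + 2 * n * h (n + 1) x) *\<^sub>R x" for n x
  proof -
    have "GDERIV (\<lambda>x. 1 - x \<bullet> x) x :> (-2) *\<^sub>R x"
      unfolding gderiv_def by (auto intro!: derivative_eq_intros simp: inner_commute)
    from GDERIV_DERIV_compose[OF this flat_exp_deriv[of n]] show ?thesis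
      unfolding h_def by (rule GDERIV_subst) (simp add: algebra_simps)
  qed
  have "Ck k (h n)"
  proof (induction k arbitrary: n)
    case 0 show ?case using gderiv_continuous[OF D] by simp
  next
    case (Suc k)
    show ?case
      by (rule Ck_SucI[OF D], unfold inner_scaleR_left)
        (intro Ck_mult Ck_add Ck_const Ck_inner Suc)
  qed
  then show ?thesis unfolding h_def .
qed

lemma Ck_bump: "Ck k bump"
  unfolding bump_def by (intro Ck_mult Ck_const Ck_flat_exp_sphere)

lemma bump_nonneg: "bump x \<ge> 0" by (simp add: bump_def flat_exp_def)

lemma bump_0: "bump 0 = 1" by (simp add: bump_def flat_exp_def exp_minus)

lemma bump_le_1: "bump x \<le> 1"
  by (auto simp: bump_def flat_exp_def simp flip: exp_add)

lemma bump_outside: "norm x \<ge> 1 \<Longrightarrow> bump x = 0"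
  by (simp add: bump_def flat_exp_def dot_square_norm not_less)

lemma test_function_bump: "test_function UNIV bump"
  by (rule test_functionI[of _ 1]) (auto intro: Ck_bump bump_outside)

section \<open>Mollification\<close>

lemma nn_integral_affine:
  fixes f :: "'a::euclidean_space \<Rightarrow> ennreal"
  assumes [measurable]: "f \<in> borel_measurable borel" and c: "c \<noteq> 0"
  shows "(\<integral>\<^sup>+x. f x \<partial>lborel) = ennreal (\<bar>c\<bar> ^ DIM('a)) * (\<integral>\<^sup>+x. f (t + c *\<^sub>R x) \<partial>lborel)"
  by (subst lborel_affine[OF c, of t])
    (simp add: nn_integral_density nn_integral_distr nn_integral_cmult)

lemma integral_affine:
  fixes f :: "'a::euclidean_space \<Rightarrow> 'b::euclidean_space"
  assumes [measurable]: "f \<in> borel_measurable borel" and c: "c \<noteq> 0"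
  shows "(\<integral>x. f x \<partial>lborel) = (\<bar>c\<bar> ^ DIM('a)) *\<^sub>R (\<integral>x. f (t + c *\<^sub>R x) \<partial>lborel)"
  by (subst lborel_affine[OF c, of t]) (simp add: integral_density integral_distr)

lemma integrable_affine:
  fixes f :: "'a::euclidean_space \<Rightarrow> 'b::euclidean_space"
  assumes f: "integrable lborel f" and c: "c \<noteq> 0"
  shows "integrable lborel (\<lambda>x. f (t + c *\<^sub>R x))"
proof -
  have [measurable]: "f \<in> borel_measurable borel" using f by auto
  have "(\<integral>\<^sup>+x. norm (f (t + c *\<^sub>R x)) \<partial>lborel) \<noteq> \<infinity>"
  proof
    assume "(\<integral>\<^sup>+x. norm (f (t + c *\<^sub>R x)) \<partial>lborel) = \<infinity>"
    then have "(\<integral>\<^sup>+x. norm (f x) \<partial>lborel) = \<infinity>"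
      using c by (subst nn_integral_affine[where c=c and t=t]) (auto simp: ennreal_mult_top)
    with f show False by (simp add: integrable_iff_bounded)
  qed
  then show ?thesis by (simp add: integrable_iff_bounded less_top)
qed

lemma continuous_AE_zero:
  fixes f :: "'a::euclidean_space \<Rightarrow> real"
  assumes "continuous_on UNIV f" "AE x in lborel. f x = 0"
  shows "f x = 0"
proof (rule ccontr)
  assume "f x \<noteq> 0"
  have o: "open {x. f x \<noteq> 0}"
    by (rule open_Collect_neq) (auto intro: assms)
  then have "{x. f x \<noteq> 0} \<in> null_sets lborel"
    using assms(2) by (subst (asm) AE_iff_null) auto
  then have "negligible {x. f x \<noteq> 0}"
    by (auto simp: negligible_iff_null_sets intro: null_sets_completionI)
  with open_not_negligible[OF o] \<open>f x \<noteq> 0\<close> show False by auto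
qed

definition mollifier :: "real \<Rightarrow> 'a::euclidean_space \<Rightarrow> real" where
  "mollifier e x = bump ((1/e) *\<^sub>R x) / (\<integral>y. bump ((1/e) *\<^sub>R (y::'a)) \<partial>lborel)"

definition mollify :: "real \<Rightarrow> ('a::euclidean_space \<Rightarrow> 'b::euclidean_space) \<Rightarrow> 'a \<Rightarrow> 'b" where
  "mollify e w x = (\<integral>y. mollifier e (x - y) *\<^sub>R w y \<partial>lborel)"

context
  fixes e :: real assumes e: "e > 0"
begin

lemma Ck_mollifier: "Ck k (mollifier e)"
proof -
  have "Ck k (\<lambda>x::'a. bump ((1/e) *\<^sub>R x + 0) * (1 / (\<integral>y. bump ((1/e) *\<^sub>R (y::'a)) \<partial>lborel)))"
    by (intro Ck_mult Ck_const Ck_affine Ck_bump)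
  then show ?thesis by (simp add: mollifier_def[abs_def])
qed

lemma mollifier_nonneg: "mollifier e x \<ge> 0"
  unfolding mollifier_def by (intro divide_nonneg_nonneg Bochner_Integration.integral_nonneg bump_nonneg)

lemma mollifier_outside: "norm x \<ge> e \<Longrightarrow> mollifier e x = 0"
  using e by (simp add: mollifier_def bump_outside)

lemma mollifier_cont: "continuous_on UNIV (mollifier e)"
  by (rule Ck_continuous[OF Ck_mollifier])

lemma mollifier_measurable [measurable]: "mollifier e \<in> borel_measurable borel"
  by (rule continuous_UNIV_borel[OF mollifier_cont])

lemma mollifier_integrable: "integrable lborel (mollifier e)"
  by (rule continuous_zero_outside_integrable[OF mollifier_cont, of e]) (auto intro: mollifier_outside)

lemma mollifier_integral: "(\<integral>x. mollifier e x \<partial>lborel) = 1"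
proof -
  let ?b = "\<lambda>x::'a. bump ((1/e) *\<^sub>R x)"
  have c: "continuous_on UNIV ?b"
    using Ck_continuous[OF Ck_affine[OF Ck_bump, where c="1/e" and d=0]] by simp
  have i: "integrable lborel ?b"
    by (rule continuous_zero_outside_integrable[OF c, of e]) (use e in \<open>auto intro!: bump_outside\<close>)
  have "(\<integral>x. ?b x \<partial>lborel) \<noteq> 0"
  proof
    assume "(\<integral>x. ?b x \<partial>lborel) = 0"
    then have "AE x in lborel. ?b x = 0"
      by (subst (asm) integral_nonneg_eq_0_iff_AE[OF i]) (auto simp: bump_nonneg)
    from continuous_AE_zero[OF c this, of 0] show False by (simp add: bump_0)
  qed
  then show ?thesis by (simp add: mollifier_def)
qed

lemma mollifier_shift:
  "integrable lborel (\<lambda>y. mollifier e (x - y))" "(\<integral>y. mollifier e (x - y) \<partial>lborel) = 1"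
  using integrable_affine[OF mollifier_integrable, of "-1" x]
    integral_affine[OF mollifier_measurable, of "-1" x] by (simp_all add: mollifier_integral)

lemma mollifier_bounded: obtains B where "B > 0" "\<And>x::'a::euclidean_space. mollifier e x \<le> B"
proof -
  obtain B where "B > 0" "\<And>x::'a. norm (mollifier e x) \<le> B"
    using continuous_zero_outside_bounded[OF mollifier_cont, of e] mollifier_outside
    by (metis less_imp_le)
  then show thesis by (intro that[of B]) (auto simp: abs_le_iff)
qed

lemma mollify_integrable:
  fixes w :: "'a::euclidean_space \<Rightarrow> 'b::euclidean_space"
  assumes "integrable lborel w"
  shows "integrable lborel (\<lambda>y. mollifier e (x - y) *\<^sub>R w y)"
proof -
  have [measurable]: "w \<in> borel_measurable borel" using assms by auto
  obtain B where B: "B > 0" "\<And>x::'a. mollifier e x \<le> B" using mollifier_bounded by blast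
  show ?thesis
  proof (rule Bochner_Integration.integrable_bound)
    show "integrable lborel (\<lambda>y. B *\<^sub>R w y)" using assms by simp
    have "\<bar>mollifier e (x - y)\<bar> \<le> \<bar>B\<bar>" for y
      using B(2)[of "x - y"] mollifier_nonneg[of "x - y"] by linarith
    then show "AE y in lborel. norm (mollifier e (x - y) *\<^sub>R w y) \<le> norm (B *\<^sub>R w y)"
      by (auto intro!: mult_right_mono)
  qed measurable
qed

lemma mollify_diff:
  assumes "integrable lborel v" "integrable lborel w"
  shows "mollify e (\<lambda>x. v x - w x) x = mollify e v x - mollify e w x"
  unfolding mollify_def scaleR_diff_right
  by (intro Bochner_Integration.integral_diff mollify_integrable assms)

lemma mollify_outside:
  assumes "\<And>x. norm x > R \<Longrightarrow> w x = 0" "norm x > R + e"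
  shows "mollify e w x = 0"
proof -
  have "mollifier e (x - y) *\<^sub>R w y = 0" for y
  proof (cases "norm y > R")
    case False
    then have "norm (x - y) \<ge> e" using assms(2) norm_triangle_ineq2[of x y] by linarith
    then show ?thesis by (simp add: mollifier_outside)
  qed (simp add: assms)
  then show ?thesis unfolding mollify_def by (simp only: integral_zero)
qed

lemma mollify_close:
  assumes w: "integrable lborel w" and d: "\<And>y. norm (x - y) < e \<Longrightarrow> norm (w y - w x) \<le> d"
  shows "norm (mollify e w x - w x) \<le> d"
proof -
  note i = mollifier_shift(1)[of x]
  have "mollify e w x - w x = (\<integral>y. mollifier e (x - y) *\<^sub>R w y \<partial>lborel) - (\<integral>y. mollifier e (x - y) *\<^sub>R w x \<partial>lborel)"
    using i by (simp add: mollify_def integral_scaleR_left mollifier_shift(2))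
  also have "\<dots> = (\<integral>y. mollifier e (x - y) *\<^sub>R (w y - w x) \<partial>lborel)"
    using mollify_integrable[OF w] i by (simp add: scaleR_diff_right)
  also have "norm \<dots> \<le> (\<integral>y. mollifier e (x - y) * d \<partial>lborel)"
  proof (rule order_trans[OF integral_norm_bound integral_mono])
    have "integrable lborel (\<lambda>y. mollifier e (x - y) *\<^sub>R (w y - w x))"
      using mollify_integrable[OF w] i by (simp add: scaleR_diff_right)
    then show "integrable lborel (\<lambda>y. norm (mollifier e (x - y) *\<^sub>R (w y - w x)))"
      by (rule integrable_norm)
    show "norm (mollifier e (x - y) *\<^sub>R (w y - w x)) \<le> mollifier e (x - y) * d" for y
      using d[of y] mollifier_nonneg[of "x - y"] mollifier_outside[of "x - y"]
      by (cases "norm (x - y) < e") (auto intro!: mult_left_mono)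
  qed (use i in auto)
  also have "\<dots> = d" using i by (simp add: mollifier_shift(2))
  finally show ?thesis .
qed

end

lemma integral_lborel_eq_cbox:
  fixes f :: "'a::euclidean_space \<Rightarrow> 'b::euclidean_space"
  assumes "integrable lborel f" "\<And>x. x \<notin> cbox a b \<Longrightarrow> f x = 0"
  shows "(\<integral>x. f x \<partial>lborel) = integral (cbox a b) f"
proof -
  have "(\<integral>x. f x \<partial>lborel) = integral UNIV f"
    using has_integral_integral_lborel[OF assms(1)] by (simp add: integral_unique)
  also have "\<dots> = integral UNIV (\<lambda>x. if x \<in> cbox a b then f x else 0)"
    by (rule arg_cong[where f="integral UNIV"]) (use assms(2) in auto)
  finally show ?thesis by (simp add: integral_restrict_UNIV)
qed

text \<open>Integrating over a fixed box instead of the whole space allows differentiation under the integral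
  sign by the Leibniz rule for compact domains; the box will contain the support of \<open>w\<close>.\<close>

lemma gderiv_convolution:
  fixes f w :: "'a::euclidean_space \<Rightarrow> real"
  assumes f: "\<And>x. GDERIV f x :> g x" and g: "continuous_on UNIV g" and w: "continuous_on UNIV w"
  shows "GDERIV (\<lambda>x. integral (cbox a b) (\<lambda>y. f (x - y) * w y)) x
    :> integral (cbox a b) (\<lambda>y. w y *\<^sub>R g (x - y))"
proof -
  have fc: "continuous_on UNIV f" by (rule gderiv_continuous[OF f])
  let ?fx = "\<lambda>x y. blinfun_inner_left (w y *\<^sub>R g (x - y))"
  have 1: "((\<lambda>x. f (x - y) * w y) has_derivative blinfun_apply (?fx x y)) (at x within UNIV)" for x y
  proof -
    have "GDERIV (\<lambda>x. f (1 *\<^sub>R x + (- y))) x :> 1 *\<^sub>R g (x - y)"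
      by (rule gderiv_affine) (use f[of "x - y"] in simp)
    then have "((\<lambda>x. f (x - y)) has_derivative (\<lambda>h. h \<bullet> g (x - y))) (at x)"
      by (simp add: gderiv_def)
    from has_derivative_mult_left[OF this, of "w y"] show ?thesis
      by (simp add: mult.commute)
  qed
  have "((\<lambda>x. integral (cbox a b) (\<lambda>y. f (x - y) * w y)) has_derivative
      blinfun_apply (integral (cbox a b) (?fx x))) (at x within UNIV)"
  proof (rule leibniz_rule[OF 1])
    show "(\<lambda>y. f (x - y) * w y) integrable_on cbox a b" for x
      by (intro integrable_continuous continuous_intros continuous_on_compose2[OF fc]
          continuous_on_subset[OF w]) auto
    show "continuous_on (UNIV \<times> cbox a b) (\<lambda>(x, y). ?fx x y)"
      unfolding split_def
      by (intro continuous_intros continuous_on_compose2[OF g] continuous_on_compose2[OF w]) auto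
  qed auto
  moreover have "integral (cbox a b) (?fx x) = blinfun_inner_left (integral (cbox a b) (\<lambda>y. w y *\<^sub>R g (x - y)))"
  proof -
    have "(\<lambda>y. w y *\<^sub>R g (x - y)) integrable_on cbox a b"
      by (intro integrable_continuous continuous_intros continuous_on_compose2[OF g]
          continuous_on_subset[OF w]) auto
    from integral_linear[OF this bounded_linear_blinfun_inner_left] show ?thesis by (simp add: o_def)
  qed
  ultimately show ?thesis by (simp add: gderiv_def)
qed

lemma Ck_convolution:
  fixes f w :: "'a::euclidean_space \<Rightarrow> real"
  assumes w: "continuous_on UNIV w"
  shows "Ck k f \<Longrightarrow> Ck k (\<lambda>x. integral (cbox a b) (\<lambda>y. f (x - y) * w y))"
proof (induction k arbitrary: f)
  case 0
  then have f: "continuous_on UNIV f" by simp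
  have "continuous_on (UNIV \<times> cbox a b) (\<lambda>(x, y). f (x - y) * w y)"
    unfolding split_def
    by (intro continuous_intros continuous_on_compose2[OF f] continuous_on_compose2[OF w]) auto
  from integral_continuous_on_param[OF this] show ?case by simp
next
  case (Suc k)
  have g: "continuous_on UNIV (grad f)" by (rule continuous_grad[OF Suc.prems])
  show ?case
  proof (rule Ck_SucI)
    show "GDERIV (\<lambda>x. integral (cbox a b) (\<lambda>y. f (x - y) * w y)) x
      :> integral (cbox a b) (\<lambda>y. w y *\<^sub>R grad f (x - y))" for x
      by (rule gderiv_convolution[OF gderiv_grad_Ck[OF Suc.prems] g w])
    fix i :: 'a assume i: "i \<in> Basis"
    have "integral (cbox a b) (\<lambda>y. w y *\<^sub>R grad f (x - y)) \<bullet> i =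
        integral (cbox a b) (\<lambda>y. (grad f (x - y) \<bullet> i) * w y)" for x
    proof -
      have "(\<lambda>y. w y *\<^sub>R grad f (x - y)) integrable_on cbox a b"
        by (intro integrable_continuous continuous_intros continuous_on_compose2[OF g]
            continuous_on_subset[OF w]) auto
      from integral_component_eq[OF this, of i] show ?thesis
        by (simp add: mult.commute)
    qed
    then have "(\<lambda>x. integral (cbox a b) (\<lambda>y. w y *\<^sub>R grad f (x - y)) \<bullet> i) =
        (\<lambda>x. integral (cbox a b) (\<lambda>y. (grad f (x - y) \<bullet> i) * w y))"
      by (rule ext)
    then show "Ck k (\<lambda>x. integral (cbox a b) (\<lambda>y. w y *\<^sub>R grad f (x - y)) \<bullet> i)"
      by (rule ssubst) (rule Suc.IH[OF Ck_grad[OF Suc.prems i]])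
  qed
qed

text \<open>Weak gradients on the whole space with a Borel representative, so that all integrals are taken
  with respect to \<open>lborel\<close>.\<close>

definition weak_pair :: "('a::euclidean_space \<Rightarrow> real) \<Rightarrow> ('a \<Rightarrow> 'a) \<Rightarrow> bool" where
  "weak_pair u G \<longleftrightarrow> continuous_on UNIV u \<and> G \<in> borel_measurable borel \<and>
     (\<forall>R. set_integrable lborel (cball 0 R) G) \<and>
     (\<forall>\<phi>. test_function UNIV \<phi> \<longrightarrow>
        (\<integral>x. u x *\<^sub>R grad \<phi> x \<partial>lborel) = - (\<integral>x. \<phi> x *\<^sub>R G x \<partial>lborel))"

context
  fixes w :: "'a::euclidean_space \<Rightarrow> real" and R e :: real
  assumes w: "continuous_on UNIV w" and wR: "\<And>x. norm x > R \<Longrightarrow> w x = 0" and e: "e > 0"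
begin

lemma mollify_eq_cbox:
  obtains a b :: 'a where "mollify e w = (\<lambda>x. integral (cbox a b) (\<lambda>y. mollifier e (x - y) * w y))"
    "\<And>y. y \<notin> cbox a b \<Longrightarrow> w y = 0"
proof -
  have i: "integrable lborel w" by (rule continuous_zero_outside_integrable[OF w wR])
  obtain a where a: "cball 0 R \<subseteq> cbox (-a) (a::'a)"
    by (rule bounded_subset_cbox_symmetric[OF bounded_cball])
  have z: "w y = 0" if "y \<notin> cbox (-a) a" for y
    using a that by (cases "norm y \<le> R") (auto intro: wR)
  have "mollify e w x = integral (cbox (-a) a) (\<lambda>y. mollifier e (x - y) * w y)" for x
  proof -
    have "integrable lborel (\<lambda>y. mollifier e (x - y) * w y)"
      using mollify_integrable[OF e i, of x] by simp
    from integral_lborel_eq_cbox[OF this, of "-a" a] show ?thesis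
      by (simp add: mollify_def z)
  qed
  then show thesis by (intro that[of "-a" a] ext z)
qed

lemma Ck_mollify: "Ck k (mollify e w)"
proof (rule mollify_eq_cbox)
  fix a b assume "mollify e w = (\<lambda>x. integral (cbox a b) (\<lambda>y. mollifier e (x - y) * w y))"
  then show "Ck k (mollify e w)" by (rule ssubst) (rule Ck_convolution[OF w Ck_mollifier[OF e]])
qed

lemma test_function_mollify: "test_function UNIV (mollify e w)"
proof (rule test_functionI[of _ "R + e"])
  show "Ck k (mollify e w)" for k by (rule Ck_mollify)
  show "mollify e w x = 0" if "norm x > R + e" for x
    by (rule mollify_outside[OF e, of R]) (use wR that in auto)
qed

text \<open>The reflected mollifier is an admissible test function, so that the weak gradient turns the
  derivative of the kernel into a mollification of the weak gradient itself.\<close>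

lemma grad_mollify:
  assumes W: "weak_pair w W"
  shows "grad (mollify e w) x = mollify e W x"
proof -
  obtain a b where ab: "mollify e w = (\<lambda>x. integral (cbox a b) (\<lambda>y. mollifier e (x - y) * w y))"
    "\<And>y. y \<notin> cbox a b \<Longrightarrow> w y = 0" using mollify_eq_cbox by blast
  let ?m = "mollifier e :: 'a \<Rightarrow> real"
  note m = Ck_mollifier[OF e, where 'a='a]
  have g: "continuous_on UNIV (grad ?m)" by (rule continuous_grad[OF m])
  have "test_function UNIV ?m"
    by (rule test_functionI[OF m]) (rule mollifier_outside[OF e less_imp_le])
  from test_function_affine[OF this, of "-1" x]
  have t: "test_function UNIV (\<lambda>y. ?m (x - y))" by (simp only: scaleR_minus1_left uminus_add_conv_diff)
  have gt: "grad (\<lambda>y. ?m (x - y)) y = - grad ?m (x - y)" for y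
    using grad_affine[OF m, of "-1" x y] by (simp only: scaleR_minus1_left uminus_add_conv_diff)
  have i: "integrable lborel (\<lambda>y. w y *\<^sub>R grad ?m (x - y))"
  proof (rule continuous_zero_outside_integrable)
    show "continuous_on UNIV (\<lambda>y. w y *\<^sub>R grad ?m (x - y))"
      by (intro continuous_intros continuous_on_compose2[OF g] w) auto
    show "w y *\<^sub>R grad ?m (x - y) = 0" if "norm y > R" for y using wR[OF that] by simp
  qed
  have "grad (mollify e w) x = integral (cbox a b) (\<lambda>y. w y *\<^sub>R grad ?m (x - y))"
    unfolding ab(1) by (rule grad_eq[OF gderiv_convolution[OF gderiv_grad_Ck[OF m] g w]])
  also have "\<dots> = (\<integral>y. w y *\<^sub>R grad ?m (x - y) \<partial>lborel)"
    by (rule integral_lborel_eq_cbox[symmetric, OF i]) (simp add: ab(2))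
  also have "\<dots> = - (\<integral>y. w y *\<^sub>R grad (\<lambda>y. ?m (x - y)) y \<partial>lborel)"
    unfolding gt by simp
  also have "\<dots> = mollify e W x"
    using W[unfolded weak_pair_def] t unfolding mollify_def by (metis minus_minus)
  finally show ?thesis .
qed

end

section \<open>Convergence of mollifications\<close>

text \<open>Density of continuous functions with compact support in \<open>L\<^sup>1\<close>, as an induction principle.
  Regularity of Lebesgue measure and Urysohn functions approximate the indicators of bounded sets,
  from which truncation and simple functions lead to the general case.\<close>

lemma integrable_induct_continuous:
  fixes W :: "'a::euclidean_space \<Rightarrow> 'b::euclidean_space"
  assumes W: "integrable lborel W"
    and cont: "\<And>g R. continuous_on UNIV g \<Longrightarrow> (\<And>x. norm x > R \<Longrightarrow> g x = 0) \<Longrightarrow> P g"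
    and add: "\<And>f g. integrable lborel f \<Longrightarrow> integrable lborel g \<Longrightarrow> P f \<Longrightarrow> P g \<Longrightarrow> P (\<lambda>x. f x + g x)"
    and closed: "\<And>g. integrable lborel g \<Longrightarrow>
      (\<And>d. d > 0 \<Longrightarrow> \<exists>h. integrable lborel h \<and> P h \<and> (\<integral>x. norm (g x - h x) \<partial>lborel) < d) \<Longrightarrow> P g"
  shows "P W"
proof -
  have P_limit: "P f" if s: "\<And>i. integrable lborel (s i)" "\<And>i. P (s i)" "\<And>x. (\<lambda>i. s i x) \<longlonglongrightarrow> f x"
    "\<And>i x. norm (s i x) \<le> w x" and f: "integrable lborel f" and w: "integrable lborel w"
    for s :: "nat \<Rightarrow> 'a \<Rightarrow> 'b" and f and w :: "'a \<Rightarrow> real"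
  proof (rule closed[OF f])
    fix d :: real assume d: "d > 0"
    have [measurable]: "f \<in> borel_measurable borel" "s i \<in> borel_measurable borel" for i
      using f s(1)[of i] by auto
    have "(\<lambda>i. \<integral>x. norm (f x - s i x) \<partial>lborel) \<longlonglongrightarrow> (\<integral>x. 0 \<partial>(lborel :: 'a measure))"
    proof (rule integral_dominated_convergence)
      show "integrable lborel (\<lambda>x. norm (f x) + w x)" using f w by simp
      show "AE x in lborel. (\<lambda>i. norm (f x - s i x)) \<longlonglongrightarrow> 0"
        using tendsto_norm_zero[OF LIM_zero[OF s(3)]] by (simp add: norm_minus_commute)
      show "AE x in lborel. norm (norm (f x - s i x)) \<le> norm (f x) + w x" for i
        using norm_triangle_ineq4 s(4)[of i] by (auto intro!: always_eventually order_trans[OF norm_triangle_ineq4])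
    qed auto
    then have "eventually (\<lambda>i. (\<integral>x. norm (f x - s i x) \<partial>lborel) < d) sequentially"
      using d by (auto dest: order_tendstoD)
    then obtain i where "(\<integral>x. norm (f x - s i x) \<partial>lborel) < d"
      by (auto simp: eventually_sequentially)
    with s show "\<exists>h. integrable lborel h \<and> P h \<and> (\<integral>x. norm (f x - h x) \<partial>lborel) < d" by blast
  qed
  have ind: "integrable lborel (\<lambda>x. indicator A x *\<^sub>R c)"
    if "A \<in> sets borel" "emeasure lborel A < \<infinity>" for A :: "'a set" and c :: 'b
    using that by (intro integrable_scaleR_left integrable_real_indicator) auto
  have bounded: "P (\<lambda>x. indicator A x *\<^sub>R c)"
    if A [measurable]: "A \<in> sets borel" and R: "A \<subseteq> cball 0 R" for A :: "'a set" and c :: 'b and R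
  proof (rule closed)
    have fin: "emeasure lborel A < \<infinity>"
      using R by (intro emeasure_bounded_finite bounded_subset[OF bounded_cball])
    show "integrable lborel (\<lambda>x. indicator A x *\<^sub>R c)" by (rule ind[OF A fin])
    fix d :: real assume d: "d > 0"
    define k where "k = norm c + 1"
    have k: "k > 0" unfolding k_def by (rule add_nonneg_pos) auto
    \<comment> \<open>the approximation will differ on a set of measure at most \<open>2 e\<close>, by at most \<open>|c|\<close>, and \<open>2 e |c| < d\<close>\<close>
    define e where "e = d / 2 / k"
    have e: "e > 0" using d k by (simp add: e_def)
    have leb: "A \<in> sets lebesgue" by simp
    obtain T where T: "open T" "A \<subseteq> T" "emeasure lebesgue (T - A) < ennreal e"
      using sets_lebesgue_outer_open[OF leb e] by metis
    obtain S where S: "closed S" "S \<subseteq> A" "emeasure lebesgue (A - S) < ennreal e"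
      using sets_lebesgue_inner_closed[OF leb e] by metis
    have [measurable]: "S \<in> sets borel" "T \<in> sets borel" using S T by auto
    define T' where "T' = T \<inter> ball 0 (R + 1)"
    have T': "open T'" "A \<subseteq> T'" using T R by (auto simp: T'_def)
    have [measurable]: "T' \<in> sets borel" using T' by auto
    obtain f :: "'a \<Rightarrow> real" where f: "continuous_on UNIV f" "\<And>x. f x \<in> closed_segment 1 0"
      "\<And>x. x \<in> S \<Longrightarrow> f x = 1" "\<And>x. x \<in> - T' \<Longrightarrow> f x = 0"
      by (rule Urysohn[of S "- T'" 1 0]) (use S T' in \<open>auto simp: closed_Compl\<close>)
    have f01: "0 \<le> f x" "f x \<le> 1" for x using f(2)[of x] by (auto simp: closed_segment_eq_real_ivl)
    let ?g = "\<lambda>x. f x *\<^sub>R c"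
    have gc: "continuous_on UNIV ?g" by (intro continuous_intros f)
    have gz: "?g x = 0" if "norm x > R + 1" for x
      using f(4)[of x] that by (auto simp: T'_def)
    have gi: "integrable lborel ?g" by (rule continuous_zero_outside_integrable[OF gc gz])
    have TS: "emeasure lborel (T' - S) < ennreal (2 * e)"
    proof -
      have "emeasure lborel (T' - S) \<le> emeasure lborel ((T - A) \<union> (A - S))"
        by (intro emeasure_mono) (auto simp: T'_def)
      also have "\<dots> \<le> emeasure lborel (T - A) + emeasure lborel (A - S)"
        by (intro emeasure_subadditive) auto
      also have "\<dots> < ennreal e + ennreal e"
        using T(3) S(3) by (intro add_strict_mono) auto
      also have "\<dots> = ennreal (2 * e)" using e by (simp flip: ennreal_plus)
      finally show ?thesis .
    qed
    have "(\<integral>x. norm (indicator A x *\<^sub>R c - ?g x) \<partial>lborel) \<le> (\<integral>x. indicator (T' - S) x * norm c \<partial>lborel)"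
    proof (rule integral_mono)
      show "integrable lborel (\<lambda>x. norm (indicator A x *\<^sub>R c - ?g x))"
        using ind[OF A fin] gi by auto
      show "integrable lborel (\<lambda>x. indicator (T' - S) x * norm c)"
        using TS by (intro integrable_mult_left integrable_real_indicator) (auto simp: top_unique less_top[symmetric] dest: order_less_trans)
      fix x
      have "norm (indicator A x *\<^sub>R c - ?g x) = \<bar>indicator A x - f x\<bar> * norm c"
        by (simp flip: scaleR_diff_left)
      also have "\<bar>indicator A x - f x\<bar> \<le> indicator (T' - S) x"
        using f(3)[of x] f(4)[of x] f01[of x] S(2) T'(2) by (auto simp: indicator_def)
      finally show "norm (indicator A x *\<^sub>R c - ?g x) \<le> indicator (T' - S) x * norm c"
        by (simp add: mult_right_mono)
    qed
    also have "\<dots> = measure lborel (T' - S) * norm c" by simp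
    also have "measure lborel (T' - S) \<le> 2 * e"
      using TS e by (auto simp: measure_def intro!: enn2real_leI)
    also have "2 * e * norm c < d"
    proof -
      have "d = 2 * e * k" using k by (simp add: e_def)
      also have "\<dots> = 2 * e * norm c + 2 * e" by (simp only: k_def distrib_left mult_1_right)
      finally show ?thesis using e by linarith
    qed
    finally have "(\<integral>x. norm (indicator A x *\<^sub>R c - ?g x) \<partial>lborel) < d"
      by (simp add: mult_right_mono)
    with gi cont[OF gc gz] show "\<exists>h. integrable lborel h \<and> P h \<and> (\<integral>x. norm (indicator A x *\<^sub>R c - h x) \<partial>lborel) < d"
      by blast
  qed
  from W show ?thesis
  proof (induction rule: integrable_induct)
    case (base A c)
    then have A: "A \<in> sets borel" "emeasure lborel A < \<infinity>" by auto
    show ?case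
    proof (rule P_limit)
      show "integrable lborel (\<lambda>x. indicator (A \<inter> cball 0 (real i)) x *\<^sub>R c)" for i
        using A(1) by (intro ind emeasure_bounded_finite bounded_subset[OF bounded_cball]) auto
      show "P (\<lambda>x. indicator (A \<inter> cball 0 (real i)) x *\<^sub>R c)" for i
        by (rule bounded[of _ "real i"]) (use A in auto)
      show "(\<lambda>i. indicator (A \<inter> cball 0 (real i)) x *\<^sub>R c) \<longlonglongrightarrow> indicator A x *\<^sub>R c" for x
      proof (rule tendsto_eventually)
        obtain n where "norm x \<le> real n" using real_arch_simple by blast
        then show "\<forall>\<^sub>F i in sequentially. indicator (A \<inter> cball 0 (real i)) x *\<^sub>R c = indicator A x *\<^sub>R c"
          by (auto simp: eventually_sequentially indicator_def intro!: exI[of _ n])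
      qed
      show "norm (indicator (A \<inter> cball 0 (real i)) x *\<^sub>R c) \<le> norm (indicator A x *\<^sub>R c)" for i x
        by (auto simp: indicator_def)
      show "integrable lborel (\<lambda>x. indicator A x *\<^sub>R c)" by (rule ind[OF A])
      then show "integrable lborel (\<lambda>x. norm (indicator A x *\<^sub>R c))" by (rule integrable_norm)
    qed
  next
    case (add f g) then show ?case by (intro assms(3))
  next
    case (lim f s)
    show ?case by (rule P_limit[of s f "\<lambda>x. 2 * norm (f x)"]) (use lim in auto)
  qed
qed

text \<open>Young's inequality for \<open>t\<close> and \<open>a\<^sup>p\<^sup>-\<^sup>1\<close>, rearranged.\<close>

lemma powr_tangent:
  fixes a t p :: real
  assumes "p \<ge> 1" "a \<ge> 0" "t \<ge> 0"
  shows "a powr p + p * a powr (p - 1) * (t - a) \<le> t powr p"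
proof (cases "a = 0 \<or> t = 0")
  case True
  then show ?thesis
  proof
    assume t: "t = 0"
    have "a powr (p - 1) * a = a powr p" using assms by (cases "a = 0") (auto simp: powr_diff)
    moreover have "1 * a powr p \<le> p * a powr p" using assms by (intro mult_right_mono) auto
    ultimately show ?thesis using t by (simp add: algebra_simps)
  qed auto
next
  case False
  then have "a > 0" "t > 0" using assms by auto
  then have "(t powr p) powr (1/p) * (a powr p) powr (1 - 1/p) \<le> 1/p * t powr p + (1 - 1/p) * a powr p"
    using assms by (intro Youngs_inequality_0) auto
  also have "(t powr p) powr (1/p) = t" using assms \<open>t > 0\<close> by (simp add: powr_powr)
  also have "(a powr p) powr (1 - 1/p) = a powr (p - 1)"
    using assms by (simp add: powr_powr algebra_simps)
  finally have *: "t * a powr (p - 1) \<le> 1/p * t powr p + (1 - 1/p) * a powr p" .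
  have "p * (t * a powr (p - 1)) \<le> p * (1/p * t powr p + (1 - 1/p) * a powr p)"
    by (rule mult_left_mono[OF *]) (use assms in simp)
  also have "\<dots> = t powr p + (p - 1) * a powr p" using assms by (simp add: field_simps)
  finally have "p * (t * a powr (p - 1)) \<le> t powr p + (p - 1) * a powr p" .
  moreover have "a powr (p - 1) * a = a powr p" using \<open>a > 0\<close> by (simp add: powr_diff)
  ultimately show ?thesis by (simp add: algebra_simps)
qed

text \<open>Jensen's inequality, by integrating the tangent line inequality at the mean.\<close>

lemma powr_integral_density_le:
  fixes m h :: "'c \<Rightarrow> real"
  assumes p: "p \<ge> 1" and m: "integrable M m" "(\<integral>y. m y \<partial>M) = 1" "\<And>y. m y \<ge> 0"
    and h: "\<And>y. h y \<ge> 0" "integrable M (\<lambda>y. m y * h y)" "integrable M (\<lambda>y. m y * h y powr p)"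
  shows "(\<integral>y. m y * h y \<partial>M) powr p \<le> (\<integral>y. m y * h y powr p \<partial>M)"
proof -
  define a where "a = (\<integral>y. m y * h y \<partial>M)"
  have a0: "a \<ge> 0" unfolding a_def using m h by (intro Bochner_Integration.integral_nonneg) auto
  have "a powr p = (\<integral>y. m y * (a powr p - p * a powr (p - 1) * a) + p * a powr (p - 1) * (m y * h y) \<partial>M)"
    using m h by (simp add: a_def[symmetric])
  also have "\<dots> \<le> (\<integral>y. m y * h y powr p \<partial>M)"
  proof (rule integral_mono)
    show "integrable M (\<lambda>y. m y * (a powr p - p * a powr (p - 1) * a) + p * a powr (p - 1) * (m y * h y))"
      using m h by auto
    fix y
    have "m y * (a powr p + p * a powr (p - 1) * (h y - a)) \<le> m y * h y powr p"
      using powr_tangent[OF p a0 h(1)] m(3) by (intro mult_left_mono) auto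
    then show "m y * (a powr p - p * a powr (p - 1) * a) + p * a powr (p - 1) * (m y * h y)
        \<le> m y * h y powr p" by (simp add: algebra_simps)
  qed (rule h)
  finally show ?thesis by (simp add: a_def)
qed

context
  fixes e :: real assumes e: "e > 0"
begin

lemma mollify_measurable:
  fixes W :: "'a::euclidean_space \<Rightarrow> 'b::euclidean_space"
  assumes [measurable]: "W \<in> borel_measurable borel"
  shows "mollify e W \<in> borel_measurable borel"
proof -
  note [measurable] = mollifier_measurable[OF e]
  show ?thesis unfolding mollify_def[abs_def] by measurable
qed

lemma mollify_powr_le:
  fixes W :: "'a::euclidean_space \<Rightarrow> 'b::euclidean_space"
  assumes p: "p \<ge> 1" and W: "integrable lborel W" and Wp: "integrable lborel (\<lambda>x. norm (W x) powr p)"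
  shows "norm (mollify e W x) powr p \<le> (\<integral>y. mollifier e (x - y) * norm (W y) powr p \<partial>lborel)"
proof -
  let ?m = "\<lambda>y. mollifier e (x - y)"
  have im: "integrable lborel ?m" "(\<integral>y. ?m y \<partial>lborel) = 1" by (auto intro: mollifier_shift[OF e])
  have m0: "?m y \<ge> 0" for y by (rule mollifier_nonneg[OF e])
  have "norm (mollify e W x) \<le> (\<integral>y. norm (?m y *\<^sub>R W y) \<partial>lborel)"
    unfolding mollify_def by (rule integral_norm_bound)
  then have "norm (mollify e W x) powr p \<le> (\<integral>y. ?m y * norm (W y) \<partial>lborel) powr p"
    using m0 p by (intro powr_mono2) auto
  also have "\<dots> \<le> (\<integral>y. ?m y * norm (W y) powr p \<partial>lborel)"
    using mollify_integrable[OF e integrable_norm[OF W], of x] mollify_integrable[OF e Wp, of x]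
    by (intro powr_integral_density_le p im m0) auto
  finally show ?thesis .
qed

text \<open>Jensen's inequality at each point, then Tonelli and translation invariance.\<close>

lemma mollify_Lp:
  fixes W :: "'a::euclidean_space \<Rightarrow> 'b::euclidean_space"
  assumes p: "p \<ge> 1" and W: "integrable lborel W" and Wp: "integrable lborel (\<lambda>x. norm (W x) powr p)"
  shows "integrable lborel (\<lambda>x. norm (mollify e W x) powr p)"
    and "(\<integral>x. norm (mollify e W x) powr p \<partial>lborel) \<le> (\<integral>x. norm (W x) powr p \<partial>lborel)"
proof -
  note [measurable] = mollifier_measurable[OF e] mollify_measurable
  have [measurable]: "W \<in> borel_measurable borel" using W by auto
  have [measurable]: "mollify e W \<in> borel_measurable borel" by (rule mollify_measurable) simp
  have m0: "mollifier e z \<ge> 0" for z :: 'a by (rule mollifier_nonneg[OF e])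
  let ?n = "\<lambda>x y. ennreal (mollifier e (x - y) * norm (W y) powr p)"
  have "(\<integral>\<^sup>+x. norm (mollify e W x) powr p \<partial>lborel) \<le> (\<integral>\<^sup>+x. (\<integral>\<^sup>+y. ?n x y \<partial>lborel) \<partial>lborel)"
  proof (rule nn_integral_mono)
    fix x
    have "integrable lborel (\<lambda>y. mollifier e (x - y) * norm (W y) powr p)"
      using mollify_integrable[OF e Wp, of x] by simp
    from nn_integral_eq_integral[OF this] mollify_powr_le[OF p W Wp, of x] m0
    show "ennreal (norm (mollify e W x) powr p) \<le> (\<integral>\<^sup>+y. ?n x y \<partial>lborel)"
      by (simp add: ennreal_leI)
  qed
  also have "\<dots> = (\<integral>\<^sup>+y. (\<integral>\<^sup>+x. ?n x y \<partial>lborel) \<partial>lborel)"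
    by (rule lborel_pair.Fubini'[symmetric]) measurable
  also have "\<dots> = (\<integral>\<^sup>+y. norm (W y) powr p \<partial>lborel)"
  proof (rule nn_integral_cong)
    fix y :: 'a
    have i: "integrable lborel (\<lambda>x. mollifier e (x - y))" "(\<integral>x. mollifier e (x - y) \<partial>lborel) = 1"
      using integrable_affine[OF mollifier_integrable[OF e], of 1 "-y"]
        integral_affine[OF mollifier_measurable[OF e], of 1 "-y"]
      by (simp_all add: mollifier_integral[OF e])
    have "(\<integral>\<^sup>+x. ?n x y \<partial>lborel) = (\<integral>\<^sup>+x. ennreal (mollifier e (x - y)) * ennreal (norm (W y) powr p) \<partial>lborel)"
      using m0 by (simp add: ennreal_mult)
    also have "\<dots> = (\<integral>\<^sup>+x. ennreal (mollifier e (x - y)) \<partial>lborel) * ennreal (norm (W y) powr p)"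
      by (rule nn_integral_multc) measurable
    also have "(\<integral>\<^sup>+x. ennreal (mollifier e (x - y)) \<partial>lborel) = 1"
      using nn_integral_eq_integral[OF i(1)] i(2) m0 by simp
    finally show "(\<integral>\<^sup>+x. ?n x y \<partial>lborel) = ennreal (norm (W y) powr p)" by simp
  qed
  also have "\<dots> = ennreal (\<integral>y. norm (W y) powr p \<partial>lborel)"
    by (rule nn_integral_eq_integral[OF Wp]) auto
  finally have *: "(\<integral>\<^sup>+x. norm (mollify e W x) powr p \<partial>lborel) \<le> ennreal (\<integral>y. norm (W y) powr p \<partial>lborel)" .
  show "integrable lborel (\<lambda>x. norm (mollify e W x) powr p)"
    by (rule integrableI_nonneg) (use * in \<open>auto intro: le_less_trans\<close>)
  show "(\<integral>x. norm (mollify e W x) powr p \<partial>lborel) \<le> (\<integral>x. norm (W x) powr p \<partial>lborel)"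
    by (rule integral_real_bounded[OF _ *]) (auto intro: Bochner_Integration.integral_nonneg)
qed

lemma mollify_L1:
  fixes W :: "'a::euclidean_space \<Rightarrow> 'b::euclidean_space"
  assumes W: "integrable lborel W"
  shows "integrable lborel (mollify e W)"
    and "(\<integral>x. norm (mollify e W x) \<partial>lborel) \<le> (\<integral>x. norm (W x) \<partial>lborel)"
proof -
  have "W \<in> borel_measurable borel" using W by auto
  from mollify_measurable[OF this] mollify_Lp[of 1, OF _ W] W
  show "integrable lborel (mollify e W)"
    "(\<integral>x. norm (mollify e W x) \<partial>lborel) \<le> (\<integral>x. norm (W x) \<partial>lborel)"
    by (auto simp: integrable_norm_iff)
qed

end

lemma mollify_uniform:
  fixes w :: "'a::euclidean_space \<Rightarrow> 'b::euclidean_space"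
  assumes w: "continuous_on UNIV w" and wR: "\<And>x. norm x > R \<Longrightarrow> w x = 0" and d: "d > 0"
  obtains e where "e > 0" "\<And>e' x. 0 < e' \<Longrightarrow> e' \<le> e \<Longrightarrow> norm (mollify e' w x - w x) \<le> d"
proof -
  have i: "integrable lborel w" by (rule continuous_zero_outside_integrable[OF w wR])
  have "uniformly_continuous_on (cball 0 (R + 2)) w"
    by (rule compact_uniformly_continuous) (auto intro: continuous_on_subset[OF w])
  then obtain r where r: "r > 0" "\<And>x y. x \<in> cball 0 (R+2) \<Longrightarrow> y \<in> cball 0 (R+2) \<Longrightarrow>
      dist y x < r \<Longrightarrow> dist (w y) (w x) < d"
    using d unfolding uniformly_continuous_on_def by metis
  have "norm (w y - w x) \<le> d" if "norm (x - y) < min r 1" for x y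
  proof (cases "norm x \<le> R + 1")
    case True
    then have "norm y \<le> R + 2" using that norm_triangle_ineq2[of y x] by (simp add: norm_minus_commute)
    with True r(2)[of x y] that show ?thesis by (auto simp: dist_norm norm_minus_commute intro: less_imp_le)
  next
    case False
    then have "norm y > R" using that norm_triangle_ineq2[of x y] by simp
    with False show ?thesis using d by (simp add: wR)
  qed
  then show thesis using r(1)
    by (intro that[of "min r 1"] mollify_close i) auto
qed

text \<open>The property passes to \<open>L\<^sup>1\<close> limits because mollification does not increase the \<open>L\<^sup>1\<close> norm, uniformly
  in the radius.\<close>

lemma mollify_converges_L1:
  fixes W :: "'a::euclidean_space \<Rightarrow> 'b::euclidean_space"
  assumes "integrable lborel W"
  shows "(\<lambda>n. \<integral>x. norm (mollify (1 / Suc n) W x - W x) \<partial>lborel) \<longlonglongrightarrow> 0"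
proof (rule integrable_induct_continuous[OF assms,
      where P="\<lambda>W. (\<lambda>n. \<integral>x. norm (mollify (1 / Suc n) W x - W x) \<partial>lborel) \<longlonglongrightarrow> 0"])
  fix g :: "'a \<Rightarrow> 'b" and R
  assume 1: "continuous_on UNIV g" "\<And>x. norm x > R \<Longrightarrow> g x = 0"
  have gi: "integrable lborel g" by (rule continuous_zero_outside_integrable[OF 1])
  show "(\<lambda>n. \<integral>x. norm (mollify (1 / Suc n) g x - g x) \<partial>lborel) \<longlonglongrightarrow> 0"
  proof (rule LIMSEQ_I)
    fix d :: real assume d: "d > 0"
    define V where "V = measure lborel (cball (0::'a) (R + 1))"
    have V: "V \<ge> 0" by (simp add: V_def)
    have dV: "d / (V + 1) > 0" using d V by (intro divide_pos_pos) auto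
    obtain e where e: "e > 0" "\<And>e' x. 0 < e' \<Longrightarrow> e' \<le> e \<Longrightarrow> norm (mollify e' g x - g x) \<le> d / (V + 1)"
      using mollify_uniform[OF 1 dV] by blast
    obtain N where N: "1 / Suc N < e" by (rule nat_approx_posE[OF e(1)])
    show "\<exists>n0. \<forall>n\<ge>n0. norm ((\<integral>x. norm (mollify (1 / Suc n) g x - g x) \<partial>lborel) - 0) < d"
    proof (intro exI[of _ N] allI impI)
      fix n assume "n \<ge> N"
      then have "1 / real (Suc n) \<le> 1 / real (Suc N)" by (intro divide_left_mono) auto
      then have n: "0 < 1 / real (Suc n)" "1 / Suc n \<le> e" "1 / real (Suc n) \<le> 1"
        using N by auto
      have "(\<integral>x. norm (mollify (1 / Suc n) g x - g x) \<partial>lborel)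
          \<le> (\<integral>x. indicator (cball (0::'a) (R + 1)) x * (d / (V + 1)) \<partial>lborel)"
      proof (rule integral_mono)
        show "integrable lborel (\<lambda>x. norm (mollify (1 / Suc n) g x - g x))"
          using mollify_L1(1)[OF n(1) gi] gi by auto
        show "integrable lborel (\<lambda>x::'a. indicator (cball 0 (R + 1)) x * (d / (V + 1)))"
          by (intro integrable_mult_left integrable_real_indicator emeasure_bounded_finite) auto
        show "norm (mollify (1 / Suc n) g x - g x) \<le> indicator (cball 0 (R + 1)) x * (d / (V + 1))" for x
        proof (cases "norm x > R + 1")
          case True
          have "mollify (1 / Suc n) g x = 0"
            using n(3) True by (intro mollify_outside[OF n(1), of R] 1(2)) linarith+
          moreover have "g x = 0" using True by (intro 1(2)) simp
          ultimately show ?thesis using d V by (simp add: indicator_def)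
        next
          case False
          with e(2)[OF n(1,2), of x] show ?thesis by (simp add: not_less)
        qed
      qed
      also have "\<dots> = V * (d / (V + 1))" by (simp add: V_def)
      also have "\<dots> = d * (V / (V + 1))" by simp
      also have "\<dots> < d * 1" using d V by (intro mult_strict_left_mono) auto
      finally have "(\<integral>x. norm (mollify (1 / Suc n) g x - g x) \<partial>lborel) < d" by simp
      moreover have "0 \<le> (\<integral>x. norm (mollify (1 / Suc n) g x - g x) \<partial>lborel)"
        by (intro Bochner_Integration.integral_nonneg) auto
      ultimately show "norm ((\<integral>x. norm (mollify (1 / Suc n) g x - g x) \<partial>lborel) - 0) < d"
        by simp
    qed
  qed
next
  fix f g :: "'a \<Rightarrow> 'b"
  assume 2: "integrable lborel f" "integrable lborel g"
    "(\<lambda>n. \<integral>x. norm (mollify (1 / Suc n) f x - f x) \<partial>lborel) \<longlonglongrightarrow> 0"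
    "(\<lambda>n. \<integral>x. norm (mollify (1 / Suc n) g x - g x) \<partial>lborel) \<longlonglongrightarrow> 0"
  show "(\<lambda>n. \<integral>x. norm (mollify (1 / Suc n) (\<lambda>x. f x + g x) x - (f x + g x)) \<partial>lborel) \<longlonglongrightarrow> 0"
  proof (rule tendsto_sandwich[OF _ _ tendsto_const tendsto_add_zero[OF 2(3,4)]])
    show "\<forall>\<^sub>F n in sequentially. (\<integral>x. norm (mollify (1 / Suc n) (\<lambda>x. f x + g x) x - (f x + g x)) \<partial>lborel)
      \<le> (\<integral>x. norm (mollify (1 / Suc n) f x - f x) \<partial>lborel) + (\<integral>x. norm (mollify (1 / Suc n) g x - g x) \<partial>lborel)"
    proof (rule always_eventually, rule allI)
      fix n
      have e: "0 < 1 / real (Suc n)" by simp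
      have eq: "mollify (1 / Suc n) (\<lambda>x. f x + g x) x = mollify (1 / Suc n) f x + mollify (1 / Suc n) g x" for x
        unfolding mollify_def scaleR_add_right
        by (intro Bochner_Integration.integral_add mollify_integrable e 2)
      have i: "integrable lborel (\<lambda>x. mollify (1 / Suc n) f x - f x)" "integrable lborel (\<lambda>x. mollify (1 / Suc n) g x - g x)"
        using mollify_L1(1)[OF e 2(1)] mollify_L1(1)[OF e 2(2)] 2 by auto
      have "(\<integral>x. norm ((mollify (1 / Suc n) f x - f x) + (mollify (1 / Suc n) g x - g x)) \<partial>lborel)
         \<le> (\<integral>x. norm (mollify (1 / Suc n) f x - f x) + norm (mollify (1 / Suc n) g x - g x) \<partial>lborel)"
        using i by (intro integral_mono) (auto intro: norm_triangle_ineq)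
      also have "\<dots> = (\<integral>x. norm (mollify (1 / Suc n) f x - f x) \<partial>lborel) + (\<integral>x. norm (mollify (1 / Suc n) g x - g x) \<partial>lborel)"
        using i by (intro Bochner_Integration.integral_add) auto
      finally show "(\<integral>x. norm (mollify (1 / Suc n) (\<lambda>x. f x + g x) x - (f x + g x)) \<partial>lborel)
      \<le> (\<integral>x. norm (mollify (1 / Suc n) f x - f x) \<partial>lborel) + (\<integral>x. norm (mollify (1 / Suc n) g x - g x) \<partial>lborel)"
        by (simp only: eq add_diff_add)
    qed
  qed (auto intro!: always_eventually Bochner_Integration.integral_nonneg)
next
  fix g :: "'a \<Rightarrow> 'b"
  assume 3: "integrable lborel g" "\<And>d. d > 0 \<Longrightarrow> \<exists>h. integrable lborel h \<and>
    (\<lambda>n. \<integral>x. norm (mollify (1 / Suc n) h x - h x) \<partial>lborel) \<longlonglongrightarrow> 0 \<and>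
    (\<integral>x. norm (g x - h x) \<partial>lborel) < d"
  show "(\<lambda>n. \<integral>x. norm (mollify (1 / Suc n) g x - g x) \<partial>lborel) \<longlonglongrightarrow> 0"
  proof (rule LIMSEQ_I)
    fix d :: real assume d: "d > 0"
    obtain h where h: "integrable lborel h" "(\<lambda>n. \<integral>x. norm (mollify (1 / Suc n) h x - h x) \<partial>lborel) \<longlonglongrightarrow> 0"
      "(\<integral>x. norm (g x - h x) \<partial>lborel) < d / 3"
    proof -
      have "0 < d / 3" using d by simp
      from 3(2)[OF this] that show thesis by (elim exE conjE) (rule that)
    qed
    have "0 < d / 3" using d by simp
    from LIMSEQ_D[OF h(2) this] obtain N where
      N: "\<And>n. n \<ge> N \<Longrightarrow> norm ((\<integral>x. norm (mollify (1 / Suc n) h x - h x) \<partial>lborel) - 0) < d / 3"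
      by blast
    show "\<exists>n0. \<forall>n\<ge>n0. norm ((\<integral>x. norm (mollify (1 / Suc n) g x - g x) \<partial>lborel) - 0) < d"
    proof (intro exI[of _ N] allI impI)
      fix n assume n: "n \<ge> N"
      have e: "0 < 1 / real (Suc n)" by simp
      let ?M = "mollify (1 / real (Suc n))"
      note i = mollify_L1[OF e 3(1)] mollify_L1[OF e h(1)] 3(1) h(1)
      have gh: "integrable lborel (\<lambda>x. g x - h x)" using i by simp
      have "(\<integral>x. norm (?M g x - g x) \<partial>lborel) \<le>
          (\<integral>x. norm (?M (\<lambda>x. g x - h x) x) + norm (?M h x - h x) + norm (g x - h x) \<partial>lborel)"
      proof (rule integral_mono)
        show "norm (?M g x - g x) \<le> norm (?M (\<lambda>x. g x - h x) x) + norm (?M h x - h x) + norm (g x - h x)" for x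
        proof -
          have "?M g x - g x = ?M (\<lambda>x. g x - h x) x + (?M h x - h x) - (g x - h x)"
            unfolding mollify_diff[OF e 3(1) h(1)] by simp
          also have "norm \<dots> \<le> norm (?M (\<lambda>x. g x - h x) x + (?M h x - h x)) + norm (g x - h x)"
            by (rule norm_triangle_ineq4)
          also have "\<dots> \<le> norm (?M (\<lambda>x. g x - h x) x) + norm (?M h x - h x) + norm (g x - h x)"
            by (intro add_right_mono norm_triangle_ineq)
          finally show ?thesis .
        qed
        show "integrable lborel (\<lambda>x. norm (?M (\<lambda>x. g x - h x) x) + norm (?M h x - h x) + norm (g x - h x))"
          using i mollify_L1(1)[OF e gh] by auto
        show "integrable lborel (\<lambda>x. norm (?M g x - g x))"
          by (intro integrable_norm Bochner_Integration.integrable_diff i)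
      qed
      also have "\<dots> = (\<integral>x. norm (?M (\<lambda>x. g x - h x) x) \<partial>lborel) + (\<integral>x. norm (?M h x - h x) \<partial>lborel) + (\<integral>x. norm (g x - h x) \<partial>lborel)"
        using i mollify_L1(1)[OF e gh] by simp
      also have "\<dots> \<le> (\<integral>x. norm (g x - h x) \<partial>lborel) + (\<integral>x. norm (?M h x - h x) \<partial>lborel) + (\<integral>x. norm (g x - h x) \<partial>lborel)"
        using mollify_L1(2)[OF e gh] by simp
      also have "\<dots> < d" using N[OF n] h(3) by (simp add: abs_less_iff)
      finally have "(\<integral>x. norm (?M g x - g x) \<partial>lborel) < d" .
      moreover have "0 \<le> (\<integral>x. norm (?M g x - g x) \<partial>lborel)"
        by (intro Bochner_Integration.integral_nonneg) auto
      ultimately show "norm ((\<integral>x. norm (?M g x - g x) \<partial>lborel) - 0) < d"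
        by simp
    qed
  qed
qed

section \<open>Weak limits of gradients\<close>

lemma young_powr:
  fixes a b p :: real
  assumes p: "p > 1" and a: "a \<ge> 0" and b: "b \<ge> 0"
  shows "a * b \<le> a powr p + b powr (p / (p - 1))"
proof -
  have "a * b \<le> a powr p / p + b powr (p / (p - 1)) / (p / (p - 1))"
    using p a b by (intro Youngs_inequality) (auto simp: field_simps)
  also have "a powr p / p \<le> a powr p" using p by (simp add: divide_le_eq mult_le_cancel_left1)
  also have "b powr (p / (p - 1)) / (p / (p - 1)) \<le> b powr (p / (p - 1))"
    using divide_left_mono[of 1 "p / (p - 1)" "b powr (p / (p - 1))"] p by simp
  finally show ?thesis by simp
qed

text \<open>The parameter moves the weight from one factor to the other: a small \<open>d\<close> makes the first term
  negligible, and a suitable large one fixes the coefficient of the second.\<close>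

lemma young_powr_scaled:
  fixes a b p d :: real
  assumes p: "p > 1" and a: "a \<ge> 0" and b: "b \<ge> 0" and d: "d > 0"
  shows "a * b \<le> d * a powr p + d powr (- 1 / (p - 1)) * b powr (p / (p - 1))"
proof -
  let ?t = "d powr (1 / p)"
  have t: "?t > 0" using d by simp
  have "a * b = (?t * a) * (b / ?t)" using t by simp
  also have "\<dots> \<le> (?t * a) powr p + (b / ?t) powr (p / (p - 1))"
    using t a b by (intro young_powr[OF p]) auto
  also have "(?t * a) powr p = d * a powr p" using a d p by (simp add: powr_mult powr_powr)
  also have "(b / ?t) powr (p / (p - 1)) = d powr (- 1 / (p - 1)) * b powr (p / (p - 1))"
  proof -
    have "?t powr (p / (p - 1)) = d powr (1 / (p - 1))" using p by (simp add: powr_powr)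
    then show ?thesis using b t d by (simp add: powr_divide powr_minus field_simps)
  qed
  finally show ?thesis .
qed

lemma norm_add_powr_le:
  fixes x y :: "'b::real_normed_vector"
  assumes p: "p \<ge> 0"
  shows "norm (x + y) powr p \<le> 2 powr p * (norm x powr p + norm y powr p)"
proof -
  have "norm (x + y) powr p \<le> (2 * max (norm x) (norm y)) powr p"
    using norm_triangle_ineq[of x y] p by (intro powr_mono2) auto
  also have "\<dots> = 2 powr p * max (norm x) (norm y) powr p" by (rule powr_mult)
  also have "\<dots> \<le> 2 powr p * (norm x powr p + norm y powr p)"
    by (intro mult_left_mono) (auto simp: max_def)
  finally show ?thesis .
qed

lemma powr_sum_integrable:
  fixes f g :: "'a::euclidean_space \<Rightarrow> 'b::euclidean_space"
  assumes p: "p \<ge> 0" and [measurable]: "f \<in> borel_measurable borel" "g \<in> borel_measurable borel"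
    and i: "integrable lborel (\<lambda>x. norm (f x) powr p)" "integrable lborel (\<lambda>x. norm (g x) powr p)"
  shows "integrable lborel (\<lambda>x. norm (f x + g x) powr p)"
proof (rule Bochner_Integration.integrable_bound)
  show "integrable lborel (\<lambda>x. 2 powr p * (norm (f x) powr p + norm (g x) powr p))" using i by simp
  show "AE x in lborel. norm (norm (f x + g x) powr p) \<le> norm (2 powr p * (norm (f x) powr p + norm (g x) powr p))"
    using norm_add_powr_le[OF p] by (intro always_eventually allI) (simp add: abs_of_nonneg)
qed measurable

lemma pairing_integrable:
  fixes B g :: "'a::euclidean_space \<Rightarrow> 'b::euclidean_space"
  assumes p: "p > 1" and [measurable]: "B \<in> borel_measurable borel" "g \<in> borel_measurable borel"
    and g: "integrable lborel (\<lambda>x. norm (g x) powr p)"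
    and B: "integrable lborel (\<lambda>x. norm (B x) powr (p / (p - 1)))"
  shows "integrable lborel (\<lambda>x. B x \<bullet> g x)"
proof (rule Bochner_Integration.integrable_bound)
  show "integrable lborel (\<lambda>x. norm (g x) powr p + norm (B x) powr (p / (p - 1)))"
    using g B by simp
  show "AE x in lborel. norm (B x \<bullet> g x) \<le> norm (norm (g x) powr p + norm (B x) powr (p / (p - 1)))"
  proof (intro always_eventually allI)
    fix x
    have "norm (B x \<bullet> g x) \<le> norm (g x) * norm (B x)"
      using Cauchy_Schwarz_ineq2[of "B x" "g x"] by (simp add: mult.commute)
    also have "\<dots> \<le> norm (g x) powr p + norm (B x) powr (p / (p - 1))"
      by (rule young_powr[OF p]) auto
    finally show "norm (B x \<bullet> g x) \<le> norm (norm (g x) powr p + norm (B x) powr (p / (p - 1)))"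
      by simp
  qed
qed measurable

text \<open>Splitting \<open>B\<close> at a large level: where \<open>B\<close> is bounded, \<open>L\<^sup>1\<close> convergence suffices, and where it
  is large, its \<open>L\<^sup>p\<^sup>'\<close> norm is small while the \<open>L\<^sup>p\<close> norms stay bounded.\<close>

lemma weak_convergence_Lp:
  fixes B W :: "'a::euclidean_space \<Rightarrow> 'b::euclidean_space" and g :: "nat \<Rightarrow> 'a \<Rightarrow> 'b"
  assumes p: "p > 1" and B [measurable]: "B \<in> borel_measurable borel"
    and Bp: "integrable lborel (\<lambda>x. norm (B x) powr (p / (p - 1)))"
    and g: "\<And>n. integrable lborel (g n)" and W: "integrable lborel W"
    and conv: "(\<lambda>n. \<integral>x. norm (g n x - W x) \<partial>lborel) \<longlonglongrightarrow> 0"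
    and gp: "\<And>n. integrable lborel (\<lambda>x. norm (g n x) powr p)"
    and Wp: "integrable lborel (\<lambda>x. norm (W x) powr p)"
    and bd: "\<And>n. (\<integral>x. norm (g n x) powr p \<partial>lborel) \<le> (\<integral>x. norm (W x) powr p \<partial>lborel)"
  shows "(\<lambda>n. \<integral>x. B x \<bullet> g n x \<partial>lborel) \<longlonglongrightarrow> (\<integral>x. B x \<bullet> W x \<partial>lborel)"
proof (rule LIMSEQ_I)
  fix e :: real assume e: "e > 0"
  have [measurable]: "g n \<in> borel_measurable borel" "W \<in> borel_measurable borel" for n
    using g[of n] W by auto
  define M where "M = (\<integral>x. norm (W x) powr p \<partial>lborel)"
  have M: "M \<ge> 0" unfolding M_def by (intro Bochner_Integration.integral_nonneg) auto
  define k where "k = 2 powr p * (M + M) + 1"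
  have k: "k > 0" using M unfolding k_def by (intro add_nonneg_pos) auto
  \<comment> \<open>\<open>k\<close> exceeds the bound \<open>2\<^sup>p (M + M)\<close> for the \<open>p\<close>-th powers of the differences\<close>
  define d where "d = e / 3 / k"
  have d: "d > 0" using e k by (simp add: d_def)
  have dM: "d * (2 powr p * (M + M)) < e / 3"
  proof -
    have "d * (2 powr p * (M + M)) < d * k" using d by (simp add: k_def)
    also have "d * k = e / 3" using k by (simp add: d_def)
    finally show ?thesis .
  qed
  define c where "c = d powr (- 1 / (p - 1))"
  have c: "c > 0" using d by (simp add: c_def)
  let ?q = "p / (p - 1)"
  define T where "T m x = (if norm (B x) > real m then norm (B x) powr ?q else 0)" for m x
  have [measurable]: "T m \<in> borel_measurable borel" for m unfolding T_def[abs_def] by measurable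
  have T0: "T m x \<ge> 0" for m x by (simp add: T_def)
  have Ti: "integrable lborel (T m)" for m
    by (rule Bochner_Integration.integrable_bound[OF Bp]) (auto simp: T_def)
  have "(\<lambda>m. \<integral>x. T m x \<partial>lborel) \<longlonglongrightarrow> (\<integral>x. 0 \<partial>(lborel :: 'a measure))"
  proof (rule integral_dominated_convergence[OF _ _ Bp])
    show "AE x in lborel. (\<lambda>m. T m x) \<longlonglongrightarrow> 0"
    proof (rule AE_I2, rule tendsto_eventually)
      fix x
      obtain m where "norm (B x) \<le> real m" using real_arch_simple by blast
      then show "\<forall>\<^sub>F m in sequentially. T m x = 0"
        by (auto simp: eventually_sequentially T_def intro!: exI[of _ m])
    qed
  qed (auto simp: T_def)
  then have "(\<lambda>m. \<integral>x. T m x \<partial>lborel) \<longlonglongrightarrow> 0" by simp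
  moreover have "e / 3 / c > 0" using e c by simp
  ultimately have "\<forall>\<^sub>F m in sequentially. (\<integral>x. T m x \<partial>lborel) < e / 3 / c"
    by (rule order_tendstoD(2))
  then obtain m where m: "(\<integral>x. T m x \<partial>lborel) < e / 3 / c"
    by (auto simp: eventually_sequentially)
  define K where "K = real m + 1"
  have K: "K > 0" by (simp add: K_def)
  have "e / 3 / K > 0" using e K by simp
  with conv have "\<forall>\<^sub>F n in sequentially. (\<integral>x. norm (g n x - W x) \<partial>lborel) < e / 3 / K"
    by (rule order_tendstoD(2))
  then obtain N where N: "\<And>n. n \<ge> N \<Longrightarrow> (\<integral>x. norm (g n x - W x) \<partial>lborel) < e / 3 / K"
    by (auto simp: eventually_sequentially)
  show "\<exists>no. \<forall>n\<ge>no. norm ((\<integral>x. B x \<bullet> g n x \<partial>lborel) - (\<integral>x. B x \<bullet> W x \<partial>lborel)) < e"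
  proof (intro exI[of _ N] allI impI)
    fix n assume n: "n \<ge> N"
    have ig: "integrable lborel (\<lambda>x. B x \<bullet> g n x)" "integrable lborel (\<lambda>x. B x \<bullet> W x)"
      by (rule pairing_integrable[OF p _ _ _ Bp]; use gp Wp in simp)+
    let ?h = "\<lambda>x. K * norm (g n x - W x)
        + (d * (2 powr p * (norm (g n x) powr p + norm (W x) powr p)) + c * T m x)"
    have "norm ((\<integral>x. B x \<bullet> g n x \<partial>lborel) - (\<integral>x. B x \<bullet> W x \<partial>lborel)) = norm (\<integral>x. B x \<bullet> (g n x - W x) \<partial>lborel)"
      using ig by (simp add: inner_diff_right)
    also have "\<dots> \<le> (\<integral>x. norm (B x \<bullet> (g n x - W x)) \<partial>lborel)" by (rule integral_norm_bound)
    also have "\<dots> \<le> (\<integral>x. ?h x \<partial>lborel)"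
    proof (rule integral_mono)
      show "integrable lborel (\<lambda>x. norm (B x \<bullet> (g n x - W x)))"
        using ig by (simp add: inner_diff_right)
      show "integrable lborel ?h" using g W gp Wp Ti by auto
      fix x
      have le: "norm (B x \<bullet> (g n x - W x)) \<le> norm (B x) * norm (g n x - W x)"
        using Cauchy_Schwarz_ineq2[of "B x" "g n x - W x"] by simp
      have nn: "0 \<le> d * (2 powr p * (norm (g n x) powr p + norm (W x) powr p))" "0 \<le> c * T m x"
        "0 \<le> K * norm (g n x - W x)"
        using d c K T0[of m x] by auto
      show "norm (B x \<bullet> (g n x - W x)) \<le> ?h x"
      proof (cases "norm (B x) > real m")
        case False
        then have "norm (B x) * norm (g n x - W x) \<le> K * norm (g n x - W x)"
          by (intro mult_right_mono) (auto simp: K_def)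
        with le nn show ?thesis by linarith
      next
        case True
        have "norm (B x) * norm (g n x - W x) \<le> d * norm (g n x - W x) powr p + c * norm (B x) powr ?q"
          using young_powr_scaled[OF p _ _ d, of "norm (g n x - W x)" "norm (B x)"]
          by (simp add: c_def mult.commute)
        also have "norm (g n x - W x) powr p \<le> 2 powr p * (norm (g n x) powr p + norm (W x) powr p)"
          using norm_add_powr_le[of p "g n x" "- W x"] p by simp
        finally have "norm (B x) * norm (g n x - W x)
            \<le> d * (2 powr p * (norm (g n x) powr p + norm (W x) powr p)) + c * T m x"
          using True d by (simp add: T_def)
        with le nn(3) show ?thesis by linarith
      qed
    qed
    also have "\<dots> = K * (\<integral>x. norm (g n x - W x) \<partial>lborel)
        + (d * (2 powr p * ((\<integral>x. norm (g n x) powr p \<partial>lborel) + M)) + c * (\<integral>x. T m x \<partial>lborel))"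
      using g W gp Wp Ti by (simp add: M_def)
    also have "\<dots> < e / 3 + (e / 3 + e / 3)"
    proof (intro add_strict_mono)
      show "K * (\<integral>x. norm (g n x - W x) \<partial>lborel) < e / 3"
        using N[OF n] K by (simp add: pos_less_divide_eq mult.commute)
      have "d * (2 powr p * ((\<integral>x. norm (g n x) powr p \<partial>lborel) + M)) \<le> d * (2 powr p * (M + M))"
        using bd[of n] d by (intro mult_left_mono) (auto simp: M_def)
      with dM show "d * (2 powr p * ((\<integral>x. norm (g n x) powr p \<partial>lborel) + M)) < e / 3" by linarith
      show "c * (\<integral>x. T m x \<partial>lborel) < e / 3"
        using m c by (simp add: pos_less_divide_eq mult_ac)
    qed
    finally show "norm ((\<integral>x. B x \<bullet> g n x \<partial>lborel) - (\<integral>x. B x \<bullet> W x \<partial>lborel)) < e" by simp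
  qed
qed

lemma set_integrable_continuous_scaleR:
  fixes G :: "'a::euclidean_space \<Rightarrow> 'b::euclidean_space"
  assumes z: "continuous_on UNIV z" and G: "set_integrable lborel (cball 0 R) G"
  shows "set_integrable lborel (cball 0 R) (\<lambda>x. z x *\<^sub>R G x)"
proof -
  have "bounded (z ` cball 0 R)"
    by (intro compact_imp_bounded compact_continuous_image) (auto intro: continuous_on_subset[OF z])
  then obtain B where B: "\<And>x. x \<in> cball 0 R \<Longrightarrow> norm (z x) \<le> B"
    unfolding bounded_iff by blast
  have [measurable]: "z \<in> borel_measurable borel" by (rule continuous_UNIV_borel[OF z])
  have [measurable]: "(\<lambda>x. indicator (cball 0 R) x *\<^sub>R G x) \<in> borel_measurable borel"
    using G unfolding set_integrable_def by auto
  have "integrable lborel (\<lambda>x. z x *\<^sub>R (indicator (cball 0 R) x *\<^sub>R G x))"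
  proof (rule Bochner_Integration.integrable_bound)
    show "integrable lborel (\<lambda>x. B *\<^sub>R (indicator (cball 0 R) x *\<^sub>R G x))"
      using G unfolding set_integrable_def by (rule integrable_scaleR_right)
    show "AE x in lborel. norm (z x *\<^sub>R (indicator (cball 0 R) x *\<^sub>R G x))
        \<le> norm (B *\<^sub>R (indicator (cball 0 R) x *\<^sub>R G x))"
    proof (intro always_eventually allI)
      fix x show "norm (z x *\<^sub>R (indicator (cball 0 R) x *\<^sub>R G x)) \<le> norm (B *\<^sub>R (indicator (cball 0 R) x *\<^sub>R G x))"
        using B[of x] by (cases "x \<in> cball 0 R") (auto intro!: mult_right_mono)
    qed
  qed measurable
  then show ?thesis by (simp add: set_integrable_def mult.commute)
qed

lemma integrable_test_scaleR:
  fixes G :: "'a::euclidean_space \<Rightarrow> 'b::euclidean_space"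
  assumes z: "continuous_on UNIV z" "\<And>x. norm x > R \<Longrightarrow> z x = 0"
    and G: "set_integrable lborel (cball 0 R) G"
  shows "integrable lborel (\<lambda>x. z x *\<^sub>R G x)"
proof -
  have "(\<lambda>x. indicator (cball 0 R) x *\<^sub>R (z x *\<^sub>R G x)) = (\<lambda>x. z x *\<^sub>R G x)"
  proof
    fix x show "indicator (cball 0 R) x *\<^sub>R (z x *\<^sub>R G x) = z x *\<^sub>R G x"
      using z(2)[of x] by (cases "norm x > R") auto
  qed
  with set_integrable_continuous_scaleR[OF z(1) G] show ?thesis by (simp add: set_integrable_def)
qed

lemma set_integrable_continuous:
  fixes G :: "'a::euclidean_space \<Rightarrow> 'b::euclidean_space"
  assumes "continuous_on UNIV G" shows "set_integrable lborel (cball 0 R) G"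
  unfolding set_integrable_def
  by (rule borel_integrable_compact) (auto intro: continuous_on_subset[OF assms])

text \<open>For a test function \<open>\<phi>\<close>, the product \<open>z \<phi>\<close> is one too, and the product rule for smooth functions
  moves the derivative off \<open>z\<close>.\<close>

lemma weak_pair_mult:
  assumes uG: "weak_pair u G" and z: "test_function UNIV z"
  shows "weak_pair (\<lambda>x. u x * z x) (\<lambda>x. z x *\<^sub>R G x + u x *\<^sub>R grad z x)"
proof -
  have u: "continuous_on UNIV u" and [measurable]: "G \<in> borel_measurable borel"
    and G: "\<And>R. set_integrable lborel (cball 0 R) G"
    and w: "\<And>\<phi>. test_function UNIV \<phi> \<Longrightarrow> (\<integral>x. u x *\<^sub>R grad \<phi> x \<partial>lborel) = - (\<integral>x. \<phi> x *\<^sub>R G x \<partial>lborel)"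
    using uG by (auto simp: weak_pair_def)
  note zc = test_function_cont[OF z] continuous_grad_test[OF z]
  have [measurable]: "u \<in> borel_measurable borel" "z \<in> borel_measurable borel" "grad z \<in> borel_measurable borel"
    using u zc by (auto intro: continuous_UNIV_borel)
  have "(\<integral>x. (u x * z x) *\<^sub>R grad \<phi> x \<partial>lborel) = - (\<integral>x. \<phi> x *\<^sub>R (z x *\<^sub>R G x + u x *\<^sub>R grad z x) \<partial>lborel)"
    if p: "test_function UNIV \<phi>" for \<phi>
  proof -
    obtain R where R: "\<And>x. norm x > R \<Longrightarrow> \<phi> x = 0"
      using test_function_bounded_support[OF p] by (metis less_imp_le)
    note pc = test_function_cont[OF p] continuous_grad_test[OF p]
    have zp: "test_function UNIV (\<lambda>x. z x * \<phi> x)"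
      by (rule test_function_mult[OF p test_function_Ck[OF z]])
    have g: "grad (\<lambda>x. z x * \<phi> x) x = z x *\<^sub>R grad \<phi> x + \<phi> x *\<^sub>R grad z x" for x
      by (rule grad_mult[OF test_function_Ck[OF z, of "Suc 0"] test_function_Ck[OF p, of "Suc 0"]])
    have i1: "integrable lborel (\<lambda>x. (u x * z x) *\<^sub>R grad \<phi> x)"
      by (rule continuous_zero_outside_integrable[of _ R])
        (auto intro!: continuous_intros u zc pc simp: grad_zero_outside[OF p R])
    have i2: "integrable lborel (\<lambda>x. \<phi> x *\<^sub>R (u x *\<^sub>R grad z x))"
      by (rule continuous_zero_outside_integrable[of _ R])
        (auto intro!: continuous_intros u zc pc simp: R)
    have i3: "integrable lborel (\<lambda>x. \<phi> x *\<^sub>R (z x *\<^sub>R G x))"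
      by (rule integrable_test_scaleR[OF pc(1) R set_integrable_continuous_scaleR[OF zc(1) G]])
    have "(\<integral>x. u x *\<^sub>R grad (\<lambda>x. z x * \<phi> x) x \<partial>lborel) =
        (\<integral>x. (u x * z x) *\<^sub>R grad \<phi> x + \<phi> x *\<^sub>R (u x *\<^sub>R grad z x) \<partial>lborel)"
      unfolding g by (simp add: scaleR_add_right mult.commute)
    also have "\<dots> = (\<integral>x. (u x * z x) *\<^sub>R grad \<phi> x \<partial>lborel) + (\<integral>x. \<phi> x *\<^sub>R (u x *\<^sub>R grad z x) \<partial>lborel)"
      by (rule Bochner_Integration.integral_add[OF i1 i2])
    finally have "(\<integral>x. (u x * z x) *\<^sub>R grad \<phi> x \<partial>lborel) =
       - ((\<integral>x. \<phi> x *\<^sub>R (z x *\<^sub>R G x) \<partial>lborel) + (\<integral>x. \<phi> x *\<^sub>R (u x *\<^sub>R grad z x) \<partial>lborel))"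
      unfolding w[OF zp] by (simp add: mult.commute algebra_simps)
    also have "\<dots> = - (\<integral>x. \<phi> x *\<^sub>R (z x *\<^sub>R G x) + \<phi> x *\<^sub>R (u x *\<^sub>R grad z x) \<partial>lborel)"
      by (subst Bochner_Integration.integral_add[OF i3 i2]) rule
    finally show ?thesis by (simp only: scaleR_add_right)
  qed
  moreover have "set_integrable lborel (cball 0 R) (\<lambda>x. z x *\<^sub>R G x + u x *\<^sub>R grad z x)" for R
    by (intro set_integral_add set_integrable_continuous_scaleR G zc u set_integrable_continuous)
  ultimately show ?thesis unfolding weak_pair_def
    by (auto intro!: continuous_intros u zc)
qed

text \<open>Test with the dilated function \<open>\<phi>(x/c)\<close> and change variables.\<close>

lemma weak_pair_dilate:
  assumes uG: "weak_pair u G" and c: "c > 0"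
  shows "weak_pair (\<lambda>x. u (c *\<^sub>R x)) (\<lambda>x. c *\<^sub>R G (c *\<^sub>R (x::'a::euclidean_space)))"
proof -
  have u: "continuous_on UNIV u" and [measurable]: "G \<in> borel_measurable borel"
    and G: "\<And>R. set_integrable lborel (cball 0 R) G"
    and w: "\<And>\<phi>. test_function UNIV \<phi> \<Longrightarrow> (\<integral>x. u x *\<^sub>R grad \<phi> x \<partial>lborel) = - (\<integral>x. \<phi> x *\<^sub>R G x \<partial>lborel)"
    using uG by (auto simp: weak_pair_def)
  have [measurable]: "u \<in> borel_measurable borel" by (rule continuous_UNIV_borel[OF u])
  have uc: "continuous_on UNIV (\<lambda>x. u (c *\<^sub>R x))"
    by (rule continuous_on_compose2[OF u]) (auto intro!: continuous_intros)
  have li: "set_integrable lborel (cball 0 R) (\<lambda>x. c *\<^sub>R G (c *\<^sub>R x))" for R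
  proof -
    have "integrable lborel (\<lambda>x. indicator (cball 0 (c * R)) (0 + c *\<^sub>R x) *\<^sub>R G (0 + c *\<^sub>R x))"
      using G[of "c * R"] c by (intro integrable_affine) (auto simp: set_integrable_def)
    then have "integrable lborel (\<lambda>x. c *\<^sub>R (indicator (cball 0 (c * R)) (0 + c *\<^sub>R x) *\<^sub>R G (0 + c *\<^sub>R x)))"
      by (rule integrable_scaleR_right)
    moreover have "(indicator (cball 0 (c * R)) (0 + c *\<^sub>R x) :: real) = indicator (cball 0 R) x" for x :: 'a
      using c by (auto simp: indicator_def)
    ultimately show ?thesis by (simp add: set_integrable_def mult.commute)
  qed
  have "(\<integral>x. u (c *\<^sub>R x) *\<^sub>R grad \<phi> x \<partial>lborel) = - (\<integral>x. \<phi> x *\<^sub>R (c *\<^sub>R G (c *\<^sub>R x)) \<partial>lborel)"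
    if p: "test_function UNIV \<phi>" for \<phi>
  proof -
    note pc = test_function_cont[OF p] continuous_grad_test[OF p]
    have [measurable]: "\<phi> \<in> borel_measurable borel" "grad \<phi> \<in> borel_measurable borel"
      using pc by (auto intro: continuous_UNIV_borel)
    define \<psi> where "\<psi> y = \<phi> ((1/c) *\<^sub>R y + 0)" for y
    have t: "test_function UNIV \<psi>" unfolding \<psi>_def by (rule test_function_affine[OF p]) (use c in auto)
    have g: "grad \<psi> y = (1/c) *\<^sub>R grad \<phi> ((1/c) *\<^sub>R y)" for y
      using grad_affine[OF test_function_Ck[OF p, of "Suc 0"], of "1/c" 0 y] by (simp add: \<psi>_def[abs_def])
    let ?k = "\<bar>c\<bar> ^ DIM('a)"
    have k: "?k \<noteq> 0" using c by simp
    have "(\<integral>x. u x *\<^sub>R grad \<psi> x \<partial>lborel) = ?k *\<^sub>R (\<integral>x. u (c *\<^sub>R x) *\<^sub>R ((1/c) *\<^sub>R grad \<phi> x) \<partial>lborel)"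
      unfolding g using c by (subst integral_affine[where c=c and t=0]) auto
    also have "(\<lambda>x. u (c *\<^sub>R x) *\<^sub>R ((1/c) *\<^sub>R grad \<phi> x)) = (\<lambda>x. (1/c) *\<^sub>R (u (c *\<^sub>R x) *\<^sub>R grad \<phi> x))"
      by (simp add: mult.commute)
    finally have 1: "(\<integral>x. u x *\<^sub>R grad \<psi> x \<partial>lborel) = (?k / c) *\<^sub>R (\<integral>x. u (c *\<^sub>R x) *\<^sub>R grad \<phi> x \<partial>lborel)"
      by (simp only: integral_scaleR_right scaleR_scaleR[of _ _ "integral\<^sup>L _ _"] times_divide_eq_right mult_1_right)
    have "(\<integral>x. \<psi> x *\<^sub>R G x \<partial>lborel) = ?k *\<^sub>R (\<integral>x. \<phi> x *\<^sub>R G (c *\<^sub>R x) \<partial>lborel)"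
      unfolding \<psi>_def using c by (subst integral_affine[where c=c and t=0]) auto
    also have "\<dots> = (?k / c) *\<^sub>R (c *\<^sub>R (\<integral>x. \<phi> x *\<^sub>R G (c *\<^sub>R x) \<partial>lborel))" using c by simp
    also have "c *\<^sub>R (\<integral>x. \<phi> x *\<^sub>R G (c *\<^sub>R x) \<partial>lborel) = (\<integral>x. c *\<^sub>R (\<phi> x *\<^sub>R G (c *\<^sub>R x)) \<partial>lborel)"
      by (rule integral_scaleR_right[symmetric])
    also have "(\<lambda>x. c *\<^sub>R (\<phi> x *\<^sub>R G (c *\<^sub>R x))) = (\<lambda>x. \<phi> x *\<^sub>R (c *\<^sub>R G (c *\<^sub>R x)))"
      by (simp add: mult.commute)
    finally have "(?k / c) *\<^sub>R (\<integral>x. u (c *\<^sub>R x) *\<^sub>R grad \<phi> x \<partial>lborel)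
       = (?k / c) *\<^sub>R (- (\<integral>x. \<phi> x *\<^sub>R (c *\<^sub>R G (c *\<^sub>R x)) \<partial>lborel))"
      using w[OF t] 1 by simp
    then show ?thesis using k c by (subst (asm) scaleR_cancel_left) auto
  qed
  with uc li show ?thesis unfolding weak_pair_def by auto
qed

text \<open>Mollifications of a compactly supported function with weak gradient in \<open>L\<^sup>p\<close>: they are test
  functions with a common support, converge uniformly, and their gradients are bounded in \<open>L\<^sup>p\<close> by the
  weak gradient.\<close>

context
  fixes w :: "'a::euclidean_space \<Rightarrow> real" and W :: "'a \<Rightarrow> 'a" and R p :: real
  assumes wW: "weak_pair w W" and wR: "\<And>x. norm x > R \<Longrightarrow> w x = 0"
    and Wi: "integrable lborel W" and Wp: "integrable lborel (\<lambda>x. norm (W x) powr p)" and p: "p > 1"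
begin

lemma w_cont: "continuous_on UNIV w" using wW by (simp add: weak_pair_def)

abbreviation (input) "w_approx n \<equiv> mollify (1 / real (Suc n)) w"

lemma w_approx_test: "test_function UNIV (w_approx n)"
  by (rule test_function_mollify[OF w_cont wR]) auto

lemma w_approx_grad: "grad (w_approx n) = mollify (1 / real (Suc n)) W"
  by (rule ext, rule grad_mollify[OF w_cont wR _ wW]) auto

lemma w_approx_grad_Lp:
  "integrable lborel (\<lambda>x. norm (grad (w_approx n) x) powr p)"
  "(\<integral>x. norm (grad (w_approx n) x) powr p \<partial>lborel) \<le> (\<integral>x. norm (W x) powr p \<partial>lborel)"
  unfolding w_approx_grad using p by (auto intro!: mollify_Lp Wi Wp)

lemma w_approx_outside: "norm x > R + 1 \<Longrightarrow> w_approx n x = 0"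
proof -
  assume "norm x > R + 1"
  moreover have "1 / real (Suc n) \<le> 1" by simp
  ultimately show ?thesis by (intro mollify_outside[of _ R] wR) (simp, assumption, linarith)
qed

lemma w_approx_uniform:
  assumes d: "d > 0" obtains N where "\<And>n x. n \<ge> N \<Longrightarrow> \<bar>w_approx n x - w x\<bar> \<le> d"
proof -
  obtain e where e: "e > 0" "\<And>e' x. 0 < e' \<Longrightarrow> e' \<le> e \<Longrightarrow> norm (mollify e' w x - w x) \<le> d"
    using mollify_uniform[OF w_cont wR d] by blast
  obtain N where N: "1 / Suc N < e" by (rule nat_approx_posE[OF e(1)])
  have "1 / real (Suc n) \<le> e" if "n \<ge> N" for n
  proof -
    have "1 / real (Suc n) \<le> 1 / real (Suc N)" using that by (intro divide_left_mono) auto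
    with N show ?thesis by linarith
  qed
  then show thesis using e(2) by (intro that[of N]) (simp add: real_norm_def del: of_nat_Suc)
qed

lemma w_approx_tendsto: "(\<lambda>n. w_approx n x) \<longlonglongrightarrow> w x"
proof (rule LIMSEQ_I)
  fix d :: real assume "d > 0"
  then have "d / 2 > 0" by simp
  then obtain N where N: "\<And>n x. n \<ge> N \<Longrightarrow> \<bar>w_approx n x - w x\<bar> \<le> d / 2"
    using w_approx_uniform by blast
  have "norm (w_approx n x - w x) < d" if "n \<ge> N" for n
    using N[OF that, of x] \<open>d > 0\<close> unfolding real_norm_def by linarith
  then show "\<exists>no. \<forall>n\<ge>no. norm (w_approx n x - w x) < d" by blast
qed

text \<open>An equation tested against smooth functions extends to compactly supported Sobolev functions.\<close>

lemma weak_equation_extends: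
  assumes A [measurable]: "A \<in> borel_measurable borel"
    and Ap: "\<And>R. set_integrable lborel (cball 0 R) (\<lambda>x. norm (A x) powr (p / (p - 1)))"
    and f: "\<And>R. set_integrable lborel (cball 0 R) f"
    and eq: "\<And>\<phi>. test_function UNIV \<phi> \<Longrightarrow> (\<integral>x. A x \<bullet> grad \<phi> x \<partial>lborel) = (\<integral>x. f x * \<phi> x \<partial>lborel)"
    and W0: "\<And>x. norm x > R \<Longrightarrow> W x = 0"
  shows "(\<integral>x. A x \<bullet> W x \<partial>lborel) = (\<integral>x. f x * w x \<partial>lborel)"
proof -
  define C where "C = cball (0::'a) (R + 1)"
  define B where "B x = indicator C x *\<^sub>R A x" for x
  have [measurable]: "C \<in> sets borel" by (simp add: C_def)
  have [measurable]: "B \<in> borel_measurable borel" unfolding B_def[abs_def] by measurable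
  have Bp: "integrable lborel (\<lambda>x. norm (B x) powr (p / (p - 1)))"
  proof -
    have "norm (B x) powr (p / (p - 1)) = indicator C x *\<^sub>R norm (A x) powr (p / (p - 1))" for x
      by (simp add: B_def indicator_def)
    then show ?thesis using Ap[of "R + 1"] by (simp add: set_integrable_def C_def)
  qed
  have gi: "integrable lborel (grad (w_approx n))" for n
    unfolding w_approx_grad by (rule mollify_L1(1)[OF _ Wi]) simp
  have L1: "(\<lambda>n. \<integral>x. B x \<bullet> grad (w_approx n) x \<partial>lborel) \<longlonglongrightarrow> (\<integral>x. B x \<bullet> W x \<partial>lborel)"
  proof (rule weak_convergence_Lp[OF p _ Bp gi Wi _ w_approx_grad_Lp(1) Wp w_approx_grad_Lp(2)])
    show "(\<lambda>n. \<integral>x. norm (grad (w_approx n) x - W x) \<partial>lborel) \<longlonglongrightarrow> 0"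
      unfolding w_approx_grad by (rule mollify_converges_L1[OF Wi])
  qed measurable
  have E: "(\<integral>x. B x \<bullet> grad (w_approx n) x \<partial>lborel) = (\<integral>x. f x * w_approx n x \<partial>lborel)" for n
  proof -
    have "grad (w_approx n) x = 0" if "norm x > R + 1" for x
      using w_approx_outside that by (rule grad_zero_outside[OF w_approx_test])
    then have "B x \<bullet> grad (w_approx n) x = A x \<bullet> grad (w_approx n) x" for x
      by (cases "norm x > R + 1") (auto simp: B_def C_def)
    then show ?thesis using eq[OF w_approx_test] by simp
  qed
  have L2: "(\<lambda>n. \<integral>x. f x * w_approx n x \<partial>lborel) \<longlonglongrightarrow> (\<integral>x. f x * w x \<partial>lborel)"
  proof (rule LIMSEQ_I)
    fix d :: real assume d: "d > 0"
    define F where "F x = indicator C x * \<bar>f x\<bar>" for x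
    have fi: "integrable lborel (\<lambda>x. indicator C x * f x)"
      using f[of "R + 1"] by (simp add: set_integrable_def C_def)
    from integrable_norm[OF this] have Fi: "integrable lborel F"
      by (simp add: F_def[abs_def] abs_mult)
    define I where "I = (\<integral>x. F x \<partial>lborel)"
    have I: "I \<ge> 0" unfolding I_def F_def by (intro Bochner_Integration.integral_nonneg) auto
    have "d / (I + 1) > 0" using d I by (intro divide_pos_pos) auto
    then obtain N where N: "\<And>n x. n \<ge> N \<Longrightarrow> \<bar>w_approx n x - w x\<bar> \<le> d / (I + 1)"
      using w_approx_uniform by blast
    show "\<exists>no. \<forall>n\<ge>no. norm ((\<integral>x. f x * w_approx n x \<partial>lborel) - (\<integral>x. f x * w x \<partial>lborel)) < d"
    proof (intro exI[of _ N] allI impI)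
      fix n assume n: "n \<ge> N"
      have i: "integrable lborel (\<lambda>x. w_approx n x *\<^sub>R f x)" "integrable lborel (\<lambda>x. w x *\<^sub>R f x)"
        by (rule integrable_test_scaleR[OF test_function_cont[OF w_approx_test] w_approx_outside f], assumption)
          (rule integrable_test_scaleR[OF w_cont wR f])
      have i': "integrable lborel (\<lambda>x. f x * w_approx n x - f x * w x)"
        using i by (simp add: mult.commute)
      have "norm ((\<integral>x. f x * w_approx n x \<partial>lborel) - (\<integral>x. f x * w x \<partial>lborel))
          = norm (\<integral>x. f x * w_approx n x - f x * w x \<partial>lborel)"
        using i by (simp add: mult.commute)
      also have "\<dots> \<le> (\<integral>x. norm (f x * w_approx n x - f x * w x) \<partial>lborel)" by (rule integral_norm_bound)
      also have "\<dots> \<le> (\<integral>x. d / (I + 1) * F x \<partial>lborel)"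
      proof (rule integral_mono[OF integrable_norm[OF i']])
        show "integrable lborel (\<lambda>x. d / (I + 1) * F x)" using Fi by simp
        fix x
        show "norm (f x * w_approx n x - f x * w x) \<le> d / (I + 1) * F x"
        proof (cases "x \<in> C")
          case True
          have "norm (f x * w_approx n x - f x * w x) = \<bar>w_approx n x - w x\<bar> * \<bar>f x\<bar>"
            by (simp add: abs_mult mult.commute flip: right_diff_distrib)
          also have "\<dots> \<le> d / (I + 1) * \<bar>f x\<bar>" by (intro mult_right_mono N n) auto
          finally show ?thesis using True by (simp add: F_def)
        next
          case False
          then have x: "norm x > R + 1" by (simp add: C_def)
          then have "w x = 0" by (intro wR) simp
          then show ?thesis unfolding w_approx_outside[OF x] using False by (simp add: F_def)
        qed
      qed
      also have "\<dots> = d * (I / (I + 1))" by (simp add: I_def)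
      also have "\<dots> < d * 1" using d I by (intro mult_strict_left_mono) auto
      finally show "norm ((\<integral>x. f x * w_approx n x \<partial>lborel) - (\<integral>x. f x * w x \<partial>lborel)) < d" by simp
    qed
  qed
  have "(\<integral>x. B x \<bullet> W x \<partial>lborel) = (\<integral>x. f x * w x \<partial>lborel)"
    by (rule LIMSEQ_unique[OF L1[unfolded E] L2])
  moreover have "B x \<bullet> W x = A x \<bullet> W x" for x
    using W0[of x] by (cases "norm x > R") (auto simp: B_def C_def)
  ultimately show ?thesis by simp
qed

end

section \<open>Differences between a function and its dilations\<close>

text \<open>The difference is the integral of the derivative along the segment from \<open>l x\<close> to \<open>x\<close>. Jensen's
  inequality for the uniform density \<open>m\<close> on \<open>[l, 1]\<close> takes the power inside, and after exchanging the
  integrals each dilation by \<open>s \<ge> 1/2\<close> costs at most \<open>2\<^sup>N\<close>.\<close>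

lemma test_function_dilation_difference:
  fixes \<phi> :: "'a::euclidean_space \<Rightarrow> real"
  assumes t: "test_function UNIV \<phi>" and p: "p > 1" and l: "1/2 \<le> l" "l < 1"
    and gp: "integrable lborel (\<lambda>x. norm (grad \<phi> x) powr p)"
  shows "(\<integral>\<^sup>+x. ennreal (\<bar>\<phi> (l *\<^sub>R x) - \<phi> x\<bar> powr p * norm x powr (-p)) \<partial>lborel)
    \<le> ennreal ((1 - l) powr p * 2 ^ DIM('a) * (\<integral>x. norm (grad \<phi> x) powr p \<partial>lborel))"
proof -
  let ?g = "grad \<phi>" and ?D = "\<integral>x. norm (grad \<phi> x) powr p \<partial>lborel"
  note gc = continuous_grad_test[OF t]
  have [measurable]: "?g \<in> borel_measurable borel" by (rule continuous_UNIV_borel[OF gc])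
  define m :: "real \<Rightarrow> real" where "m s = indicator {l..1} s / (1 - l)" for s
  have [measurable]: "m \<in> borel_measurable borel" unfolding m_def[abs_def] by measurable
  have m0: "m s \<ge> 0" for s using l by (simp add: m_def)
  have mi: "integrable lborel m" unfolding m_def[abs_def]
    by (intro integrable_divide integrable_real_indicator) (use l in auto)
  have m1: "(\<integral>s. m s \<partial>lborel) = 1" unfolding m_def using l by simp
  have ic: "integrable lborel (\<lambda>s. m s * h s)" if "continuous_on UNIV h" for h :: "real \<Rightarrow> real"
  proof -
    have "integrable lborel (\<lambda>s. indicator {l..1} s *\<^sub>R h s)"
      by (rule borel_integrable_compact) (auto intro: continuous_on_subset[OF that])
    then have "integrable lborel (\<lambda>s. indicator {l..1} s *\<^sub>R h s / (1 - l))"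
      by (rule integrable_divide)
    then show ?thesis by (simp add: m_def)
  qed
  have gsc: "continuous_on UNIV (\<lambda>s. ?g (s *\<^sub>R x))" for x
    by (intro continuous_on_compose2[OF gc] continuous_intros) auto
  have pw: "\<bar>\<phi> (l *\<^sub>R x) - \<phi> x\<bar> powr p * norm x powr (-p)
      \<le> (1 - l) powr p * (\<integral>s. m s * norm (?g (s *\<^sub>R x)) powr p \<partial>lborel)" for x
  proof (cases "x = 0")
    case True
    have "0 \<le> (\<integral>s. m s * norm (?g (s *\<^sub>R x)) powr p \<partial>lborel)"
      using m0 by (intro Bochner_Integration.integral_nonneg) auto
    with True p show ?thesis by simp
  next
    case False
    have i1: "integrable lborel (\<lambda>s. m s * norm (?g (s *\<^sub>R x)))"
      by (rule ic) (intro continuous_intros gsc)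
    have i2: "integrable lborel (\<lambda>s. m s * norm (?g (s *\<^sub>R x)) powr p)"
      by (rule ic) (use p in \<open>intro continuous_on_powr' continuous_intros gsc; simp\<close>)
    have "(\<integral>s. indicator {l..1} s *\<^sub>R (x \<bullet> ?g (s *\<^sub>R x)) \<partial>lborel) = \<phi> (1 *\<^sub>R x) - \<phi> (l *\<^sub>R x)"
    proof (rule integral_FTC_Icc)
      show "l \<le> 1" using l by simp
      show "continuous_on {l..1} (\<lambda>s. x \<bullet> ?g (s *\<^sub>R x))"
        by (intro continuous_intros continuous_on_subset[OF gsc]) auto
      fix s
      have "((\<lambda>s. s *\<^sub>R x) has_derivative (\<lambda>h. h *\<^sub>R x)) (at s within {l..1})"
        by (auto intro!: derivative_eq_intros)
      from has_derivative_compose[OF this gderiv_grad[OF t, unfolded gderiv_def]]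
      show "((\<lambda>s. \<phi> (s *\<^sub>R x)) has_vector_derivative x \<bullet> ?g (s *\<^sub>R x)) (at s within {l..1})"
        by (simp add: has_vector_derivative_def)
    qed
    then have "\<phi> x - \<phi> (l *\<^sub>R x) = (\<integral>s. (1 - l) * (m s * (x \<bullet> ?g (s *\<^sub>R x))) \<partial>lborel)"
      using l by (simp add: m_def)
    then have "\<bar>\<phi> (l *\<^sub>R x) - \<phi> x\<bar> = \<bar>\<integral>s. (1 - l) * (m s * (x \<bullet> ?g (s *\<^sub>R x))) \<partial>lborel\<bar>"
      by (simp add: abs_minus_commute)
    also have "\<dots> \<le> (\<integral>s. \<bar>(1 - l) * (m s * (x \<bullet> ?g (s *\<^sub>R x)))\<bar> \<partial>lborel)"
      using integral_norm_bound[of lborel "\<lambda>s. (1 - l) * (m s * (x \<bullet> ?g (s *\<^sub>R x)))"] by simp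
    also have "\<dots> \<le> (\<integral>s. ((1 - l) * norm x) * (m s * norm (?g (s *\<^sub>R x))) \<partial>lborel)"
    proof (rule integral_mono)
      have "integrable lborel (\<lambda>s. m s * (x \<bullet> ?g (s *\<^sub>R x)))" by (rule ic) (intro continuous_intros gsc)
      then have "integrable lborel (\<lambda>s. (1 - l) * (m s * (x \<bullet> ?g (s *\<^sub>R x))))" by simp
      from integrable_norm[OF this] show "integrable lborel (\<lambda>s. \<bar>(1 - l) * (m s * (x \<bullet> ?g (s *\<^sub>R x)))\<bar>)"
        by simp
      show "integrable lborel (\<lambda>s. ((1 - l) * norm x) * (m s * norm (?g (s *\<^sub>R x))))" using i1 by simp
      fix s
      have "\<bar>(1 - l) * (m s * (x \<bullet> ?g (s *\<^sub>R x)))\<bar> = (1 - l) * m s * \<bar>x \<bullet> ?g (s *\<^sub>R x)\<bar>"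
        using l m0[of s] by (simp add: abs_mult)
      also have "\<dots> \<le> (1 - l) * m s * (norm x * norm (?g (s *\<^sub>R x)))"
        using l m0[of s] by (intro mult_left_mono Cauchy_Schwarz_ineq2) auto
      finally show "\<bar>(1 - l) * (m s * (x \<bullet> ?g (s *\<^sub>R x)))\<bar> \<le> ((1 - l) * norm x) * (m s * norm (?g (s *\<^sub>R x)))"
        by (simp add: mult_ac)
    qed
    also have "\<dots> = ((1 - l) * norm x) * (\<integral>s. m s * norm (?g (s *\<^sub>R x)) \<partial>lborel)" by simp
    finally have "\<bar>\<phi> (l *\<^sub>R x) - \<phi> x\<bar> powr p \<le> (((1 - l) * norm x) * (\<integral>s. m s * norm (?g (s *\<^sub>R x)) \<partial>lborel)) powr p"
      using p by (intro powr_mono2) auto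
    also have "\<dots> = (1 - l) powr p * norm x powr p * (\<integral>s. m s * norm (?g (s *\<^sub>R x)) \<partial>lborel) powr p"
      by (simp add: powr_mult)
    also have "\<dots> \<le> (1 - l) powr p * norm x powr p * (\<integral>s. m s * norm (?g (s *\<^sub>R x)) powr p \<partial>lborel)"
      using p by (intro mult_left_mono powr_integral_density_le mi m1 m0 i1 i2) auto
    finally have "\<bar>\<phi> (l *\<^sub>R x) - \<phi> x\<bar> powr p * norm x powr (-p)
       \<le> ((1 - l) powr p * norm x powr p * (\<integral>s. m s * norm (?g (s *\<^sub>R x)) powr p \<partial>lborel)) * norm x powr (-p)"
      by (intro mult_right_mono) auto
    also have "\<dots> = (1 - l) powr p * (\<integral>s. m s * norm (?g (s *\<^sub>R x)) powr p \<partial>lborel)"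
      using False by (simp add: powr_minus)
    finally show ?thesis .
  qed
  let ?n = "\<lambda>x s. ennreal (m s * norm (?g (s *\<^sub>R x)) powr p)"
  have "(\<integral>\<^sup>+x. ennreal (\<bar>\<phi> (l *\<^sub>R x) - \<phi> x\<bar> powr p * norm x powr (-p)) \<partial>lborel)
      \<le> (\<integral>\<^sup>+x. ennreal ((1 - l) powr p) * (\<integral>\<^sup>+s. ?n x s \<partial>lborel) \<partial>lborel)"
  proof (rule nn_integral_mono)
    fix x :: 'a
    have i2: "integrable lborel (\<lambda>s. m s * norm (?g (s *\<^sub>R x)) powr p)"
      by (rule ic) (use p in \<open>intro continuous_on_powr' continuous_intros gsc; simp\<close>)
    have "(\<integral>\<^sup>+s. ?n x s \<partial>lborel) = ennreal (\<integral>s. m s * norm (?g (s *\<^sub>R x)) powr p \<partial>lborel)"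
      by (rule nn_integral_eq_integral[OF i2]) (simp add: m0)
    with pw[of x] show "ennreal (\<bar>\<phi> (l *\<^sub>R x) - \<phi> x\<bar> powr p * norm x powr (-p))
        \<le> ennreal ((1 - l) powr p) * (\<integral>\<^sup>+s. ?n x s \<partial>lborel)"
      by (simp add: ennreal_leI flip: ennreal_mult')
  qed
  also have "\<dots> = ennreal ((1 - l) powr p) * (\<integral>\<^sup>+x. (\<integral>\<^sup>+s. ?n x s \<partial>lborel) \<partial>lborel)"
    by (rule nn_integral_cmult) measurable
  also have "(\<integral>\<^sup>+x. (\<integral>\<^sup>+s. ?n x s \<partial>lborel) \<partial>lborel) = (\<integral>\<^sup>+s. (\<integral>\<^sup>+x. ?n x s \<partial>lborel) \<partial>lborel)"
    by (rule lborel_pair.Fubini'[symmetric]) measurable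
  also have "\<dots> \<le> (\<integral>\<^sup>+s. ennreal (m s) * ennreal (2 ^ DIM('a) * ?D) \<partial>lborel)"
  proof (rule nn_integral_mono)
    fix s :: real
    show "(\<integral>\<^sup>+x. ?n x s \<partial>lborel) \<le> ennreal (m s) * ennreal (2 ^ DIM('a) * ?D)"
    proof (cases "s \<in> {l..1}")
      case False then show ?thesis by (simp add: m_def)
    next
      case True
      then have s: "s \<ge> 1/2" "s > 0" using l by auto
      let ?I = "\<integral>\<^sup>+x. ennreal (norm (?g (s *\<^sub>R x)) powr p) \<partial>lborel"
      have "ennreal ?D = (\<integral>\<^sup>+x. ennreal (norm (?g x) powr p) \<partial>lborel)"
        by (rule nn_integral_eq_integral[OF gp, symmetric]) simp
      also have "\<dots> = ennreal (s ^ DIM('a)) * ?I"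
        using s by (subst nn_integral_affine[where c=s and t=0]) auto
      finally have D: "ennreal ?D = ennreal (s ^ DIM('a)) * ?I" .
      have "1 \<le> (2 * s) ^ DIM('a)" using s by (intro one_le_power) auto
      then have "1 \<le> ennreal (2 ^ DIM('a)) * ennreal (s ^ DIM('a))"
        using s by (simp add: power_mult_distrib flip: ennreal_mult)
      then have "?I \<le> ennreal (2 ^ DIM('a)) * ennreal (s ^ DIM('a)) * ?I"
        using mult_right_mono[of 1 "ennreal (2 ^ DIM('a)) * ennreal (s ^ DIM('a))" ?I] by simp
      also have "\<dots> = ennreal (2 ^ DIM('a) * ?D)"
        by (simp add: D ennreal_mult' mult.assoc)
      finally have I: "?I \<le> ennreal (2 ^ DIM('a) * ?D)" .
      have "(\<integral>\<^sup>+x. ?n x s \<partial>lborel) = ennreal (m s) * ?I"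
        using m0[of s] by (simp add: ennreal_mult' nn_integral_cmult)
      also have "\<dots> \<le> ennreal (m s) * ennreal (2 ^ DIM('a) * ?D)" by (rule mult_left_mono[OF I]) simp
      finally show ?thesis .
    qed
  qed
  also have "\<dots> = ennreal (2 ^ DIM('a) * ?D)"
  proof -
    have "(\<integral>\<^sup>+s. ennreal (m s) \<partial>lborel) = 1"
      using nn_integral_eq_integral[OF mi] m0 m1 by simp
    then show ?thesis by (simp add: nn_integral_multc)
  qed
  also have "ennreal ((1 - l) powr p) * ennreal (2 ^ DIM('a) * ?D) = ennreal ((1 - l) powr p * 2 ^ DIM('a) * ?D)"
    by (simp add: ennreal_mult'[symmetric] mult.assoc)
  finally show ?thesis by (simp add: mult_left_mono)
qed

text \<open>Mollify and use Fatou's lemma, so that pointwise convergence suffices on the left.\<close>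

lemma dilation_difference:
  fixes w :: "'a::euclidean_space \<Rightarrow> real"
  assumes wW: "weak_pair w W" and wR: "\<And>x. norm x > R \<Longrightarrow> w x = 0"
    and Wi: "integrable lborel W" and Wp: "integrable lborel (\<lambda>x. norm (W x) powr p)" and p: "p > 1"
    and l: "1/2 \<le> l" "l < 1"
  shows "(\<integral>\<^sup>+x. ennreal (\<bar>w (l *\<^sub>R x) - w x\<bar> powr p * norm x powr (-p)) \<partial>lborel)
    \<le> ennreal ((1 - l) powr p * 2 ^ DIM('a) * (\<integral>x. norm (W x) powr p \<partial>lborel))" (is "_ \<le> ?C")
proof -
  let ?w = "\<lambda>n. mollify (1 / real (Suc n)) w"
  let ?f = "\<lambda>v x. ennreal (\<bar>v (l *\<^sub>R x) - v x\<bar> powr p * norm x powr (-p))"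
  note T = w_approx_test[OF wW wR Wi Wp p] and L = w_approx_tendsto[OF wW wR Wi Wp p]
    and G = w_approx_grad_Lp[OF wW wR Wi Wp p]
  have [measurable]: "?w n \<in> borel_measurable borel" for n
    by (rule continuous_UNIV_borel[OF test_function_cont[OF T]])
  have "(\<lambda>n. ?f (?w n) x) \<longlonglongrightarrow> ?f w x" for x
    using p by (intro tendsto_ennrealI tendsto_mult tendsto_powr' tendsto_rabs tendsto_diff L tendsto_const) auto
  then have lim: "liminf (\<lambda>n. ?f (?w n) x) = ?f w x" for x
    by (intro lim_imp_Liminf) auto
  have "(\<integral>\<^sup>+x. ?f w x \<partial>lborel) = (\<integral>\<^sup>+x. liminf (\<lambda>n. ?f (?w n) x) \<partial>lborel)" unfolding lim by rule
  also have "\<dots> \<le> liminf (\<lambda>n. \<integral>\<^sup>+x. ?f (?w n) x \<partial>lborel)"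
    by (rule nn_integral_liminf) measurable
  also have "\<dots> \<le> liminf (\<lambda>n. ?C)"
  proof (rule Liminf_mono, rule always_eventually, rule allI)
    fix n
    have "(\<integral>\<^sup>+x. ?f (?w n) x \<partial>lborel) \<le> ennreal ((1 - l) powr p * 2 ^ DIM('a) * (\<integral>x. norm (grad (?w n) x) powr p \<partial>lborel))"
      by (rule test_function_dilation_difference[OF T p l G(1)])
    also have "\<dots> \<le> ?C" by (intro ennreal_leI mult_left_mono G(2)) auto
    finally show "(\<integral>\<^sup>+x. ?f (?w n) x \<partial>lborel) \<le> ?C" .
  qed
  also have "\<dots> = ?C" by (simp add: Liminf_const)
  finally show ?thesis .
qed

section \<open>Power weights\<close>

abbreviation weight :: "'a::euclidean_space \<Rightarrow> real" where
  "weight x \<equiv> max 1 (norm x)"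

text \<open>The dilates of the shell \<open>1 \<le> |x| < 2\<close> by powers of \<open>t\<close> contribute a geometric series.\<close>

lemma nn_integral_shells_finite:
  fixes t a :: real
  assumes t: "t > 0" and r: "t powr (DIM('a) + a) < 1"
  shows "(\<integral>\<^sup>+x. (\<Sum>k. indicator {y::'a::euclidean_space. 1 \<le> norm y \<and> norm y < 2} ((1 / t ^ k) *\<^sub>R x)
      * ennreal (norm x powr a)) \<partial>lborel) < \<infinity>"
proof -
  let ?S = "{y::'a. 1 \<le> norm y \<and> norm y < 2}"
  let ?r = "t powr (DIM('a) + a)"
  have [measurable]: "?S \<in> sets borel" by measurable
  define I where "I = (\<integral>\<^sup>+y. indicator ?S y * ennreal (norm (y::'a) powr a) \<partial>lborel)"
  have I: "I < \<infinity>"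
  proof -
    have "I \<le> (\<integral>\<^sup>+y. ennreal (max 1 (2 powr a)) * indicator (cball (0::'a) 2) y \<partial>lborel)"
      unfolding I_def
    proof (rule nn_integral_mono)
      fix y :: 'a
      have "norm y powr a \<le> max 1 (2 powr a)" if "1 \<le> norm y" "norm y < 2"
      proof (cases "a \<ge> 0")
        case True
        then have "norm y powr a \<le> 2 powr a" using that by (intro powr_mono2) auto
        then show ?thesis by simp
      next
        case False
        then have "norm y powr a \<le> 1 powr a" using that by (intro powr_mono2') auto
        then show ?thesis by simp
      qed
      then show "indicator ?S y * ennreal (norm y powr a) \<le> ennreal (max 1 (2 powr a)) * indicator (cball 0 2) y"
        by (auto simp: indicator_def intro!: ennreal_leI)
    qed
    also have "\<dots> = ennreal (max 1 (2 powr a)) * emeasure lborel (cball (0::'a) 2)"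
      by (rule nn_integral_cmult_indicator) simp
    also have "\<dots> < \<infinity>"
      using emeasure_bounded_finite[OF bounded_cball, of "0::'a" 2] by (simp add: ennreal_mult_less_top)
    finally show ?thesis .
  qed
  have shell: "(\<integral>\<^sup>+x. indicator ?S ((1 / t ^ k) *\<^sub>R x) * ennreal (norm x powr a) \<partial>lborel) = ennreal (?r ^ k) * I" for k
  proof -
    have tk: "t ^ k > 0" using t by simp
    have "(\<integral>\<^sup>+x. indicator ?S ((1 / t ^ k) *\<^sub>R x) * ennreal (norm x powr a) \<partial>lborel)
      = ennreal ((t ^ k) ^ DIM('a)) * (\<integral>\<^sup>+y. indicator ?S y * ennreal (norm (t ^ k *\<^sub>R y) powr a) \<partial>lborel)"
      using tk t by (subst nn_integral_affine[where c="t ^ k" and t=0]) auto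
    also have "(\<integral>\<^sup>+y. indicator ?S y * ennreal (norm (t ^ k *\<^sub>R y) powr a) \<partial>lborel)
        = (\<integral>\<^sup>+y. ennreal ((t ^ k) powr a) * (indicator ?S y * ennreal (norm (y::'a) powr a)) \<partial>lborel)"
      using tk by (intro nn_integral_cong) (simp add: powr_mult ennreal_mult mult_ac)
    also have "\<dots> = ennreal ((t ^ k) powr a) * I"
      unfolding I_def by (rule nn_integral_cmult) measurable
    finally have "(\<integral>\<^sup>+x. indicator ?S ((1 / t ^ k) *\<^sub>R x) * ennreal (norm x powr a) \<partial>lborel)
        = ennreal ((t ^ k) ^ DIM('a) * (t ^ k) powr a) * I"
      using tk by (simp add: ennreal_mult mult.assoc)
    also have "(t ^ k) ^ DIM('a) * (t ^ k) powr a = (t ^ k) powr (DIM('a) + a)"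
      using tk t by (simp add: powr_add powr_realpow)
    also have "\<dots> = ?r ^ k" using t by (simp add: powr_realpow[symmetric] powr_powr mult.commute)
    finally show ?thesis .
  qed
  have "(\<integral>\<^sup>+x. (\<Sum>k. indicator ?S ((1 / t ^ k) *\<^sub>R x) * ennreal (norm x powr a)) \<partial>lborel)
      = (\<Sum>k. ennreal (?r ^ k) * I)"
    by (subst nn_integral_suminf) (auto simp: shell)
  also have "\<dots> = (\<Sum>k. ennreal (?r ^ k)) * I" by (rule ennreal_suminf_multc)
  also have "(\<Sum>k. ennreal (?r ^ k)) = ennreal (\<Sum>k. ?r ^ k)"
    by (rule suminf_ennreal2) (use r t in \<open>auto intro!: summable_geometric\<close>)
  also have "ennreal (\<Sum>k. ?r ^ k) * I < \<infinity>" using I by (simp add: ennreal_mult_less_top)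
  finally show ?thesis .
qed

text \<open>The first exponent governs integrability at the origin, the sum of both that at infinity: cover the
  unit ball by shells shrinking with ratio \<open>1/2\<close>, its complement by shells growing with ratio 2.\<close>

lemma integrable_norm_weight:
  fixes a b :: real
  assumes a: "a > - real DIM('a)" and b: "a + b < - real DIM('a)"
  shows "integrable lborel (\<lambda>x::'a::euclidean_space. norm x powr a * weight x powr b)"
proof (rule integrableI_nonneg)
  let ?g = "\<lambda>t a k (x::'a). indicator {y::'a. 1 \<le> norm y \<and> norm y < 2} ((1 / t ^ k) *\<^sub>R x) * ennreal (norm x powr a)"
  have [measurable]: "{y::'a. 1 \<le> norm y \<and> norm y < 2} \<in> sets borel" by measurable
  have term_le: "?g t c k x \<le> (\<Sum>k. ?g t c k x)" for t c k x
  proof -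
    have "h k \<le> suminf h" for h :: "nat \<Rightarrow> ennreal" using sum_le_suminf[of h "{k}"] by simp
    then show ?thesis .
  qed
  have "ennreal (norm x powr a * weight x powr b) \<le> (\<Sum>k. ?g (1/2) a k x) + (\<Sum>k. ?g 2 (a + b) k x)" for x
  proof -
    consider "x = 0" | "0 < norm x" "norm x < 1" | "norm x \<ge> 1" by fastforce
    then show ?thesis
    proof cases
      case 2
      obtain k where k: "2 ^ k * norm x < 2" "1 \<le> 2 ^ k * norm x"
      proof -
        define P where "P k \<longleftrightarrow> 1 \<le> 2 ^ k * norm x" for k
        obtain n where "1 / norm x < 2 ^ n" using real_arch_pow[of 2 "1 / norm x"] by auto
        then have Pn: "P n" using 2 by (simp add: P_def field_simps)
        define k where "k = (LEAST k. P k)"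
        have Pk: "P k" unfolding k_def by (rule LeastI[of P, OF Pn])
        have "k \<noteq> 0"
        proof
          assume "k = 0"
          with Pk have "P 0" by simp
          with 2 show False by (simp add: P_def)
        qed
        then obtain j where j: "k = Suc j" by (cases k) auto
        then have "\<not> P j" using not_less_Least[of j P] by (simp add: k_def)
        then show thesis using Pk j by (intro that[of k]) (auto simp: P_def)
      qed
      have "ennreal (norm x powr a * weight x powr b) = ennreal (norm x powr a)" using 2 by simp
      also have "\<dots> = ?g (1/2) a k x" using k by (simp add: power_divide)
      also have "\<dots> \<le> (\<Sum>k. ?g (1/2) a k x)" by (rule term_le)
      finally show ?thesis by (rule order_trans) simp
    next
      case 3
      obtain k where k: "1 \<le> norm x / 2 ^ k" "norm x / 2 ^ k < 2"
      proof -
        define P where "P k \<longleftrightarrow> norm x < 2 * 2 ^ k" for k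
        obtain n where "norm x < 2 ^ n" using real_arch_pow[of 2 "norm x"] by auto
        then have Pn: "P n" using 3 by (simp add: P_def)
        define k where "k = (LEAST k. P k)"
        have Pk: "P k" unfolding k_def by (rule LeastI[of P, OF Pn])
        have "2 ^ k \<le> norm x"
        proof (cases k)
          case (Suc j)
          then have "\<not> P j" using not_less_Least[of j P] by (simp add: k_def)
          with Suc show ?thesis by (simp add: P_def)
        qed (use 3 in simp)
        then show thesis using Pk by (intro that[of k]) (auto simp: P_def field_simps)
      qed
      have "ennreal (norm x powr a * weight x powr b) = ennreal (norm x powr (a + b))"
        using 3 by (simp add: powr_add max_def)
      also have "\<dots> = ?g 2 (a + b) k x" using k by simp
      also have "\<dots> \<le> (\<Sum>k. ?g 2 (a + b) k x)" by (rule term_le)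
      finally show ?thesis by (rule order_trans) simp
    qed simp
  qed
  then have "(\<integral>\<^sup>+x. ennreal (norm x powr a * weight (x::'a) powr b) \<partial>lborel)
      \<le> (\<integral>\<^sup>+x. (\<Sum>k. ?g (1/2) a k x) + (\<Sum>k. ?g 2 (a + b) k x) \<partial>lborel)"
    by (intro nn_integral_mono)
  also have "\<dots> = (\<integral>\<^sup>+x. (\<Sum>k. ?g (1/2) a k x) \<partial>lborel) + (\<integral>\<^sup>+x. (\<Sum>k. ?g 2 (a + b) k x) \<partial>lborel)"
    by (rule nn_integral_add) measurable
  also have "\<dots> < \<infinity>"
  proof -
    have "1 < 2 powr (DIM('a) + a)" using a by (intro gr_one_powr) auto
    then have "(1/2) powr (DIM('a) + a) < 1" by (simp add: powr_divide)
    moreover have "2 powr (DIM('a) + (a + b)) < 2 powr 0" using b by (intro powr_less_mono) auto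
    then have "2 powr (DIM('a) + (a + b)) < 1" by simp
    ultimately show ?thesis
      using nn_integral_shells_finite[of "1/2" a, where 'a='a] nn_integral_shells_finite[of 2 "a + b", where 'a='a]
      by simp
  qed
  finally show "(\<integral>\<^sup>+x. ennreal (norm x powr a * weight (x::'a) powr b) \<partial>lborel) < \<infinity>" .
qed auto

section \<open>Cutoff functions\<close>

definition cutoff :: "nat \<Rightarrow> 'a::euclidean_space \<Rightarrow> real" where
  "cutoff n x = bump ((1 / real (Suc n)) *\<^sub>R x)"

lemma test_function_cutoff: "test_function UNIV (cutoff n)"
  using test_function_affine[OF test_function_bump, of "1 / real (Suc n)" 0]
  unfolding cutoff_def[abs_def] add_0_right by simp

lemma cutoff_nonneg: "cutoff n x \<ge> 0" and cutoff_le_1: "cutoff n x \<le> 1"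
  by (auto simp: cutoff_def bump_nonneg bump_le_1)

lemma tendsto_inverse_Suc_scaleR: "(\<lambda>n. (1 / real (Suc n)) *\<^sub>R x) \<longlonglongrightarrow> (0::'a::real_normed_vector)"
  using tendsto_scaleR[OF LIMSEQ_inverse_real_of_nat tendsto_const[of x]]
  by (simp add: inverse_eq_divide)

lemma cutoff_tendsto: "(\<lambda>n. cutoff n x) \<longlonglongrightarrow> 1"
proof -
  have "isCont bump (0::'a)"
    using Ck_continuous[OF Ck_bump[where 'a='a]] by (simp add: continuous_on_eq_continuous_at)
  from isCont_tendsto_compose[OF this tendsto_inverse_Suc_scaleR[of x]]
  show ?thesis by (simp add: cutoff_def[abs_def] bump_0)
qed

lemma grad_cutoff: "grad (cutoff n) x = (1 / real (Suc n)) *\<^sub>R grad bump ((1 / real (Suc n)) *\<^sub>R x)"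
  using grad_affine[OF Ck_bump[of "Suc 0"], of "1 / real (Suc n)" 0 x]
  unfolding cutoff_def[abs_def] add_0_right .

text \<open>The bound is uniform in \<open>n\<close>: the gradient has size \<open>1/(n + 1)\<close> and lives where \<open>|x| \<le> n + 1\<close>.\<close>

lemma grad_cutoff_bound:
  obtains B where "B > 0" "\<And>n x::'a::euclidean_space. norm (grad (cutoff n) x) \<le> B / weight x"
proof -
  have z: "grad bump x = 0" if "norm x > 1" for x :: 'a
    using bump_outside[OF less_imp_le] that by (rule grad_zero_outside[OF test_function_bump])
  obtain B where B: "B > 0" "\<And>x::'a. norm (grad bump x) \<le> B"
    using continuous_zero_outside_bounded[OF continuous_grad_test[OF test_function_bump] z] by blast
  have "norm (grad (cutoff n) x) \<le> B / weight x" for n and x :: 'a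
  proof (cases "norm x > real (Suc n)")
    case True
    then have "norm ((1 / real (Suc n)) *\<^sub>R x) > 1" by (simp del: of_nat_Suc)
    from z[OF this] B show ?thesis unfolding grad_cutoff by simp
  next
    case False
    then have "weight x \<le> real (Suc n)" by simp
    then have "B / real (Suc n) \<le> B / weight x" using B by (intro divide_left_mono) auto
    moreover have "norm (grad (cutoff n) x) \<le> B / real (Suc n)"
      unfolding grad_cutoff using B(2)[of "(1 / real (Suc n)) *\<^sub>R x"]
      by (simp add: divide_right_mono del: of_nat_Suc)
    ultimately show ?thesis by linarith
  qed
  with B(1) that show thesis by blast
qed

lemma grad_cutoff_tendsto: "(\<lambda>n. grad (cutoff n) x) \<longlonglongrightarrow> 0"
proof -
  have "isCont (grad bump) (0::'a)"
    using continuous_grad_test[OF test_function_bump[where 'a='a]] by (simp add: continuous_on_eq_continuous_at)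
  from tendsto_scaleR[OF LIMSEQ_inverse_real_of_nat isCont_tendsto_compose[OF this tendsto_inverse_Suc_scaleR[of x]]]
  show ?thesis unfolding grad_cutoff by (simp add: inverse_eq_divide)
qed

section \<open>Borel representatives\<close>

lemma lebesgue_ex_borel:
  fixes G :: "'a::euclidean_space \<Rightarrow> 'b::euclidean_space"
  assumes G: "G \<in> borel_measurable lebesgue"
  obtains H where "H \<in> borel_measurable borel" "AE x in lebesgue. G x = H x"
proof -
  have "\<exists>h\<in>borel_measurable lborel. AE x in lborel. G x \<bullet> b = h x" for b
    using G by (intro completion_ex_borel_measurable_real) simp
  then obtain h where h: "\<And>b. h b \<in> borel_measurable lborel" "\<And>b. AE x in lborel. G x \<bullet> b = h b x"
    by metis
  note [measurable] = h(1)
  have "AE x in lborel. \<forall>b\<in>Basis. G x \<bullet> b = h b x" by (intro AE_finite_allI h(2)) simp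
  then have "AE x in lborel. G x = (\<Sum>b\<in>Basis. h b x *\<^sub>R b)"
  proof eventually_elim
    case (elim x)
    have "G x = (\<Sum>b\<in>Basis. (G x \<bullet> b) *\<^sub>R b)" by (simp add: euclidean_representation)
    with elim show ?case by simp
  qed
  then have "AE x in lebesgue. G x = (\<Sum>b\<in>Basis. h b x *\<^sub>R b)" by (rule AE_completion)
  moreover have "(\<lambda>x. \<Sum>b\<in>Basis. h b x *\<^sub>R b) \<in> borel_measurable borel" by measurable
  ultimately show thesis using that by blast
qed

lemma integral_lebesgue_eq_lborel:
  fixes F F' :: "'a::euclidean_space \<Rightarrow> 'b::euclidean_space"
  assumes F: "F \<in> borel_measurable lebesgue" and F': "F' \<in> borel_measurable borel"
    and eq: "AE x in lebesgue. F x = F' x"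
  shows "integral\<^sup>L lebesgue F = integral\<^sup>L lborel F'"
    and "integrable lebesgue F \<longleftrightarrow> integrable lborel F'"
proof -
  have F'': "F' \<in> borel_measurable lborel" "F' \<in> borel_measurable lebesgue"
    using F' by (auto intro: measurable_completion)
  show "integral\<^sup>L lebesgue F = integral\<^sup>L lborel F'"
    using integral_cong_AE[OF F F''(2) eq] integral_completion[OF F''(1)] by simp
  show "integrable lebesgue F \<longleftrightarrow> integrable lborel F'"
    using integrable_cong_AE[OF F F''(2) eq] integrable_completion[OF F''(1)] by simp
qed

lemma Lp_loc_set_integrable:
  fixes f f' :: "'a::euclidean_space \<Rightarrow> 'b::euclidean_space"
  assumes f: "Lp_loc p UNIV f" and f' [measurable]: "f' \<in> borel_measurable borel"
    and eq: "AE x in lebesgue. f x = f' x"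
  shows "set_integrable lborel (cball 0 R) (\<lambda>x. norm (f' x) powr p)"
proof -
  have [measurable]: "f \<in> borel_measurable lebesgue"
    using f by (simp add: Lp_loc_def lebesgue_on_UNIV_eq)
  have [measurable]: "cball (0::'a) R \<in> sets lebesgue" by simp
  have "integrable (lebesgue_on (cball 0 R)) (\<lambda>x. norm (f x) powr p)"
    using f by (simp add: Lp_loc_def)
  then have i: "integrable lebesgue (\<lambda>x. indicator (cball 0 R) x *\<^sub>R norm (f x) powr p)"
    by (subst (asm) integrable_restrict_space) auto
  have ae: "AE x in lebesgue. indicator (cball 0 R) x *\<^sub>R norm (f x) powr p = indicator (cball 0 R) x *\<^sub>R norm (f' x) powr p"
    using eq by eventually_elim simp
  have [measurable]: "cball (0::'a) R \<in> sets borel" by simp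
  have m: "(\<lambda>x. indicator (cball 0 R) x *\<^sub>R norm (f x) powr p) \<in> borel_measurable lebesgue"
    "(\<lambda>x. indicator (cball 0 R) x *\<^sub>R norm (f' x) powr p) \<in> borel_measurable borel"
    using i by auto
  show ?thesis unfolding set_integrable_def
    by (rule iffD1[OF integral_lebesgue_eq_lborel(2)[OF m ae] i])
qed

lemma set_integrable_norm_powr_1:
  fixes f :: "'a::euclidean_space \<Rightarrow> 'b::euclidean_space"
  assumes [measurable]: "f \<in> borel_measurable borel"
    and i: "set_integrable lborel (cball 0 R) (\<lambda>x. norm (f x) powr 1)"
  shows "set_integrable lborel (cball 0 R) f"
proof -
  have [measurable]: "cball (0::'a) R \<in> sets borel" by simp
  have "integrable lborel (\<lambda>x. norm (indicator (cball 0 R) x *\<^sub>R f x))"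
    using i by (simp add: set_integrable_def)
  moreover have "(\<lambda>x. indicator (cball 0 R) x *\<^sub>R f x) \<in> borel_measurable lborel" by measurable
  ultimately show ?thesis unfolding set_integrable_def by (simp only: integrable_norm_iff)
qed

lemma continuous_solution_borel:
  fixes u :: "'a::euclidean_space \<Rightarrow> real"
  assumes "continuous_solution p \<alpha> q UNIV u"
  obtains G where "weak_pair u G" "\<And>R. set_integrable lborel (cball 0 R) (\<lambda>x. norm (G x) powr p)"
    "\<And>R. set_integrable lborel (cball 0 R) (\<lambda>x. norm x powr \<alpha> * u x powr q)"
    "\<And>\<phi>. test_function UNIV \<phi> \<Longrightarrow> (\<integral>x. (norm (G x) powr (p - 2) *\<^sub>R G x) \<bullet> grad \<phi> x \<partial>lborel)
        = (\<integral>x. norm x powr \<alpha> * u x powr q * \<phi> x \<partial>lborel)"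
proof -
  let ?f = "\<lambda>x. norm x powr \<alpha> * u x powr q"
  have u: "continuous_on UNIV u" and fL: "Lp_loc 1 UNIV ?f"
    using assms by (auto simp: continuous_solution_def)
  obtain G0 where w: "weak_gradient UNIV u G0" and G0p: "Lp_loc p UNIV G0"
    and e: "\<And>\<phi>. test_function UNIV \<phi> \<Longrightarrow>
      (LINT x|lebesgue_on UNIV. (norm (G0 x) powr (p - 2) *\<^sub>R G0 x) \<bullet> grad \<phi> x) =
      (LINT x|lebesgue_on UNIV. norm x powr \<alpha> * u x powr q * \<phi> x)"
    using assms by (auto simp: continuous_solution_def)
  have G0m [measurable]: "G0 \<in> borel_measurable lebesgue"
    using G0p by (simp add: Lp_loc_def lebesgue_on_UNIV_eq)
  obtain G where G [measurable]: "G \<in> borel_measurable borel" and ae: "AE x in lebesgue. G0 x = G x"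
    using lebesgue_ex_borel[OF G0m] by blast
  have um [measurable]: "u \<in> borel_measurable borel" by (rule continuous_UNIV_borel[OF u])
  have fm [measurable]: "?f \<in> borel_measurable borel" by measurable
  have G1: "Lp_loc 1 UNIV G0" using w by (simp add: weak_gradient_def)
  show thesis
  proof (rule that)
    show "set_integrable lborel (cball 0 R) (\<lambda>x. norm (G x) powr p)" for R
      by (rule Lp_loc_set_integrable[OF G0p G ae])
    show "set_integrable lborel (cball 0 R) ?f" for R
      by (rule set_integrable_norm_powr_1[OF fm Lp_loc_set_integrable[OF fL fm]]) simp
    have "set_integrable lborel (cball 0 R) G" for R
      by (rule set_integrable_norm_powr_1[OF G Lp_loc_set_integrable[OF G1 G ae]])
    moreover have "(\<integral>x. u x *\<^sub>R grad \<phi> x \<partial>lborel) = - (\<integral>x. \<phi> x *\<^sub>R G x \<partial>lborel)"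
      if t: "test_function UNIV \<phi>" for \<phi>
    proof -
      have [measurable]: "\<phi> \<in> borel_measurable borel" "grad \<phi> \<in> borel_measurable borel"
        using test_function_cont[OF t] continuous_grad_test[OF t] by (auto intro: continuous_UNIV_borel)
      have pl [measurable]: "\<phi> \<in> borel_measurable lebesgue" by (rule measurable_completion) simp
      have "integral\<^sup>L lebesgue (\<lambda>x. u x *\<^sub>R grad \<phi> x) = (\<integral>x. u x *\<^sub>R grad \<phi> x \<partial>lborel)"
        by (rule integral_completion) measurable
      moreover have "integral\<^sup>L lebesgue (\<lambda>x. \<phi> x *\<^sub>R G0 x) = (\<integral>x. \<phi> x *\<^sub>R G x \<partial>lborel)"
      proof (rule integral_lebesgue_eq_lborel(1))
        show "AE x in lebesgue. \<phi> x *\<^sub>R G0 x = \<phi> x *\<^sub>R G x" using ae by eventually_elim simp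
      qed measurable
      ultimately show ?thesis using w t by (simp add: weak_gradient_def lebesgue_on_UNIV_eq)
    qed
    ultimately show "weak_pair u G" unfolding weak_pair_def using u G by blast
    fix \<phi> :: "'a \<Rightarrow> real" assume t: "test_function UNIV \<phi>"
    have [measurable]: "\<phi> \<in> borel_measurable borel" "grad \<phi> \<in> borel_measurable borel"
      using test_function_cont[OF t] continuous_grad_test[OF t] by (auto intro: continuous_UNIV_borel)
    have pl [measurable]: "grad \<phi> \<in> borel_measurable lebesgue" by (rule measurable_completion) simp
    have "integral\<^sup>L lebesgue (\<lambda>x. (norm (G0 x) powr (p - 2) *\<^sub>R G0 x) \<bullet> grad \<phi> x)
        = (\<integral>x. (norm (G x) powr (p - 2) *\<^sub>R G x) \<bullet> grad \<phi> x \<partial>lborel)"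
    proof (rule integral_lebesgue_eq_lborel(1))
      show "AE x in lebesgue. (norm (G0 x) powr (p - 2) *\<^sub>R G0 x) \<bullet> grad \<phi> x = (norm (G x) powr (p - 2) *\<^sub>R G x) \<bullet> grad \<phi> x"
        using ae by eventually_elim simp
    qed measurable
    moreover have "integral\<^sup>L lebesgue (\<lambda>x. ?f x * \<phi> x) = (\<integral>x. ?f x * \<phi> x \<partial>lborel)"
      by (rule integral_completion) measurable
    ultimately show "(\<integral>x. (norm (G x) powr (p - 2) *\<^sub>R G x) \<bullet> grad \<phi> x \<partial>lborel) = (\<integral>x. ?f x * \<phi> x \<partial>lborel)"
      using e[OF t] by (simp add: lebesgue_on_UNIV_eq)
  qed
qed

section \<open>The energy identity\<close>

lemma integrable_weight:
  assumes b: "b < - real DIM('a)"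
  shows "integrable lborel (\<lambda>x::'a::euclidean_space. weight x powr b)"
proof -
  have "integrable lborel (\<lambda>x::'a. norm x powr 0 * weight x powr b)"
    by (rule integrable_norm_weight) (use b in auto)
  moreover have "AE x in lborel. norm (x::'a) powr 0 * weight x powr b = weight x powr b"
    using AE_lborel_singleton[of "0::'a"] by eventually_elim simp
  ultimately show ?thesis by (subst (asm) integrable_cong_AE) auto
qed

lemma cutoff_product:
  fixes v z :: "'a::euclidean_space \<Rightarrow> real"
  assumes vV: "weak_pair v V" and Vp: "\<And>R. set_integrable lborel (cball 0 R) (\<lambda>x. norm (V x) powr p)"
    and z: "test_function UNIV z" and p: "p > 1"
  defines "W \<equiv> \<lambda>x. z x *\<^sub>R V x + v x *\<^sub>R grad z x"
  obtains R where "weak_pair (\<lambda>x. v x * z x) W" "\<And>x. norm x > R \<Longrightarrow> v x * z x = 0"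
    "\<And>x. norm x > R \<Longrightarrow> W x = 0" "integrable lborel W" "integrable lborel (\<lambda>x. norm (W x) powr p)"
proof -
  obtain R where R: "\<And>x. norm x \<ge> R \<Longrightarrow> z x = 0" using test_function_bounded_support[OF z] by blast
  then have R': "\<And>x. norm x > R \<Longrightarrow> z x = 0" by simp
  have v: "continuous_on UNIV v" and V [measurable]: "V \<in> borel_measurable borel"
    using vV by (auto simp: weak_pair_def)
  note zc = test_function_cont[OF z] continuous_grad_test[OF z]
  have [measurable]: "v \<in> borel_measurable borel" "z \<in> borel_measurable borel" "grad z \<in> borel_measurable borel"
    using v zc by (auto intro: continuous_UNIV_borel)
  have gz: "grad z x = 0" if "norm x > R" for x
    using R' that by (rule grad_zero_outside[OF z])
  have W0: "W x = 0" if "norm x > R" for x using R'[OF that] gz[OF that] by (simp add: W_def)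
  have wp: "weak_pair (\<lambda>x. v x * z x) W" unfolding W_def by (rule weak_pair_mult[OF vV z])
  have "(\<lambda>x. indicator (cball 0 R) x *\<^sub>R W x) = W"
  proof
    fix x show "indicator (cball 0 R) x *\<^sub>R W x = W x"
      using W0[of x] by (cases "norm x > R") auto
  qed
  moreover have "set_integrable lborel (cball 0 R) W" using wp by (simp add: weak_pair_def)
  ultimately have Wi: "integrable lborel W" by (simp add: set_integrable_def)
  have zp: "continuous_on UNIV (\<lambda>x. \<bar>z x\<bar> powr p)"
    using p by (intro continuous_on_powr' continuous_intros zc) auto
  have "integrable lborel (\<lambda>x. \<bar>z x\<bar> powr p *\<^sub>R norm (V x) powr p)"
    by (rule integrable_test_scaleR[OF zp _ Vp]) (use R' p in auto)
  then have i1: "integrable lborel (\<lambda>x. norm (z x *\<^sub>R V x) powr p)" by (simp add: powr_mult)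
  have "continuous_on UNIV (\<lambda>x. norm (v x *\<^sub>R grad z x) powr p)"
    using p by (intro continuous_on_powr' continuous_intros v zc) auto
  then have i2: "integrable lborel (\<lambda>x. norm (v x *\<^sub>R grad z x) powr p)"
    by (rule continuous_zero_outside_integrable) (use gz p in auto)
  have "integrable lborel (\<lambda>x. norm (W x) powr p)"
    unfolding W_def by (rule powr_sum_integrable[OF _ _ _ i1 i2]) (use p in auto)
  with wp R' W0 Wi that[of R] show thesis by simp
qed

text \<open>A nonnegative, fast decaying weak solution, with its gradient \<open>G\<close> given by a Borel function. On
  \<open>real ^ 'n\<close> this is the situation of the main result.\<close>

locale henon_solution =
  fixes u :: "'a::euclidean_space \<Rightarrow> real" and G :: "'a \<Rightarrow> 'a" and p q \<alpha> C :: real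
  assumes p1: "1 < p" and pN: "p < DIM('a)" and q1: "p - 1 < q"
    and q2: "q < (DIM('a) + \<alpha>) * p / (DIM('a) - p) - 1"
    and uG: "weak_pair u G" and Gloc: "\<And>R. set_integrable lborel (cball 0 R) (\<lambda>x. norm (G x) powr p)"
    and floc: "\<And>R. set_integrable lborel (cball 0 R) (\<lambda>x. norm x powr \<alpha> * u x powr q)"
    and eq: "\<And>\<phi>. test_function UNIV \<phi> \<Longrightarrow> (\<integral>x. (norm (G x) powr (p - 2) *\<^sub>R G x) \<bullet> grad \<phi> x \<partial>lborel)
        = (\<integral>x. norm x powr \<alpha> * u x powr q * \<phi> x \<partial>lborel)"
    and u0: "\<And>x. 0 \<le> u x"
    and decay: "\<And>x. norm x powr ((p + \<alpha>) / (q + 1 - p)) * u x \<le> C"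
begin

definition rate :: real where "rate = (p + \<alpha>) / (q + 1 - p)"

definition rhs :: "'a \<Rightarrow> real" where "rhs x = norm x powr \<alpha> * u x powr q"

definition flux :: "'a \<Rightarrow> 'a" where "flux x = norm (G x) powr (p - 2) *\<^sub>R G x"

lemma subcritical: "(q + 1) * (real DIM('a) - p) < (real DIM('a) + \<alpha>) * p"
proof -
  have "real DIM('a) - p > 0" using pN by simp
  moreover have "q + 1 < (real DIM('a) + \<alpha>) * p / (real DIM('a) - p)" using q2 by simp
  ultimately show ?thesis by (simp add: pos_less_divide_eq)
qed

lemma p_alpha_pos: "p + \<alpha> > 0"
proof -
  have "p * (real DIM('a) - p) < (q + 1) * (real DIM('a) - p)" using q1 pN by (intro mult_strict_right_mono) auto
  with subcritical have "p * (real DIM('a) - p) < p * (real DIM('a) + \<alpha>)" by (simp add: mult.commute)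
  then show ?thesis using p1 by simp
qed

lemma rate_pos: "rate > 0" using p_alpha_pos q1 by (simp add: rate_def)

lemma rate_mult: "rate * (q + 1 - p) = p + \<alpha>" using q1 by (simp add: rate_def)

text \<open>The form in which subcriticality is used: \<open>|x|\<close> to the power \<open>- rate\<close> has its gradient in \<open>L\<^sup>p\<close> near
  infinity.\<close>

lemma rate_p: "rate * p + p > real DIM('a)"
proof -
  have "(q + 1 - p) * (real DIM('a) - p) < p * (p + \<alpha>)" using subcritical by (simp add: algebra_simps)
  also have "\<dots> = (q + 1 - p) * (p * rate)" using rate_mult by (simp add: mult.commute mult.left_commute)
  finally have "real DIM('a) - p < p * rate" using q1 by (simp add: mult_less_cancel_left)
  then show ?thesis by (simp add: mult.commute)
qed

lemma rate_q: "\<alpha> - rate * (q + 1) < - real DIM('a)"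
  using rate_mult rate_p by (simp add: algebra_simps)

lemma u_cont: "continuous_on UNIV u" and G_meas [measurable]: "G \<in> borel_measurable borel"
  using uG by (auto simp: weak_pair_def)

lemma u_meas [measurable]: "u \<in> borel_measurable borel" by (rule continuous_UNIV_borel[OF u_cont])

lemma flux_meas [measurable]: "flux \<in> borel_measurable borel"
  unfolding flux_def[abs_def] by measurable

lemma rhs_meas [measurable]: "rhs \<in> borel_measurable borel"
  unfolding rhs_def[abs_def] by measurable

lemma rhs_nonneg: "rhs x \<ge> 0" by (simp add: rhs_def)

lemma norm_flux: "norm (flux x) = norm (G x) powr (p - 1)"
proof (cases "G x = 0")
  case False
  then have "norm (G x) powr (p - 2) * norm (G x) powr 1 = norm (G x) powr (p - 1)"
    by (subst powr_add[symmetric]) simp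
  with False show ?thesis by (simp add: flux_def)
qed (simp add: flux_def)

lemma flux_inner_G: "flux x \<bullet> G x = norm (G x) powr p"
proof (cases "G x = 0")
  case False
  then have "norm (G x) powr (p - 2) * norm (G x) powr 2 = norm (G x) powr p"
    by (subst powr_add[symmetric]) simp
  with False show ?thesis by (simp add: flux_def dot_square_norm)
qed (simp add: flux_def)

lemma flux_powr: "norm (flux x) powr (p / (p - 1)) = norm (G x) powr p"
  using p1 by (simp add: norm_flux powr_powr)

text \<open>Continuity near the origin and the decay assumption elsewhere combine to a bound by one constant.\<close>

definition K :: real where "K = (SOME K. K > 0 \<and> (\<forall>x. u x \<le> K * weight x powr (- rate)))"

lemma K: "K > 0" "u x \<le> K * weight x powr (- rate)"
proof -
  have "\<exists>K. K > 0 \<and> (\<forall>x. u x \<le> K * weight x powr (- rate))"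
  proof -
    have "bounded (u ` cball 0 1)"
      by (intro compact_imp_bounded compact_continuous_image) (auto intro: continuous_on_subset[OF u_cont])
    then obtain B where B: "B > 0" "\<And>x. norm x \<le> 1 \<Longrightarrow> u x \<le> B"
      unfolding bounded_pos by (force simp: abs_le_iff)
    have "u x \<le> (B + \<bar>C\<bar>) * weight x powr (- rate)" for x
    proof (cases "norm x \<le> 1")
      case True
      then show ?thesis using B(2)[of x] by simp
    next
      case False
      then have "x \<noteq> 0" by auto
      then have "u x = (norm x powr rate * u x) * norm x powr (- rate)"
        by (simp add: powr_minus)
      also have "\<dots> \<le> (B + \<bar>C\<bar>) * norm x powr (- rate)"
        using decay[of x] B(1) by (intro mult_right_mono) (auto simp: rate_def)
      finally show ?thesis using False by (simp add: max_def)
    qed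
    moreover have "B + \<bar>C\<bar> > 0" using B by simp
    ultimately show ?thesis by blast
  qed
  from someI_ex[OF this] show "K > 0" "u x \<le> K * weight x powr (- rate)" unfolding K_def by auto
qed

lemma u_powr_q: "u x powr q \<le> K powr q * weight x powr (- rate * q)"
proof -
  have "u x powr q \<le> (K * weight x powr (- rate)) powr q"
    using K(2)[of x] u0 p1 q1 by (intro powr_mono2) auto
  then show ?thesis by (simp add: powr_mult powr_powr)
qed

lemma rhs_mult_integrable:
  assumes [measurable]: "v \<in> borel_measurable borel" and v: "\<And>x. 0 \<le> v x" "\<And>x. v x \<le> L * weight x powr (- rate)"
  shows "integrable lborel (\<lambda>x. rhs x * v x)"
proof (rule Bochner_Integration.integrable_bound)
  have "integrable lborel (\<lambda>x::'a. norm x powr \<alpha> * weight x powr (- rate * (q + 1)))"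
    using rate_q p_alpha_pos pN by (intro integrable_norm_weight) (auto simp: algebra_simps)
  then show "integrable lborel (\<lambda>x::'a. (K powr q * L) * (norm x powr \<alpha> * weight x powr (- rate * (q + 1))))"
    by simp
  show "AE x in lborel. norm (rhs x * v x) \<le> norm ((K powr q * L) * (norm x powr \<alpha> * weight x powr (- rate * (q + 1))))"
  proof (rule AE_I2)
    fix x
    have "norm (rhs x * v x) = norm x powr \<alpha> * (u x powr q * v x)"
      using v(1)[of x] by (simp add: rhs_def abs_mult)
    also have "\<dots> \<le> norm x powr \<alpha> * ((K powr q * weight x powr (- rate * q)) * (L * weight x powr (- rate)))"
      using v u_powr_q by (intro mult_left_mono mult_mono) auto
    also have "\<dots> = (K powr q * L) * (norm x powr \<alpha> * (weight x powr (- rate * q) * weight x powr (- rate)))"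
      by (simp add: mult_ac)
    also have "weight x powr (- rate * q) * weight x powr (- rate) = weight x powr (- rate * (q + 1))"
      by (subst powr_add[symmetric]) (simp add: algebra_simps)
    finally show "norm (rhs x * v x) \<le> norm ((K powr q * L) * (norm x powr \<alpha> * weight x powr (- rate * (q + 1))))"
      using abs_ge_self order_trans by (metis real_norm_def)
  qed
qed measurable

lemma weight_p_integrable: "integrable lborel (\<lambda>x::'a. weight x powr (- (rate + 1) * p))"
  using rate_p by (intro integrable_weight) (simp add: algebra_simps)

lemma test_cutoff:
  assumes vV: "weak_pair v V" and Vp: "\<And>R. set_integrable lborel (cball 0 R) (\<lambda>x. norm (V x) powr p)"
    and z: "test_function UNIV z"
  shows "(\<integral>x. flux x \<bullet> (z x *\<^sub>R V x + v x *\<^sub>R grad z x) \<partial>lborel) = (\<integral>x. rhs x * (v x * z x) \<partial>lborel)"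
proof -
  obtain R where R: "weak_pair (\<lambda>x. v x * z x) (\<lambda>x. z x *\<^sub>R V x + v x *\<^sub>R grad z x)"
    "\<And>x. norm x > R \<Longrightarrow> v x * z x = 0" "\<And>x. norm x > R \<Longrightarrow> z x *\<^sub>R V x + v x *\<^sub>R grad z x = 0"
    "integrable lborel (\<lambda>x. z x *\<^sub>R V x + v x *\<^sub>R grad z x)"
    "integrable lborel (\<lambda>x. norm (z x *\<^sub>R V x + v x *\<^sub>R grad z x) powr p)"
    using cutoff_product[OF vV Vp z p1] by blast
  show ?thesis
    by (rule weak_equation_extends[OF R(1,2,4,5) p1])
      (use Gloc floc eq R(3) in \<open>auto simp: flux_powr rhs_def[abs_def] flux_def[symmetric]\<close>)
qed

lemma grad_cutoff_power:
  "grad (\<lambda>x. cutoff n x ^ Suc m) x = (real (Suc m) * cutoff n x ^ m) *\<^sub>R grad (cutoff n) (x::'a)"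
proof -
  have "DERIV (\<lambda>t. t ^ Suc m) (cutoff n x) :> real (Suc m) * cutoff n x ^ m"
    using DERIV_pow[of "Suc m" "cutoff n x"] by simp
  from GDERIV_DERIV_compose[OF gderiv_grad[OF test_function_cutoff] this] show ?thesis
    by (rule grad_eq)
qed

text \<open>The Caccioppoli estimate: testing with \<open>u\<close> times a high power of the cutoff, the boundary term is
  absorbed into the gradient term, and the decay of \<open>u\<close> bounds what is left.\<close>

lemma G_Lp: "integrable lborel (\<lambda>x. norm (G x) powr p)"
proof -
  obtain B where B: "B > 0" "\<And>n x::'a. norm (grad (cutoff n) x) \<le> B / weight x"
    using grad_cutoff_bound[where 'a='a] by blast
  \<comment> \<open>an exponent \<open>m + 1 \<ge> p\<close> of the cutoff makes the \<open>p/(p - 1)\<close>-th power of its \<open>m\<close>-th power at most its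
    \<open>(m + 1)\<close>-st power\<close>
  obtain m where "p \<le> real m" using real_arch_simple by blast
  then have m: "p \<le> real (Suc m)" by simp
  \<comment> \<open>chosen so that the gradient term in the scaled Young inequality has coefficient \<open>1/2\<close>\<close>
  define D where "D = 2 powr (p - 1)"
  have D: "D > 0" "D powr (- 1 / (p - 1)) = 1 / 2"
    using p1 by (auto simp: D_def powr_powr powr_minus)
  define S where "S x = (real (Suc m) * B * K) powr p * weight x powr (- (rate + 1) * p)" for x :: 'a
  have Si: "integrable lborel S" unfolding S_def[abs_def] using weight_p_integrable by simp
  have fu: "integrable lborel (\<lambda>x. rhs x * u x)" by (rule rhs_mult_integrable[OF u_meas u0 K(2)])
  define M where "M = 2 * ((\<integral>x. rhs x * u x \<partial>lborel) + D * (\<integral>x. S x \<partial>lborel))"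
  let ?z = "\<lambda>n x. cutoff n (x::'a) ^ Suc m"
  have z: "test_function UNIV (?z n)" for n
    using test_function_mult[OF test_function_cutoff[of n] Ck_power[OF test_function_Ck[OF test_function_cutoff[of n]]], of m]
    by (simp add: mult.commute)
  have zc: "continuous_on UNIV (?z n)" for n by (rule test_function_cont[OF z])
  have [measurable]: "(\<lambda>x. cutoff n (x::'a)) \<in> borel_measurable borel" "grad (cutoff n) \<in> borel_measurable borel"
    "grad (?z n) \<in> borel_measurable borel" for n
    using test_function_cont[OF test_function_cutoff] continuous_grad_test[OF test_function_cutoff] continuous_grad_test[OF z]
    by (auto intro!: continuous_UNIV_borel)
  have z01: "0 \<le> ?z n x" "?z n x \<le> 1" for n x
    using cutoff_nonneg[of n x] cutoff_le_1[of n x] by (auto intro: power_le_one simp del: power_Suc)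
  have bnd: "integrable lborel (\<lambda>x. norm (G x) powr p * ?z n x) \<and>
      (\<integral>x. norm (G x) powr p * ?z n x \<partial>lborel) \<le> M" for n
  proof -
    obtain R where R: "\<And>x. norm x \<ge> R \<Longrightarrow> ?z n x = 0" using test_function_bounded_support[OF z[of n]] by blast
    have "integrable lborel (\<lambda>x. ?z n x *\<^sub>R norm (G x) powr p)"
      by (rule integrable_test_scaleR[OF zc _ Gloc]) (rule R[OF less_imp_le])
    then have i: "integrable lborel (\<lambda>x. norm (G x) powr p * ?z n x)" by (simp add: mult.commute)
    define X where "X x = flux x \<bullet> (?z n x *\<^sub>R G x + u x *\<^sub>R grad (?z n) x)" for x
    have [measurable]: "X \<in> borel_measurable borel" unfolding X_def[abs_def] by measurable
    have Y: "\<bar>u x * (flux x \<bullet> grad (?z n) x)\<bar> \<le> D * S x + 1/2 * (norm (G x) powr p * ?z n x)" for x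
    proof -
      let ?e = "cutoff n x"
      define a where "a = real (Suc m) * u x * (B / weight x)"
      define b where "b = norm (G x) powr (p - 1) * ?e ^ m"
      have a0: "a \<ge> 0" unfolding a_def using u0 B by (intro mult_nonneg_nonneg divide_nonneg_nonneg) auto
      have b0: "b \<ge> 0" unfolding b_def using cutoff_nonneg[of n x] by simp
      have "\<bar>u x * (flux x \<bullet> grad (?z n) x)\<bar> \<le> u x * (norm (flux x) * norm (grad (?z n) x))"
        using u0[of x] by (simp add: abs_mult mult_left_mono Cauchy_Schwarz_ineq2)
      also have "\<dots> = u x * (norm (G x) powr (p - 1) * (real (Suc m) * ?e ^ m * norm (grad (cutoff n) x)))"
        using cutoff_nonneg[of n x] unfolding grad_cutoff_power norm_flux norm_scaleR
        by (simp add: abs_mult del: of_nat_Suc)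
      also have "\<dots> \<le> u x * (norm (G x) powr (p - 1) * (real (Suc m) * ?e ^ m * (B / weight x)))"
        using u0[of x] B(2)[of n x] cutoff_nonneg[of n x]
        by (intro mult_left_mono mult_nonneg_nonneg) (auto simp del: of_nat_Suc)
      also have "\<dots> = a * b" by (simp add: a_def b_def mult_ac del: of_nat_Suc)
      also have "\<dots> \<le> D * a powr p + D powr (- 1 / (p - 1)) * b powr (p / (p - 1))"
        by (rule young_powr_scaled[OF p1 a0 b0 D(1)])
      also have "\<dots> \<le> D * S x + 1/2 * (norm (G x) powr p * ?z n x)"
      proof (intro add_mono mult_mono)
        have "a \<le> real (Suc m) * (K * weight x powr (- rate)) * (B / weight x)"
          unfolding a_def using K(2)[of x] B(1) by (intro mult_left_mono mult_right_mono) auto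
        also have "\<dots> = (real (Suc m) * B * K) * weight x powr (- (rate + 1))"
          by (simp add: powr_diff powr_minus field_simps del: of_nat_Suc)
        finally have "a powr p \<le> ((real (Suc m) * B * K) * weight x powr (- (rate + 1))) powr p"
          using a0 p1 by (intro powr_mono2) auto
        also have "\<dots> = S x" by (simp add: S_def powr_mult powr_powr del: of_nat_Suc)
        finally show "a powr p \<le> S x" .
        have e: "(?e ^ m) powr (p / (p - 1)) \<le> ?z n x"
        proof (cases "?e = 0")
          case True
          have "m \<noteq> 0" using m p1 by (cases m) auto
          with True show ?thesis by simp
        next
          case False
          then have e: "?e > 0" using cutoff_nonneg[of n x] by simp
          have "real (Suc m) \<le> real m * (p / (p - 1))"
          proof -
            have "real (Suc m) * (p - 1) \<le> real m * p" using m by (simp add: algebra_simps)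
            then show ?thesis using p1 by (simp add: pos_le_divide_eq del: of_nat_Suc)
          qed
          then have "?e powr (real m * (p / (p - 1))) \<le> ?e powr real (Suc m)"
            using e cutoff_le_1[of n x] by (intro powr_mono') auto
          then show ?thesis using e by (simp only: powr_realpow[symmetric] powr_powr)
        qed
        have "b powr (p / (p - 1)) = norm (G x) powr p * (?e ^ m) powr (p / (p - 1))"
          using p1 by (simp add: b_def powr_mult powr_powr)
        also have "\<dots> \<le> norm (G x) powr p * ?z n x" by (rule mult_left_mono[OF e]) simp
        finally show "b powr (p / (p - 1)) \<le> norm (G x) powr p * ?z n x" .
      qed (use D in auto)
      finally show ?thesis .
    qed
    have Xeq: "X x = norm (G x) powr p * ?z n x + u x * (flux x \<bullet> grad (?z n) x)" for x
      unfolding X_def inner_add_right inner_scaleR_right flux_inner_G by (simp only: mult.commute)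
    have iY: "integrable lborel (\<lambda>x. u x * (flux x \<bullet> grad (?z n) x))"
    proof (rule Bochner_Integration.integrable_bound)
      show "integrable lborel (\<lambda>x. D * S x + 1/2 * (norm (G x) powr p * ?z n x))"
        by (intro Bochner_Integration.integrable_add integrable_mult_right Si i)
      show "AE x in lborel. norm (u x * (flux x \<bullet> grad (?z n) x)) \<le> norm (D * S x + 1/2 * (norm (G x) powr p * ?z n x))"
        using Y by (intro AE_I2) (smt (verit) real_norm_def)
    qed measurable
    have iX: "integrable lborel X" unfolding Xeq[abs_def] by (intro Bochner_Integration.integrable_add i iY)
    have "(\<integral>x. 1/2 * (norm (G x) powr p * ?z n x) \<partial>lborel) \<le> (\<integral>x. X x + D * S x \<partial>lborel)"
    proof (rule integral_mono)
      show "1/2 * (norm (G x) powr p * ?z n x) \<le> X x + D * S x" for x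
        using Y[of x] unfolding Xeq by linarith
      show "integrable lborel (\<lambda>x. X x + D * S x)"
        by (intro Bochner_Integration.integrable_add integrable_mult_right Si iX)
      show "integrable lborel (\<lambda>x. 1/2 * (norm (G x) powr p * ?z n x))" by (intro integrable_mult_right i)
    qed
    also have "\<dots> = (\<integral>x. X x \<partial>lborel) + D * (\<integral>x. S x \<partial>lborel)" using iX Si by simp
    finally have h: "1/2 * (\<integral>x. norm (G x) powr p * ?z n x \<partial>lborel) \<le> (\<integral>x. X x \<partial>lborel) + D * (\<integral>x. S x \<partial>lborel)"
      by (simp only: integral_mult_right_zero)
    have "(\<integral>x. X x \<partial>lborel) = (\<integral>x. rhs x * (u x * ?z n x) \<partial>lborel)"
      unfolding X_def by (rule test_cutoff[OF uG Gloc z])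
    also have "\<dots> \<le> (\<integral>x. rhs x * u x \<partial>lborel)"
    proof (rule integral_mono[OF rhs_mult_integrable fu])
      have uz: "u x * ?z n x \<le> u x" for x using z01[of n x] u0[of x] by (simp add: mult_left_le del: power_Suc)
      show "rhs x * (u x * ?z n x) \<le> rhs x * u x" for x by (intro mult_left_mono uz rhs_nonneg)
      show "u x * ?z n x \<le> K * weight x powr (- rate)" for x using uz[of x] K(2)[of x] by linarith
      show "0 \<le> u x * ?z n x" for x by (intro mult_nonneg_nonneg u0 z01)
    qed measurable
    finally have h': "(\<integral>x. X x \<partial>lborel) \<le> (\<integral>x. rhs x * u x \<partial>lborel)" .
    have "J \<le> 2 * (a + b)" if "1/2 * J \<le> x + b" "x \<le> a" for J a b x :: real using that by simp
    from this[OF h h'] have "(\<integral>x. norm (G x) powr p * ?z n x \<partial>lborel) \<le> M"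
      unfolding M_def .
    with i show ?thesis by blast
  qed
  have lim: "(\<lambda>n. ennreal (norm (G x) powr p * ?z n x)) \<longlonglongrightarrow> ennreal (norm (G x) powr p)" for x
  proof (rule tendsto_ennrealI)
    have "(\<lambda>n. norm (G x) powr p * ?z n x) \<longlonglongrightarrow> norm (G x) powr p * 1 ^ Suc m"
      by (intro tendsto_mult tendsto_const tendsto_power cutoff_tendsto)
    then show "(\<lambda>n. norm (G x) powr p * ?z n x) \<longlonglongrightarrow> norm (G x) powr p" by (simp only: power_one mult_1_right)
  qed
  have "(\<integral>\<^sup>+x. ennreal (norm (G x) powr p) \<partial>lborel) = (\<integral>\<^sup>+x. liminf (\<lambda>n. ennreal (norm (G x) powr p * ?z n x)) \<partial>lborel)"
    by (intro nn_integral_cong lim_imp_Liminf[symmetric] lim) simp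
  also have "\<dots> \<le> liminf (\<lambda>n. \<integral>\<^sup>+x. ennreal (norm (G x) powr p * ?z n x) \<partial>lborel)"
    by (rule nn_integral_liminf) measurable
  also have "\<dots> \<le> liminf (\<lambda>n. ennreal M)"
  proof (rule Liminf_mono, rule always_eventually, rule allI)
    fix n
    have "(\<integral>\<^sup>+x. ennreal (norm (G x) powr p * ?z n x) \<partial>lborel) = ennreal (\<integral>x. norm (G x) powr p * ?z n x \<partial>lborel)"
      using bnd[of n] z01 by (intro nn_integral_eq_integral) (auto simp del: power_Suc)
    also have "\<dots> \<le> ennreal M" using bnd[of n] by (intro ennreal_leI) blast
    finally show "(\<integral>\<^sup>+x. ennreal (norm (G x) powr p * ?z n x) \<partial>lborel) \<le> ennreal M" .
  qed
  also have "\<dots> < \<infinity>" by (simp add: Liminf_const)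
  finally have "(\<integral>\<^sup>+x. ennreal (norm (G x) powr p) \<partial>lborel) < \<infinity>" .
  then show ?thesis by (intro integrableI_nonneg) auto
qed

text \<open>This controls the terms in which the gradient falls on a cutoff, uniformly in the cutoff radius.\<close>

lemma decaying_powr_weight:
  assumes v: "0 \<le> v" "v \<le> L * weight x powr (- rate)" and B: "B \<ge> 0"
  shows "(v * (B / weight x)) powr p \<le> (L * B) powr p * weight x powr (- (rate + 1) * p)"
proof -
  have "v * (B / weight x) \<le> (L * weight x powr (- rate)) * (B / weight x)"
    using v B by (intro mult_right_mono) auto
  also have "\<dots> = (L * B) * weight x powr (- (rate + 1))"
    by (simp add: powr_diff powr_minus field_simps)
  finally have "(v * (B / weight x)) powr p \<le> ((L * B) * weight x powr (- (rate + 1))) powr p"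
    using v B p1 by (intro powr_mono2) auto
  then show ?thesis by (simp add: powr_mult powr_powr)
qed

end

context henon_solution
begin

lemma flux_Lp: "integrable lborel (\<lambda>x. norm (flux x) powr (p / (p - 1)))"
  unfolding flux_powr by (rule G_Lp)

lemma set_integrable_cball:
  fixes h :: "'a \<Rightarrow> real"
  assumes "integrable lborel h" shows "set_integrable lborel (cball 0 R) h"
  unfolding set_integrable_def by (rule integrable_mult_indicator[OF _ assms]) simp

text \<open>Multiply \<open>v\<close> by cutoffs and let their radius tend to infinity, with dominated convergence on both
  sides of the equation.\<close>

lemma test_decaying:
  assumes vV: "weak_pair v V" and Vp: "integrable lborel (\<lambda>x. norm (V x) powr p)"
    and v: "\<And>x. 0 \<le> v x" "\<And>x. v x \<le> L * weight x powr (- rate)"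
  shows "integrable lborel (\<lambda>x. flux x \<bullet> V x)"
    and "(\<integral>x. flux x \<bullet> V x \<partial>lborel) = (\<integral>x. rhs x * v x \<partial>lborel)"
proof -
  have [measurable]: "V \<in> borel_measurable borel" and vc: "continuous_on UNIV v" using vV by (auto simp: weak_pair_def)
  have [measurable]: "v \<in> borel_measurable borel" by (rule continuous_UNIV_borel[OF vc])
  show "integrable lborel (\<lambda>x. flux x \<bullet> V x)"
    by (rule pairing_integrable[OF p1 _ _ Vp flux_Lp]) measurable
  obtain B where B: "B > 0" "\<And>n x::'a. norm (grad (cutoff n) x) \<le> B / weight x"
    using grad_cutoff_bound[where 'a='a] by blast
  have [measurable]: "(\<lambda>x. cutoff n (x::'a)) \<in> borel_measurable borel" "grad (cutoff n) \<in> borel_measurable (borel :: 'a measure)" for n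
    using test_function_cont[OF test_function_cutoff] continuous_grad_test[OF test_function_cutoff]
    by (auto intro!: continuous_UNIV_borel)
  let ?X = "\<lambda>n x. flux x \<bullet> (cutoff n x *\<^sub>R V x + v x *\<^sub>R grad (cutoff n) x)"
  let ?h = "\<lambda>x. (norm (V x) powr p + norm (G x) powr p) + ((L * B) powr p * weight x powr (- (rate + 1) * p) + norm (G x) powr p)"
  have "(\<lambda>n. \<integral>x. ?X n x \<partial>lborel) \<longlonglongrightarrow> (\<integral>x. flux x \<bullet> V x \<partial>lborel)"
  proof (rule integral_dominated_convergence[where w="?h"])
    show "integrable lborel ?h" using Vp G_Lp weight_p_integrable by auto
    show "AE x in lborel. (\<lambda>n. ?X n x) \<longlonglongrightarrow> flux x \<bullet> V x"
    proof (rule AE_I2)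
      fix x
      have "(\<lambda>n. ?X n x) \<longlonglongrightarrow> flux x \<bullet> (1 *\<^sub>R V x + v x *\<^sub>R 0)"
        by (intro tendsto_inner tendsto_add tendsto_scaleR tendsto_const cutoff_tendsto grad_cutoff_tendsto)
      then show "(\<lambda>n. ?X n x) \<longlonglongrightarrow> flux x \<bullet> V x" by simp
    qed
    show "AE x in lborel. norm (?X n x) \<le> ?h x" for n
    proof (rule AE_I2)
      fix x
      have 1: "\<bar>flux x \<bullet> (cutoff n x *\<^sub>R V x)\<bar> \<le> norm (V x) powr p + norm (G x) powr p"
      proof -
        have "\<bar>flux x \<bullet> (cutoff n x *\<^sub>R V x)\<bar> \<le> norm (flux x) * norm (cutoff n x *\<^sub>R V x)"
          by (rule Cauchy_Schwarz_ineq2)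
        also have "\<dots> \<le> norm (flux x) * norm (V x)"
          using cutoff_nonneg[of n x] cutoff_le_1[of n x] by (intro mult_left_mono) (auto intro: mult_left_le_one_le)
        also have "\<dots> \<le> norm (V x) powr p + norm (flux x) powr (p / (p - 1))"
          using young_powr[OF p1, of "norm (V x)" "norm (flux x)"] by (simp add: mult.commute)
        finally show ?thesis by (simp add: flux_powr)
      qed
      have 2: "\<bar>flux x \<bullet> (v x *\<^sub>R grad (cutoff n) x)\<bar>
          \<le> (L * B) powr p * weight x powr (- (rate + 1) * p) + norm (G x) powr p"
      proof -
        have "\<bar>flux x \<bullet> (v x *\<^sub>R grad (cutoff n) x)\<bar> \<le> norm (flux x) * norm (v x *\<^sub>R grad (cutoff n) x)"
          by (rule Cauchy_Schwarz_ineq2)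
        also have "\<dots> \<le> norm (flux x) * (v x * (B / weight x))"
          using v(1)[of x] B(2)[of n x] by (intro mult_left_mono) (auto intro: mult_left_mono simp del: times_divide_eq_right)
        also have "\<dots> \<le> (v x * (B / weight x)) powr p + norm (flux x) powr (p / (p - 1))"
          using young_powr[OF p1, of "v x * (B / weight x)" "norm (flux x)"] v(1)[of x] B(1) by (simp add: mult.commute)
        also have "(v x * (B / weight x)) powr p \<le> (L * B) powr p * weight x powr (- (rate + 1) * p)"
          by (rule decaying_powr_weight) (use v B in auto)
        finally show ?thesis by (simp add: flux_powr)
      qed
      show "norm (?X n x) \<le> ?h x"
        unfolding inner_add_right real_norm_def using 1 2 by linarith
    qed
  qed measurable
  moreover have "(\<integral>x. ?X n x \<partial>lborel) = (\<integral>x. rhs x * (v x * cutoff n x) \<partial>lborel)" for n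
    by (rule test_cutoff[OF vV set_integrable_cball[OF Vp] test_function_cutoff])
  moreover have "(\<lambda>n. \<integral>x. rhs x * (v x * cutoff n x) \<partial>lborel) \<longlonglongrightarrow> (\<integral>x. rhs x * v x \<partial>lborel)"
  proof (rule integral_dominated_convergence[OF _ _ rhs_mult_integrable[OF _ v]])
    show "AE x in lborel. (\<lambda>n. rhs x * (v x * cutoff n x)) \<longlonglongrightarrow> rhs x * v x"
    proof (rule AE_I2)
      fix x
      have "(\<lambda>n. rhs x * (v x * cutoff n x)) \<longlonglongrightarrow> rhs x * (v x * 1)"
        by (intro tendsto_mult tendsto_const cutoff_tendsto)
      then show "(\<lambda>n. rhs x * (v x * cutoff n x)) \<longlonglongrightarrow> rhs x * v x" by simp
    qed
    show "AE x in lborel. norm (rhs x * (v x * cutoff n x)) \<le> rhs x * v x" for n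
    proof (rule AE_I2)
      fix x
      have "norm (rhs x * (v x * cutoff n x)) = rhs x * (v x * cutoff n x)"
        using rhs_nonneg[of x] v(1)[of x] cutoff_nonneg[of n x] by simp
      also have "\<dots> \<le> rhs x * (v x * 1)"
        using rhs_nonneg[of x] v(1)[of x] cutoff_le_1[of n x] by (intro mult_left_mono) auto
      finally show "norm (rhs x * (v x * cutoff n x)) \<le> rhs x * v x" by simp
    qed
  qed measurable
  ultimately show "(\<integral>x. flux x \<bullet> V x \<partial>lborel) = (\<integral>x. rhs x * v x \<partial>lborel)"
    using LIMSEQ_unique by (simp only:)
qed

definition energy :: real where "energy = (\<integral>x. norm (G x) powr p \<partial>lborel)"

lemma energy_nonneg: "energy \<ge> 0"
  unfolding energy_def by (intro Bochner_Integration.integral_nonneg) auto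

lemma energy_eq: "(\<integral>x. rhs x * u x \<partial>lborel) = energy"
  using test_decaying(2)[OF uG G_Lp u0 K(2)] by (simp add: flux_inner_G energy_def)

section \<open>Comparison with dilations\<close>

text \<open>The estimate for compactly supported functions, applied to \<open>u\<close> times a cutoff. The gradients of these
  products are bounded in \<open>L\<^sup>p\<close> independently of the cutoff, and Fatou's lemma removes it.\<close>

lemma dilation_difference_bound:
  obtains M where "M \<ge> 0" "\<And>l. 1/2 \<le> l \<Longrightarrow> l < 1 \<Longrightarrow>
    (\<integral>\<^sup>+x. ennreal (\<bar>u (l *\<^sub>R x) - u x\<bar> powr p * norm x powr (-p)) \<partial>lborel) \<le> ennreal ((1 - l) powr p * M)"
proof -
  obtain B where B: "B > 0" "\<And>n x::'a. norm (grad (cutoff n) x) \<le> B / weight x"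
    using grad_cutoff_bound[where 'a='a] by blast
  let ?h = "\<lambda>x. 2 powr p * (norm (G x) powr p + (K * B) powr p * weight x powr (- (rate + 1) * p))"
  have hi: "integrable lborel ?h" using G_Lp weight_p_integrable by auto
  define M where "M = 2 ^ DIM('a) * (\<integral>x. ?h x \<partial>lborel)"
  have "(\<integral>x. ?h x \<partial>lborel) \<ge> 0" by (intro Bochner_Integration.integral_nonneg) auto
  then have M0: "M \<ge> 0" by (simp add: M_def)
  have "(\<integral>\<^sup>+x. ennreal (\<bar>u (l *\<^sub>R x) - u x\<bar> powr p * norm x powr (-p)) \<partial>lborel) \<le> ennreal ((1 - l) powr p * M)"
    if l: "1/2 \<le> l" "l < 1" for l
  proof -
    let ?f = "\<lambda>v x. ennreal (\<bar>v (l *\<^sub>R x) - v x\<bar> powr p * norm x powr (-p))"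
    let ?w = "\<lambda>n x. u x * cutoff n x"
    have [measurable]: "(\<lambda>x. cutoff n (x::'a)) \<in> borel_measurable borel" for n
      by (rule continuous_UNIV_borel[OF test_function_cont[OF test_function_cutoff]])
    have bound: "(\<integral>\<^sup>+x. ?f (?w n) x \<partial>lborel) \<le> ennreal ((1 - l) powr p * M)" for n
    proof -
      let ?W = "\<lambda>x. cutoff n x *\<^sub>R G x + u x *\<^sub>R grad (cutoff n) x"
      obtain R where R: "weak_pair (?w n) ?W" "\<And>x. norm x > R \<Longrightarrow> ?w n x = 0"
        "integrable lborel ?W" "integrable lborel (\<lambda>x. norm (?W x) powr p)"
        using cutoff_product[OF uG Gloc test_function_cutoff p1] by blast
      have "(\<integral>x. norm (?W x) powr p \<partial>lborel) \<le> (\<integral>x. ?h x \<partial>lborel)"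
      proof (rule integral_mono[OF R(4) hi])
        fix x
        have "norm (?W x) powr p \<le> 2 powr p * (norm (cutoff n x *\<^sub>R G x) powr p + norm (u x *\<^sub>R grad (cutoff n) x) powr p)"
          using p1 by (intro norm_add_powr_le) auto
        also have "\<dots> \<le> ?h x"
        proof (intro mult_left_mono add_mono)
          show "norm (cutoff n x *\<^sub>R G x) powr p \<le> norm (G x) powr p"
            using cutoff_nonneg[of n x] cutoff_le_1[of n x] p1
            by (intro powr_mono2) (auto intro: mult_left_le_one_le)
          have "norm (u x *\<^sub>R grad (cutoff n) x) powr p \<le> (u x * (B / weight x)) powr p"
            using u0[of x] B(2)[of n x] p1 by (intro powr_mono2) (auto intro: mult_left_mono simp del: times_divide_eq_right)
          also have "\<dots> \<le> (K * B) powr p * weight x powr (- (rate + 1) * p)"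
            by (rule decaying_powr_weight) (use u0 K B in auto)
          finally show "norm (u x *\<^sub>R grad (cutoff n) x) powr p \<le> (K * B) powr p * weight x powr (- (rate + 1) * p)" .
        qed auto
        finally show "norm (?W x) powr p \<le> ?h x" .
      qed
      then have "(1 - l) powr p * 2 ^ DIM('a) * (\<integral>x. norm (?W x) powr p \<partial>lborel) \<le> (1 - l) powr p * M"
        unfolding M_def mult.assoc by (intro mult_left_mono) auto
      then show ?thesis using dilation_difference[OF R p1 l]
        by (meson ennreal_leI order_trans)
    qed
    have "(\<lambda>n. ?f (?w n) x) \<longlonglongrightarrow> ?f u x" for x
    proof -
      have "(\<lambda>n. ?f (?w n) x) \<longlonglongrightarrow> ennreal (\<bar>u (l *\<^sub>R x) * 1 - u x * 1\<bar> powr p * norm x powr (-p))"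
        using p1 by (intro tendsto_ennrealI tendsto_mult tendsto_powr' tendsto_rabs tendsto_diff
            cutoff_tendsto tendsto_const) auto
      then show ?thesis by simp
    qed
    then have lim: "liminf (\<lambda>n. ?f (?w n) x) = ?f u x" for x
      by (intro lim_imp_Liminf) auto
    have "(\<integral>\<^sup>+x. ?f u x \<partial>lborel) = (\<integral>\<^sup>+x. liminf (\<lambda>n. ?f (?w n) x) \<partial>lborel)" unfolding lim by rule
    also have "\<dots> \<le> liminf (\<lambda>n. \<integral>\<^sup>+x. ?f (?w n) x \<partial>lborel)"
      by (rule nn_integral_liminf) measurable
    also have "\<dots> \<le> liminf (\<lambda>n. ennreal ((1 - l) powr p * M))"
      by (rule Liminf_mono, rule always_eventually, rule allI, rule bound)
    finally show ?thesis by (simp add: Liminf_const)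
  qed
  with M0 that show thesis by blast
qed

lemma u_dilate_bound:
  assumes l: "1/2 \<le> l"
  shows "u (l *\<^sub>R x) \<le> (K * 2 powr rate) * weight x powr (- rate)"
proof -
  have le: "weight x / 2 \<le> weight (l *\<^sub>R x)"
    using l mult_right_mono[of "1/2" l "norm x"] by (auto simp: max_def)
  have "u (l *\<^sub>R x) \<le> K * weight (l *\<^sub>R x) powr (- rate)" by (rule K)
  also have "weight (l *\<^sub>R x) powr (- rate) \<le> (weight x / 2) powr (- rate)"
    using le rate_pos by (intro powr_mono2') auto
  also have "(weight x / 2) powr (- rate) = 2 powr rate * weight x powr (- rate)"
    by (simp add: powr_divide powr_minus field_simps)
  finally show ?thesis using K(1) by (simp add: mult_left_mono)
qed

lemma u_le_dilate_bound: "u x \<le> (K * 2 powr rate) * weight x powr (- rate)"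
  using u_dilate_bound[of 1 x] by simp

text \<open>Since \<open>u\<close> minimises the convex functional \<open>v \<mapsto> (1/p) \<integral>|\<nabla>v|\<^sup>p - \<integral> rhs v\<close>, comparing it with its
  dilation bounds \<open>\<integral> rhs u(l \<cdot>)\<close> from above.\<close>

lemma dilation_upper:
  assumes l: "1/2 \<le> l" "l < 1"
  shows "(\<integral>x. rhs x * u (l *\<^sub>R x) \<partial>lborel) \<le> (1 - 1/p) * energy + l powr (p - DIM('a)) * energy / p"
proof -
  have l0: "l > 0" using l by simp
  let ?V = "\<lambda>x. l *\<^sub>R G (l *\<^sub>R x)"
  have wp: "weak_pair (\<lambda>x. u (l *\<^sub>R x)) ?V" by (rule weak_pair_dilate[OF uG l0])
  have iG: "integrable lborel (\<lambda>x. norm (G (l *\<^sub>R x)) powr p)"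
    using integrable_affine[OF G_Lp, of l 0] l0 by simp
  have Veq: "norm (?V x) powr p = l powr p * norm (G (l *\<^sub>R x)) powr p" for x
    using l0 by (simp add: powr_mult)
  have Vp: "integrable lborel (\<lambda>x. norm (?V x) powr p)" unfolding Veq using iG by simp
  have "energy = l ^ DIM('a) * (\<integral>x. norm (G (l *\<^sub>R x)) powr p \<partial>lborel)"
    unfolding energy_def using l0 by (subst integral_affine[where c=l and t=0]) auto
  then have "(\<integral>x. norm (G (l *\<^sub>R x)) powr p \<partial>lborel) = l powr (- DIM('a)) * energy"
    using l0 by (simp add: powr_minus powr_realpow field_simps)
  then have "(\<integral>x. norm (?V x) powr p \<partial>lborel) = l powr p * (l powr (- DIM('a)) * energy)"
    unfolding Veq by simp
  also have "\<dots> = l powr (p - DIM('a)) * energy"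
    using l0 by (simp add: powr_diff powr_minus field_simps)
  finally have VE: "(\<integral>x. norm (?V x) powr p \<partial>lborel) = l powr (p - DIM('a)) * energy" .
  note t = test_decaying[OF wp Vp u0 u_dilate_bound[OF l(1)]]
  have "(\<integral>x. rhs x * u (l *\<^sub>R x) \<partial>lborel) = (\<integral>x. flux x \<bullet> ?V x \<partial>lborel)" by (rule t(2)[symmetric])
  also have "\<dots> \<le> (\<integral>x. (1 - 1/p) * norm (G x) powr p + (1/p) * norm (?V x) powr p \<partial>lborel)"
  proof (rule integral_mono[OF t(1)])
    show "integrable lborel (\<lambda>x. (1 - 1/p) * norm (G x) powr p + (1/p) * norm (?V x) powr p)"
      using G_Lp Vp by (intro Bochner_Integration.integrable_add integrable_mult_right)
    fix x
    have "flux x \<bullet> ?V x \<le> norm (flux x) * norm (?V x)" by (rule norm_cauchy_schwarz)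
    also have "\<dots> \<le> norm (flux x) powr (p / (p - 1)) / (p / (p - 1)) + norm (?V x) powr p / p"
      using p1 by (intro Youngs_inequality) (auto simp: field_simps)
    also have "norm (flux x) powr (p / (p - 1)) / (p / (p - 1)) = (1 - 1/p) * norm (G x) powr p"
      using p1 unfolding flux_powr by (simp add: field_simps)
    finally show "flux x \<bullet> ?V x \<le> (1 - 1/p) * norm (G x) powr p + (1/p) * norm (?V x) powr p" by simp
  qed
  also have "\<dots> = (1 - 1/p) * energy + (1/p) * (l powr (p - DIM('a)) * energy)"
    using G_Lp Vp VE
    by (subst Bochner_Integration.integral_add) (auto simp: energy_def)
  finally show ?thesis by simp
qed

text \<open>The factor \<open>u(lx)\<^sup>q - u(x)\<^sup>q\<close> of the error term in \<open>dilation_lower\<close> below, weighted and raised to the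
  dual exponent as Young's inequality against \<open>|u(lx) - u(x)|\<^sup>p |x|\<^sup>-\<^sup>p\<close> requires.\<close>

definition power_gap :: "real \<Rightarrow> 'a \<Rightarrow> real" where
  "power_gap l x = (norm x powr (\<alpha> + 1) * \<bar>u (l *\<^sub>R x) powr q - u x powr q\<bar>) powr (p / (p - 1))"

lemma power_gap_measurable [measurable]: "power_gap l \<in> borel_measurable borel"
  unfolding power_gap_def[abs_def] by measurable

text \<open>At the origin, integrability of the bound amounts to \<open>(\<alpha> + 1) p/(p - 1) > - N\<close>, which follows from
  \<open>\<alpha> > - p\<close>; at infinity, the exponents add up to \<open>- p (1 + rate)\<close>.\<close>

lemma power_gap_dominated:
  obtains h :: "'a \<Rightarrow> real" where "integrable lborel h" "\<And>l x. 1/2 \<le> l \<Longrightarrow> norm (power_gap l x) \<le> h x"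
proof -
  let ?L = "K * 2 powr rate" and ?s = "p / (p - 1)"
  define h where "h x = (?L powr q) powr ?s * (norm x powr ((\<alpha> + 1) * ?s) * weight x powr (- rate * q * ?s))" for x :: 'a
  have s: "?s > 0" using p1 by simp
  have "integrable lborel (\<lambda>x::'a. norm x powr ((\<alpha> + 1) * ?s) * weight x powr (- rate * q * ?s))"
  proof (rule integrable_norm_weight)
    have ps: "(p - 1) * ?s = p" using p1 by simp
    have "(- (p - 1)) * ?s < (\<alpha> + 1) * ?s"
      using p_alpha_pos s by (intro mult_strict_right_mono) auto
    then show "- real DIM('a) < (\<alpha> + 1) * ?s"
      unfolding mult_minus_left ps using pN by linarith
    have gap: "\<alpha> + 1 - rate * q = - ((p - 1) * (1 + rate))" using rate_mult by (simp add: algebra_simps)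
    have "a * t + - b * q * t = (a - b * q) * t" "- (a * b) * t = - ((a * t) * b)" for a b t :: real
      by (simp_all add: algebra_simps)
    then have "(\<alpha> + 1) * ?s + - rate * q * ?s = - (p * (1 + rate))"
      by (simp only: gap ps)
    then show "(\<alpha> + 1) * ?s + - rate * q * ?s < - real DIM('a)"
      using rate_p by (simp only:) (simp add: algebra_simps)
  qed
  then have "integrable lborel h" unfolding h_def[abs_def] by simp
  moreover have "norm (power_gap l x) \<le> h x" if l: "1/2 \<le> l" for l x
  proof -
    have q0: "q > 0" using p1 q1 by simp
    have b: "v powr q \<le> ?L powr q * weight x powr (- rate * q)" if "0 \<le> v" "v \<le> ?L * weight x powr (- rate)" for v
    proof -
      have "v powr q \<le> (?L * weight x powr (- rate)) powr q" using that q0 by (intro powr_mono2) auto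
      also have "\<dots> = ?L powr q * (weight x powr (- rate)) powr q" by (rule powr_mult)
      also have "(weight x powr (- rate)) powr q = weight x powr (- rate * q)" by (rule powr_powr)
      finally show ?thesis .
    qed
    have "\<bar>u (l *\<^sub>R x) powr q - u x powr q\<bar> \<le> ?L powr q * weight x powr (- rate * q)"
      using b[OF u0 u_dilate_bound[OF l]] b[OF u0 u_le_dilate_bound] powr_ge_zero[of "u x" q] powr_ge_zero[of "u (l *\<^sub>R x)" q]
      by linarith
    then have "power_gap l x \<le> (norm x powr (\<alpha> + 1) * (?L powr q * weight x powr (- rate * q))) powr ?s"
      unfolding power_gap_def using s by (intro powr_mono2 mult_left_mono) auto
    also have "\<dots> = (norm x powr (\<alpha> + 1)) powr ?s * ((?L powr q) powr ?s * (weight x powr (- rate * q)) powr ?s)"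
      by (simp only: powr_mult)
    also have "\<dots> = h x" unfolding h_def by (simp only: powr_powr mult_ac)
    finally show ?thesis by (simp add: power_gap_def)
  qed
  ultimately show thesis using that by blast
qed

lemma power_gap_integral_tendsto:
  assumes l: "\<And>n. 1/2 \<le> l n" "l \<longlonglongrightarrow> 1"
  shows "(\<lambda>n. \<integral>x. power_gap (l n) x \<partial>lborel) \<longlonglongrightarrow> 0"
proof -
  obtain h where h: "integrable lborel h" "\<And>l x. 1/2 \<le> l \<Longrightarrow> norm (power_gap l x) \<le> h x"
    using power_gap_dominated by blast
  have "(\<lambda>n. \<integral>x. power_gap (l n) x \<partial>lborel) \<longlonglongrightarrow> (\<integral>x. 0 \<partial>(lborel :: 'a measure))"
  proof (rule integral_dominated_convergence[OF _ _ h(1)])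
    show "AE x in lborel. (\<lambda>n. power_gap (l n) x) \<longlonglongrightarrow> 0"
    proof (rule AE_I2)
      fix x
      have "isCont u x" using u_cont by (simp add: continuous_on_eq_continuous_at)
      moreover have "(\<lambda>n. l n *\<^sub>R x) \<longlonglongrightarrow> 1 *\<^sub>R x" by (intro tendsto_scaleR l tendsto_const)
      ultimately have "(\<lambda>n. u (l n *\<^sub>R x)) \<longlonglongrightarrow> u x"
        unfolding scaleR_one by (rule isCont_tendsto_compose)
      then have "(\<lambda>n. power_gap (l n) x) \<longlonglongrightarrow> (norm x powr (\<alpha> + 1) * \<bar>u x powr q - u x powr q\<bar>) powr (p / (p - 1))"
        unfolding power_gap_def using u0 p1 q1
        by (intro tendsto_powr' tendsto_mult tendsto_const tendsto_rabs tendsto_diff) (auto intro: always_eventually)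
      then show "(\<lambda>n. power_gap (l n) x) \<longlonglongrightarrow> 0" by simp
    qed
    show "AE x in lborel. norm (power_gap (l n) x) \<le> h x" for n by (rule AE_I2, rule h(2)[OF l(1)])
  qed measurable
  then show ?thesis by simp
qed

text \<open>Convexity of \<open>t\<^sup>q\<^sup>+\<^sup>1\<close> and the exact scaling of \<open>\<integral>|x|\<^sup>\<alpha> u\<^sup>q\<^sup>+\<^sup>1\<close> bound the same integral from below, up to
  the second order error \<open>\<integral>|x|\<^sup>\<alpha> (u(lx)\<^sup>q - u\<^sup>q) (u(lx) - u)\<close>. One factor of the error is \<open>1 - l\<close> times a
  function bounded in \<open>L\<^sup>p\<close>, the other one tends to zero.\<close>

lemma dilation_lower:
  assumes l: "1/2 \<le> l" "l < 1" and d: "d > 0" and M0: "M \<ge> 0"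
    and M: "(\<integral>\<^sup>+x. ennreal (\<bar>u (l *\<^sub>R x) - u x\<bar> powr p * norm x powr (-p)) \<partial>lborel) \<le> ennreal ((1 - l) powr p * M)"
  shows "(l powr (- (DIM('a) + \<alpha>)) - 1) * energy / (q + 1)
    \<le> (\<integral>x. rhs x * u (l *\<^sub>R x) \<partial>lborel) - energy
      + (1 - l) * (d * M + d powr (- 1 / (p - 1)) * (\<integral>x. power_gap l x \<partial>lborel))"
proof -
  have l0: "l > 0" using l by simp
  have q0: "q > 0" using p1 q1 by simp
  let ?u = "\<lambda>x. u (l *\<^sub>R x)"
  have uc: "continuous_on UNIV ?u" by (rule continuous_on_compose2[OF u_cont]) (auto intro!: continuous_intros)
  have [measurable]: "?u \<in> borel_measurable borel" by (rule continuous_UNIV_borel[OF uc])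
  define c where "c = d powr (- 1 / (p - 1))"
  define D where "D x = \<bar>?u x - u x\<bar> powr p * norm x powr (-p)" for x
  have D0: "D x \<ge> 0" for x by (simp add: D_def)
  have [measurable]: "D \<in> borel_measurable borel" unfolding D_def[abs_def] by measurable
  have Di: "integrable lborel D"
    by (rule integrableI_nonneg) (use M D0 in \<open>auto simp: D_def intro: le_less_trans\<close>)
  have DM: "(\<integral>x. D x \<partial>lborel) \<le> (1 - l) powr p * M"
    by (rule integral_real_bounded) (use M M0 in \<open>auto simp: D_def\<close>)
  have Ti: "integrable lborel (power_gap l)"
  proof -
    obtain h where h: "integrable lborel h" "\<And>l x. 1/2 \<le> l \<Longrightarrow> norm (power_gap l x) \<le> h x"
      using power_gap_dominated by blast
    show ?thesis
    proof (rule Bochner_Integration.integrable_bound[OF h(1)])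
      show "AE x in lborel. norm (power_gap l x) \<le> norm (h x)"
        using h(2)[OF l(1)] by (intro AE_I2) (metis abs_ge_self order_trans real_norm_def)
    qed measurable
  qed
  have iu: "integrable lborel (\<lambda>x. rhs x * u x)" by (rule rhs_mult_integrable[OF u_meas u0 K(2)])
  have iul: "integrable lborel (\<lambda>x. rhs x * ?u x)"
    by (rule rhs_mult_integrable[OF _ u0 u_dilate_bound[OF l(1)]]) measurable
  have powr_Suc: "t powr q * t = t powr (q + 1)" if "t \<ge> 0" for t
    using that by (cases "t = 0") (auto simp: powr_add)
  define F where "F x = norm x powr \<alpha> * ?u x powr (q + 1)" for x
  have Feq: "F x = l powr (- \<alpha>) * (rhs (l *\<^sub>R x) * u (l *\<^sub>R x))" for x
    using l0 powr_Suc[OF u0, of "l *\<^sub>R x"]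
    by (simp add: F_def rhs_def powr_mult powr_minus mult.assoc)
  have iF': "integrable lborel (\<lambda>x. rhs (l *\<^sub>R x) * u (l *\<^sub>R x))"
    using integrable_affine[OF iu, of l 0] l0 by simp
  have iF: "integrable lborel F" unfolding Feq[abs_def] using iF' by simp
  have intF: "(\<integral>x. F x \<partial>lborel) = l powr (- (DIM('a) + \<alpha>)) * energy"
  proof -
    have "energy = l ^ DIM('a) * (\<integral>x. rhs (l *\<^sub>R x) * u (l *\<^sub>R x) \<partial>lborel)"
      unfolding energy_eq[symmetric] using l0 by (subst integral_affine[where c=l and t=0]) auto
    then have "(\<integral>x. rhs (l *\<^sub>R x) * u (l *\<^sub>R x) \<partial>lborel) = l powr (- DIM('a)) * energy"
      using l0 by (simp add: powr_minus powr_realpow field_simps)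
    then have "(\<integral>x. F x \<partial>lborel) = l powr (- \<alpha>) * (l powr (- DIM('a)) * energy)"
      unfolding Feq by simp
    also have "\<dots> = l powr (- (DIM('a) + \<alpha>)) * energy"
      using l0 by (simp add: powr_diff powr_minus powr_add field_simps)
    finally show ?thesis .
  qed
  have pw: "(F x - rhs x * u x) / (q + 1)
      \<le> rhs x * ?u x - rhs x * u x + ((1 - l) * (d / (1 - l) powr p) * D x + (1 - l) * c * power_gap l x)" for x
  proof (cases "x = 0")
    case True
    then show ?thesis using D0[of x] l d by (simp add: F_def rhs_def power_gap_def c_def D_def)
  next
    case False
    let ?g = "norm x powr \<alpha>"
    \<comment> \<open>the powers of \<open>|x|\<close> and \<open>1 - l\<close> are distributed so that the first factor is bounded in \<open>L\<^sup>p\<close>\<close>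
    have err: "\<bar>?u x powr q - u x powr q\<bar> * \<bar>?u x - u x\<bar> * ?g
        \<le> (1 - l) * (d / (1 - l) powr p) * D x + (1 - l) * c * power_gap l x"
    proof -
      let ?a = "\<bar>?u x - u x\<bar> / norm x / (1 - l)" and ?b = "norm x powr (\<alpha> + 1) * \<bar>?u x powr q - u x powr q\<bar>"
      have "?a * ?b \<le> d * ?a powr p + d powr (- 1 / (p - 1)) * ?b powr (p / (p - 1))"
        using l by (intro young_powr_scaled[OF p1 _ _ d]) auto
      also have "?a powr p = D x / (1 - l) powr p"
        unfolding powr_divide by (simp add: D_def powr_minus_divide)
      finally have "(1 - l) * (?a * ?b) \<le> (1 - l) * (d * (D x / (1 - l) powr p) + c * power_gap l x)"
        using l by (intro mult_left_mono) (auto simp: c_def power_gap_def)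
      moreover have "(1 - l) * (?a * ?b) = \<bar>?u x powr q - u x powr q\<bar> * \<bar>?u x - u x\<bar> * ?g"
        using l False by (simp add: powr_add)
      ultimately show ?thesis by (simp add: algebra_simps)
    qed
    have "?u x powr (q + 1) + (q + 1) * ?u x powr (q + 1 - 1) * (u x - ?u x) \<le> u x powr (q + 1)"
      using q0 u0 by (intro powr_tangent) auto
    then have "?u x powr (q + 1) - u x powr (q + 1) \<le> (q + 1) * (?u x powr q * (?u x - u x))"
      by (simp add: algebra_simps)
    then have "(?u x powr (q + 1) - u x powr (q + 1)) / (q + 1) \<le> ?u x powr q * (?u x - u x)"
      using q0 by (simp add: pos_divide_le_eq mult.commute)
    also have "\<dots> = u x powr q * (?u x - u x) + (?u x powr q - u x powr q) * (?u x - u x)"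
      by (simp add: algebra_simps)
    also have "\<dots> \<le> u x powr q * (?u x - u x) + \<bar>?u x powr q - u x powr q\<bar> * \<bar>?u x - u x\<bar>"
      unfolding abs_mult[symmetric] by (intro add_left_mono abs_ge_self)
    finally have "(?u x powr (q + 1) - u x powr (q + 1)) / (q + 1) * ?g
        \<le> (u x powr q * (?u x - u x) + \<bar>?u x powr q - u x powr q\<bar> * \<bar>?u x - u x\<bar>) * ?g"
      by (intro mult_right_mono) auto
    moreover have "(?u x powr (q + 1) - u x powr (q + 1)) / (q + 1) * ?g = (F x - rhs x * u x) / (q + 1)"
      using powr_Suc[OF u0, of x] by (simp add: F_def rhs_def algebra_simps)
    moreover have "(u x powr q * (?u x - u x) + \<bar>?u x powr q - u x powr q\<bar> * \<bar>?u x - u x\<bar>) * ?g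
        = rhs x * ?u x - rhs x * u x + \<bar>?u x powr q - u x powr q\<bar> * \<bar>?u x - u x\<bar> * ?g"
      by (simp add: rhs_def algebra_simps)
    ultimately show ?thesis using err by linarith
  qed
  have "(\<integral>x. (F x - rhs x * u x) / (q + 1) \<partial>lborel)
    \<le> (\<integral>x. rhs x * ?u x - rhs x * u x + ((1 - l) * (d / (1 - l) powr p) * D x + (1 - l) * c * power_gap l x) \<partial>lborel)"
    by (rule integral_mono[OF _ _ pw])
      (intro integrable_divide Bochner_Integration.integrable_diff Bochner_Integration.integrable_add
        integrable_mult_right iF iu iul Di Ti)+
  also have "\<dots> = (\<integral>x. rhs x * ?u x \<partial>lborel) - energy
      + ((1 - l) * (d / (1 - l) powr p) * (\<integral>x. D x \<partial>lborel) + (1 - l) * c * (\<integral>x. power_gap l x \<partial>lborel))"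
    using iF iu iul Di Ti by (simp add: energy_eq)
  also have "(1 - l) * (d / (1 - l) powr p) * (\<integral>x. D x \<partial>lborel) \<le> (1 - l) * (d / (1 - l) powr p) * ((1 - l) powr p * M)"
    using l d DM by (intro mult_left_mono) auto
  also have "\<dots> = (1 - l) * (d * M)" using l by simp
  also have "(\<integral>x. (F x - rhs x * u x) / (q + 1) \<partial>lborel) = (l powr (- (DIM('a) + \<alpha>)) - 1) * energy / (q + 1)"
    using iF iu by (simp add: energy_eq intF left_diff_distrib)
  finally show ?thesis unfolding c_def[symmetric] by (simp add: algebra_simps)
qed

text \<open>To first order at \<open>l = 1\<close>, the two bounds give the Pohozaev inequality.\<close>

lemma pohozaev_inequality: "(DIM('a) + \<alpha>) * energy / (q + 1) \<le> (DIM('a) - p) * energy / p"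
proof -
  obtain M where M: "M \<ge> 0" "\<And>l. 1/2 \<le> l \<Longrightarrow> l < 1 \<Longrightarrow>
    (\<integral>\<^sup>+x. ennreal (\<bar>u (l *\<^sub>R x) - u x\<bar> powr p * norm x powr (-p)) \<partial>lborel) \<le> ennreal ((1 - l) powr p * M)"
    using dilation_difference_bound by blast
  define l where "l n = 1 - 1 / (real n + 2)" for n :: nat
  have l: "1/2 \<le> l n" "l n < 1" for n by (auto simp: l_def field_simps)
  have "(\<lambda>n. 1 - 1 / real (n + 2)) \<longlonglongrightarrow> 1 - 0"
    by (intro tendsto_diff tendsto_const LIMSEQ_ignore_initial_segment[of "\<lambda>n. 1 / real n"] lim_1_over_n)
  then have l1: "l \<longlonglongrightarrow> 1" by (simp add: l_def[abs_def] add.commute)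
  have slope: "(\<lambda>n. (l n powr (- s) - 1) / (1 - l n)) \<longlonglongrightarrow> s" for s
  proof -
    have "((\<lambda>t. t powr (- s)) has_real_derivative - s) (at 1)"
      by (auto intro!: derivative_eq_intros)
    then have "((\<lambda>t. (t powr (- s) - 1) / (t - 1)) \<longlongrightarrow> - s) (at 1)"
      by (simp add: has_field_derivative_iff)
    moreover have "filterlim l (at 1) sequentially"
      unfolding filterlim_at using l1 l(2) by (auto intro!: always_eventually simp: less_imp_neq)
    ultimately have "(\<lambda>n. (l n powr (- s) - 1) / (l n - 1)) \<longlonglongrightarrow> - s" by (rule filterlim_compose)
    from tendsto_minus[OF this] show ?thesis by (simp flip: divide_minus_right)
  qed
  show ?thesis
  proof (rule field_le_epsilon)
    fix e :: real assume e: "e > 0"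
    define d where "d = e / (M + 1)"
    have d: "d > 0" using e M(1) by (simp add: d_def)
    have dM: "d * M \<le> e"
    proof -
      have "d * M \<le> d * (M + 1)" using d by simp
      also have "\<dots> = e" using M(1) by (simp add: d_def)
      finally show ?thesis .
    qed
    let ?c = "d powr (- 1 / (p - 1))"
    let ?T = "\<lambda>n. \<integral>x. power_gap (l n) x \<partial>lborel"
    have "(DIM('a) + \<alpha>) * energy / (q + 1) \<le> (DIM('a) - p) * energy / p + (d * M + ?c * 0)"
    proof (rule LIMSEQ_le)
      show "(\<lambda>n. (l n powr (- (DIM('a) + \<alpha>)) - 1) / (1 - l n) * energy / (q + 1)) \<longlonglongrightarrow> (DIM('a) + \<alpha>) * energy / (q + 1)"
        by (intro tendsto_divide tendsto_mult tendsto_const slope) (use p1 q1 in auto)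
      show "(\<lambda>n. (l n powr (- (DIM('a) - p)) - 1) / (1 - l n) * energy / p + (d * M + ?c * ?T n))
          \<longlonglongrightarrow> (DIM('a) - p) * energy / p + (d * M + ?c * 0)"
        by (intro tendsto_divide tendsto_add tendsto_mult tendsto_const slope power_gap_integral_tendsto l l1)
          (use p1 in auto)
      show "\<exists>N. \<forall>n\<ge>N. (l n powr (- (DIM('a) + \<alpha>)) - 1) / (1 - l n) * energy / (q + 1)
          \<le> (l n powr (- (DIM('a) - p)) - 1) / (1 - l n) * energy / p + (d * M + ?c * ?T n)"
      proof (intro exI allI impI)
        fix n
        have pos: "1 - l n > 0" using l[of n] by simp
        let ?a = "l n powr (- (DIM('a) + \<alpha>)) - 1" and ?b = "l n powr (- (DIM('a) - p)) - 1"
        have "?a * energy / (q + 1) \<le> (\<integral>x. rhs x * u (l n *\<^sub>R x) \<partial>lborel) - energy + (1 - l n) * (d * M + ?c * ?T n)"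
          by (rule dilation_lower[OF l d M(1) M(2)[OF l]])
        also have "(\<integral>x. rhs x * u (l n *\<^sub>R x) \<partial>lborel) \<le> (1 - 1/p) * energy + l n powr (p - DIM('a)) * energy / p"
          by (rule dilation_upper[OF l])
        also have "(1 - 1/p) * energy + l n powr (p - DIM('a)) * energy / p - energy = ?b * energy / p"
          by (simp add: algebra_simps diff_divide_distrib)
        finally have "?a * energy / (q + 1) \<le> ?b * energy / p + (1 - l n) * (d * M + ?c * ?T n)" by simp
        then have "?a * energy / (q + 1) / (1 - l n) \<le> (?b * energy / p + (1 - l n) * (d * M + ?c * ?T n)) / (1 - l n)"
          using pos by (intro divide_right_mono) auto
        also have "\<dots> = ?b * energy / p / (1 - l n) + (d * M + ?c * ?T n)"
          using pos by (simp add: add_divide_distrib)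
        finally show "?a / (1 - l n) * energy / (q + 1) \<le> ?b / (1 - l n) * energy / p + (d * M + ?c * ?T n)"
          by (simp add: mult.commute)
      qed
    qed
    with dM show "(DIM('a) + \<alpha>) * energy / (q + 1) \<le> (DIM('a) - p) * energy / p + e" by simp
  qed
qed

lemma energy_zero: "energy = 0"
proof (rule ccontr)
  assume "energy \<noteq> 0"
  then have "energy > 0" using energy_nonneg by simp
  with pohozaev_inequality have "(DIM('a) + \<alpha>) / (q + 1) \<le> (DIM('a) - p) / p"
    by (simp add: mult_le_cancel_right divide_right_mono flip: times_divide_eq_left)
  then have "(real DIM('a) + \<alpha>) * p \<le> (q + 1) * (real DIM('a) - p)"
    using p1 q1 by (simp add: field_simps)
  with subcritical show False by simp
qed

lemma solution_zero: "u x = 0"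
proof -
  have i: "integrable lborel (\<lambda>x. rhs x * u x)" by (rule rhs_mult_integrable[OF u_meas u0 K(2)])
  have "(\<integral>x. rhs x * u x \<partial>lborel) = 0" by (simp add: energy_eq energy_zero)
  then have "AE x in lborel. rhs x * u x = 0"
    using integral_nonneg_eq_0_iff_AE[OF i] rhs_nonneg u0 by simp
  then have "AE x in lborel. u x = 0"
    using AE_lborel_singleton[of "0::'a"] by eventually_elim (auto simp: rhs_def)
  from continuous_AE_zero[OF u_cont this] show ?thesis .
qed

end

section \<open>The Liouville theorem\<close>

theorem theorem1p5:
  fixes u :: "real ^ 'n \<Rightarrow> real" and p q \<alpha> C :: real
  assumes "CARD('n) \<ge> 2"
    and "1 < p" and "p < real CARD('n)"
    and "p - 1 < q" and "q < (real CARD('n) + \<alpha>) * p / (real CARD('n) - p) - 1"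
    and "continuous_solution p \<alpha> q UNIV u"
    and "\<forall>x. 0 \<le> u x"
    and "C > 0"
    and "\<forall>x. norm x powr ((p + \<alpha>) / (q + 1 - p)) * u x \<le> C"
  shows "\<forall>x. u x = 0"
proof -
  obtain G where G: "weak_pair u G" "\<And>R. set_integrable lborel (cball 0 R) (\<lambda>x. norm (G x) powr p)"
    "\<And>R. set_integrable lborel (cball 0 R) (\<lambda>x. norm x powr \<alpha> * u x powr q)"
    "\<And>\<phi>. test_function UNIV \<phi> \<Longrightarrow> (\<integral>x. (norm (G x) powr (p - 2) *\<^sub>R G x) \<bullet> grad \<phi> x \<partial>lborel)
        = (\<integral>x. norm x powr \<alpha> * u x powr q * \<phi> x \<partial>lborel)"
    using continuous_solution_borel[OF assms(6)] by blast
  interpret henon_solution u G p q \<alpha> C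
    by unfold_locales (use assms G in auto)
  show ?thesis using solution_zero by blast
qed

end
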